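(* Let $1 \leq p < 4/3$ and $q = p'/3$, where $\frac1p + \frac1{p'} = 1$ (so $q = \infty$ if $p=1$). There exists a constant $C = C(p) < \infty$ such that for every convex curve $\Gamma \subseteq \mathbb{R}^2$ and every Schwartz function $f \in \mathcal{S}(\mathbb{R}^2)$ we have $$\|\widehat{f}\|_{L^q(\Gamma,\nu)} \leq C \|f\|_{L^p(\mathbb{R}^2)},$$ where $\nu$ is the affine arclength measure on $\Gamma$.
   Context: $\widehat{f}(\xi) = \int_{\mathbb{R}^2} f(x) e^{-2\pi i x\cdot \xi}\,dx$ is the Fourier transform. Convex curve: a convex curve $\Gamma \subseteq \mathbb{R}^2$ is the boundary $\partial K$ of a non-empty open convex set $K \subseteq \mathbb{R}^2$. No smoothness is assumed. Affine arclength measure $\nu$ (compact case): a compact convex curve $\Gamma$ (that is, $K$ bounded) is rectifiable; let $z \colon J = [0,\ell(\Gamma)) \to \Gamma$ be a counterclockwise arclength parametrization, where $\ell(\Gamma)$ is the length of $\Gamma$. The one-sided derivatives of $z$ exist everywhere as unit vectors (with $z$ extended periodically at the endpoints) and agree Lebesgue-almost everywhere, giving $z'$; they are themselves differentiable Lebesgue-almost everywhere with a common derivative $z''$, and $\det\begin{pmatrix} z'(t) & z''(t)\end{pmatrix} \geq 0$ for almost every $t$. The measure $\nu$ on $J$ is defined by $$d\nu(t) = \sqrt[3]{\det \begin{pmatrix} z'(t) & z''(t) \end{pmatrix}}\, dt,$$ and $\nu$ also denotes its push-forward to $\Gamma$ via $z$. Affine arclength measure $\nu$ (non-compact case): for $N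 \in \mathbb{N}$ large enough that $K \cap (-N,N)^2 \neq \varnothing$, let $\Gamma_N = \partial(K \cap [-N,N]^2)$, a compact convex curve, with affine arclength measure $\nu_{\Gamma_N}$. Then $\nu$ on $\Gamma$ is the Borel measure $\nu(E) = \lim_{N \to \infty} \nu_{\Gamma_N}(E \cap (-N,N)^2)$. *)

theory Defs
  imports "HOL-Probability.Essential_Supremum" "HOL-Complex_Analysis.Winding_Numbers"
begin

section \<open>Schwartz functions, Fourier transform, \<open>L\<^sup>q\<close> norms\<close>

definition partial_derivative :: "2 \<Rightarrow> (real^2 \<Rightarrow> complex) \<Rightarrow> real^2 \<Rightarrow> complex" where
  "partial_derivative j f x = frechet_derivative f (at x) (axis j 1)"

text \<open>Lists of coordinate directions play the role of multi-indices. Differentiability of all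
  iterated partial derivatives makes them all continuous, so that \<open>f\<close> is smooth.\<close>

definition schwartz :: "(real^2 \<Rightarrow> complex) \<Rightarrow> bool" where
  "schwartz f \<longleftrightarrow>
     (\<forall>js. (\<forall>x. foldr partial_derivative js f differentiable (at x)) \<and>
           (\<forall>k::nat. bounded (range (\<lambda>x. norm x ^ k *\<^sub>R foldr partial_derivative js f x))))"

definition fourier :: "(real^2 \<Rightarrow> complex) \<Rightarrow> real^2 \<Rightarrow> complex" where
  "fourier f \<xi> = (LINT x|lborel. f x * exp (- (2 * pi * (x \<bullet> \<xi>)) *\<^sub>R \<i>))"

text \<open>Exponents range over the extended reals, and the norm takes the value \<open>\<infinity>\<close> on functions
  outside \<open>L\<^sup>q\<close>.\<close>

definition Lq_norm :: "ennreal \<Rightarrow> 'a measure \<Rightarrow> ('a \<Rightarrow> complex) \<Rightarrow> ennreal" where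
  "Lq_norm q M g =
     (if q = \<infinity> then esssup M (\<lambda>x. ennreal (norm (g x)))
      else let I = (\<integral>\<^sup>+ x. ennreal (norm (g x) powr enn2real q) \<partial>M)
           in if I = \<infinity> then \<infinity> else ennreal (enn2real I powr (1 / enn2real q)))"

section \<open>Affine arclength measure\<close>

text \<open>Length of the curve \<open>z\<close> over \<open>[a, b]\<close>: the supremum of the lengths of inscribed polygons.\<close>

definition curve_length :: "(real \<Rightarrow> 'a::metric_space) \<Rightarrow> real \<Rightarrow> real \<Rightarrow> ennreal" where
  "curve_length z a b =
     (SUP (n, s) \<in> {(n, s :: nat \<Rightarrow> real). mono s \<and> range s \<subseteq> {a..b}}.
        ennreal (\<Sum>i<n. dist (z (s i)) (z (s (Suc i)))))"

definition to_complex :: "real^2 \<Rightarrow> complex" where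
  "to_complex v = Complex (v $ 1) (v $ 2)"

text \<open>\<open>z\<close>, restricted to \<open>[0, L)\<close>, is a counterclockwise arclength parametrization of the closed
  curve \<open>\<Gamma>\<close>; outside of \<open>[0, L)\<close> it is extended \<open>L\<close>-periodically. Necessarily \<open>L\<close> is the length
  of \<open>\<Gamma>\<close>. For \<open>\<Gamma> = frontier K\<close> with \<open>K\<close> open, bounded, convex and nonempty,
  \<open>inside \<Gamma>\<close> is \<open>K\<close>.\<close>

definition ccw_arclength_param :: "(real^2) set \<Rightarrow> real \<Rightarrow> (real \<Rightarrow> real^2) \<Rightarrow> bool" where
  "ccw_arclength_param \<Gamma> L z \<longleftrightarrow>
     0 < L \<and> continuous_on UNIV z \<and> (\<forall>t. z (t + L) = z t) \<and> bij_betw z {0..<L} \<Gamma> \<and>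
     (\<forall>a b. 0 \<le> a \<and> a \<le> b \<and> b \<le> L \<longrightarrow> curve_length z a b = ennreal (b - a)) \<and>
     (\<forall>w \<in> inside \<Gamma>. winding_number (\<lambda>s. to_complex (z (L * s))) (to_complex w) = 1)"

text \<open>For convex curves the right derivative exists everywhere and equals the left derivative
  almost everywhere; \<open>z'\<close> is represented by the right derivative. The second derivative exists
  almost everywhere, and its junk values on the exceptional null set do not affect
  the measure below.\<close>

definition curve_deriv :: "(real \<Rightarrow> real^2) \<Rightarrow> real \<Rightarrow> real^2" where
  "curve_deriv z t = vector_derivative z (at_right t)"

definition curve_deriv2 :: "(real \<Rightarrow> real^2) \<Rightarrow> real \<Rightarrow> real^2" where
  "curve_deriv2 z t = vector_derivative (curve_deriv z) (at t)"

definition affine_arclength_on_interval :: "real \<Rightarrow> (real \<Rightarrow> real^2) \<Rightarrow> real measure" where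
  "affine_arclength_on_interval L z =
     density (lebesgue_on {0..<L})
       (\<lambda>t. ennreal (root 3 (det (transpose (vector [curve_deriv z t, curve_deriv2 z t] :: real^2^2)))))"

text \<open>The parametrization of a compact convex curve is unique up to the choice of
  the starting point \<open>z 0\<close>, which does not affect the push-forward.\<close>

definition compact_affine_arclength :: "(real^2) set \<Rightarrow> (real^2) measure" where
  "compact_affine_arclength \<Gamma> =
     (case Eps (\<lambda>(L, z). ccw_arclength_param \<Gamma> L z) of (L, z) \<Rightarrow>
        distr (affine_arclength_on_interval L z) (restrict_space borel \<Gamma>) z)"

definition truncated_curve :: "(real^2) set \<Rightarrow> nat \<Rightarrow> (real^2) set" where
  "truncated_curve K N = frontier (K \<inter> cbox (vec (- real N)) (vec (real N)))"

text \<open>The affine arclength measure, a measure on the Borel sets of \<open>\<Gamma> = frontier K\<close>, for \<open>K\<close> open,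
  convex and nonempty. The limit ignores the finitely many \<open>N\<close> for which \<open>K\<close> misses
  the open square.\<close>

definition affine_arclength :: "(real^2) set \<Rightarrow> (real^2) measure" where
  "affine_arclength K =
     (if bounded K then compact_affine_arclength (frontier K)
      else measure_of (frontier K) (sets (restrict_space borel (frontier K)))
        (\<lambda>E. lim (\<lambda>N. emeasure (compact_affine_arclength (truncated_curve K N))
                        (E \<inter> box (vec (- real N)) (vec (real N))))))"

end

theory Submission
  imports Defs "HOL-Probability.Probability" "HOL-Complex_Analysis.Riemann_Mapping"
begin

text \<open>The curve is parametrized by arclength, \<open>z' = dir \<theta>\<close> with a monotone tangent
  angle \<open>\<theta>\<close>, so that affine arclength is \<open>\<kappa> powr (1 / 3)\<close> times arclength, where
  \<open>\<kappa> = \<theta>'\<close> exists almost everywhere by Lebesgue's theorem. The curve is cut into ten arcs on which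
  \<open>\<theta>\<close> varies by at most 1. On such an arc the extension operator is squared: \<open>(E g)\<^sup>2\<close>
  is the Fourier transform of a function on the plane, pushed forward by \<open>(s, t) \<mapsto> z s + z t\<close>, a map
  that is injective for \<open>s < t\<close> and whose Jacobian is \<open>sin (\<theta> t - \<theta> s)\<close>. Hausdorff-Young
  reduces the estimate to a Hardy-Littlewood-Sobolev inequality in the variable \<open>\<theta>\<close>, with a constant
  that does not depend on the curve, and duality gives the restriction estimate.

  In the unbounded case the affine arclength measures of the truncated curves agree where the
  truncations do, because the arclength parametrizations differ there by a translation. So the
  limit that defines the measure is monotone, and the uniform bounds pass to it.\<close>

section \<open>Differentiability of monotone functions\<close>

text \<open>Nothing is smooth: \<theta> is only monotone and may have jumps and a singular
  continuous part. These carry no affine arclength, so the analysis runs on the parameters where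
  \<theta>' exists and is positive. There the changes of variables are injective and differentiable,
  and they only have to push a weighted measure below Lebesgue measure. With
  \<open>p = 2 * r / (r + 1)\<close> and \<open>q = 2 * r / (3 * (r - 1))\<close>, the range 1 < p <
  4/3 becomes 1 < r < 2. Dividing the tensor square by the Jacobian and taking r-th powers leaves a
  kernel of size \<open>\<bar>\<theta> s - \<theta> t\<bar> powr (1 - r)\<close>, integrable near
  the diagonal because r < 2. The cube root closes the argument: in \<open>\<kappa> powr (r / 3) =
  \<kappa> * \<kappa> powr ((r - 3) / 3)\<close> the first factor turns arclength into the angle
  variable, and the norm that the Hardy-Littlewood-Sobolev inequality puts on the rest is again a
  norm for affine arclength. The endpoint p = 1 is the trivial sup bound.\<close>

lemma vitali_slope_bound:
  fixes f :: "real \<Rightarrow> real"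
  assumes mono: "mono f" and cont: "continuous_on UNIV f"
    and U: "open U" "E \<subseteq> U" and E: "E \<in> sets borel" and q: "0 \<le> q"
    and slope: "\<And>x e. x \<in> E \<Longrightarrow> e > 0 \<Longrightarrow> \<exists>h. h \<noteq> 0 \<and> \<bar>h\<bar> < e \<and> (f (x + h) - f x) / h > q"
  shows "ennreal q * emeasure lborel E \<le> emeasure (interval_measure f) U"
proof -
  \<comment> \<open>The intervals of \<open>K\<close> need not be centred at points of E: the one
    spanned by x and x + h works for either sign of h. Vitali's theorem selects disjoint ones that
    cover almost all of E, and their increments add up to at most the mass of U.\<close>
  define K where "K = {i :: real \<times> real. 0 < snd i \<and> cball (fst i) (snd i) \<subseteq> U \<and>
     f (fst i + snd i) - f (fst i - snd i) \<ge> q * (2 * snd i)}"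
  have fine: "\<exists>i. i \<in> K \<and> x \<in> cball (fst i) (snd i) \<and> snd i < d" if "x \<in> E" "0 < d" for x d
  proof -
    obtain e where e: "e > 0" "ball x e \<subseteq> U"
      using U \<open>x \<in> E\<close> open_contains_ball by (metis subsetD)
    obtain h where h: "h \<noteq> 0" "\<bar>h\<bar> < min e d" "(f (x + h) - f x) / h > q"
      using slope[OF \<open>x \<in> E\<close>, of "min e d"] e \<open>0 < d\<close> by auto
    let ?i = "(x + h / 2, \<bar>h\<bar> / 2)"
    have "cball (x + h / 2) (\<bar>h\<bar> / 2) \<subseteq> ball x e"
    proof
      fix y assume "y \<in> cball (x + h / 2) (\<bar>h\<bar> / 2)"
      then have "\<bar>x + h / 2 - y\<bar> \<le> \<bar>h\<bar> / 2" by (simp add: dist_real_def)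
      then have "\<bar>x - y\<bar> \<le> \<bar>h\<bar>" by linarith
      then show "y \<in> ball x e" using h by (simp add: dist_real_def)
    qed
    moreover have "f (x + h / 2 + \<bar>h\<bar> / 2) - f (x + h / 2 - \<bar>h\<bar> / 2) \<ge> q * (2 * (\<bar>h\<bar> / 2))"
    proof (cases "h > 0")
      case True
      then have e: "x + h / 2 + \<bar>h\<bar> / 2 = x + h" "x + h / 2 - \<bar>h\<bar> / 2 = x" by auto
      show ?thesis unfolding e using h True by (simp add: field_simps)
    next
      case False
      then have e: "x + h / 2 + \<bar>h\<bar> / 2 = x" "x + h / 2 - \<bar>h\<bar> / 2 = x + h" by auto
      have "h < 0" using False h by auto
      then show ?thesis unfolding e using h by (simp add: field_simps)
    qed
    ultimately have "?i \<in> K" using h e by (auto simp: K_def)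
    moreover have "x \<in> cball (fst ?i) (snd ?i)" by (auto simp: dist_real_def)
    ultimately show ?thesis using h by (intro exI[of _ ?i]) auto
  qed
  obtain C where C: "countable C" "C \<subseteq> K"
    "pairwise (\<lambda>i j. disjnt (cball (fst i) (snd i)) (cball (fst j) (snd j))) C"
    "negligible (E - (\<Union>i\<in>C. cball (fst i) (snd i)))"
    using Vitali_covering_theorem_cballs[of K snd E fst, OF _ fine] by (auto simp: K_def)
  let ?B = "\<lambda>i :: real \<times> real. cball (fst i) (snd i)"
  let ?V = "\<Union>i\<in>C. ?B i"
  have V[measurable]: "?V \<in> sets borel" using C(1) by (intro sets.countable_UN') auto
  have disj: "disjoint_family_on ?B C"
    using C(3) by (auto simp: disjoint_family_on_def pairwise_def disjnt_def)
  have nullEV: "E - ?V \<in> null_sets lborel"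
    using C(4) E V by (simp add: negligible_iff_null_sets null_sets_completion_iff)
  have "emeasure lborel E \<le> emeasure lborel ?V"
  proof (rule emeasure_mono_AE)
    show "AE x in lborel. x \<in> E \<longrightarrow> x \<in> ?V"
      using AE_not_in[OF nullEV] by eventually_elim auto
  qed simp
  then have "ennreal q * emeasure lborel E \<le> ennreal q * emeasure lborel ?V"
    by (rule mult_left_mono) simp
  also have "emeasure lborel ?V = (\<integral>\<^sup>+i. emeasure lborel (?B i) \<partial>count_space C)"
    by (rule emeasure_UN_countable) (use C disj in auto)
  also have "ennreal q * \<dots> = (\<integral>\<^sup>+i. ennreal q * emeasure lborel (?B i) \<partial>count_space C)"
    by (simp add: nn_integral_cmult)
  also have "\<dots> \<le> (\<integral>\<^sup>+i. emeasure (interval_measure f) (?B i) \<partial>count_space C)"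
  proof (rule nn_integral_mono)
    fix i assume "i \<in> space (count_space C)"
    then have "i \<in> K" using C by auto
    then have i: "0 < snd i" "f (fst i + snd i) - f (fst i - snd i) \<ge> q * (2 * snd i)"
      by (auto simp: K_def)
    have "emeasure (interval_measure f) (?B i) = ennreal (f (fst i + snd i) - f (fst i - snd i))"
      using i mono cont by (subst cball_eq_atLeastAtMost, subst emeasure_interval_measure_Icc)
        (auto dest: monoD)
    moreover have "emeasure lborel (?B i) = ennreal (2 * snd i)"
      using i by (subst cball_eq_atLeastAtMost) simp
    ultimately show "ennreal q * emeasure lborel (?B i) \<le> emeasure (interval_measure f) (?B i)"
      using i q by (simp add: ennreal_mult'[symmetric] ennreal_leI)
  qed
  also have "\<dots> = emeasure (interval_measure f) ?V"
    by (rule emeasure_UN_countable[symmetric]) (use C disj in auto)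
  also have "\<dots> \<le> emeasure (interval_measure f) U"
    using C(2) U by (intro emeasure_mono) (auto simp: K_def)
  finally show ?thesis .
qed

text \<open>A measure that gives boxes their volume is Lebesgue measure, and on an interval the
  increments of f and g add up to the length. The complement g = id - f later turns small slopes of
  f into large slopes of g.\<close>

lemma emeasure_interval_measure_add:
  fixes f g :: "real \<Rightarrow> real"
  assumes f: "mono f" "continuous_on UNIV f" and g: "mono g" "continuous_on UNIV g"
    and fg: "\<And>x. f x + g x = x" and A: "A \<in> sets borel"
  shows "emeasure (interval_measure f) A + emeasure (interval_measure g) A = emeasure lborel A"
proof -
  let ?m = "\<lambda>A. emeasure (interval_measure f) A + emeasure (interval_measure g) A"
  define M where "M = measure_of UNIV (sets borel) ?m"
  have sets_M: "sets M = sets borel"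
    unfolding M_def by (metis sets.sigma_sets_eq sets_measure_of space_borel subset_UNIV Pow_UNIV)
  have eM: "emeasure M A = ?m A" if "A \<in> sets borel" for A
    unfolding M_def
  proof (rule emeasure_measure_of_sigma[OF _ _ _ that])
    show "sigma_algebra UNIV (sets (borel :: real measure))"
      using sets.sigma_algebra_axioms[of borel] by simp
    show "positive (sets borel) ?m" by (simp add: positive_def)
    show "countably_additive (sets borel) ?m"
      unfolding countably_additive_def
    proof safe
      fix A :: "nat \<Rightarrow> real set" assume A: "range A \<subseteq> sets borel" "disjoint_family A"
      have "(\<Sum>i. emeasure (interval_measure h) (A i)) = emeasure (interval_measure h) (\<Union>i. A i)" for h
        using A by (intro suminf_emeasure) auto
      then show "(\<Sum>i. ?m (A i)) = ?m (\<Union> (range A))"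
        by (simp add: suminf_add[symmetric])
    qed
  qed
  have Ioo: "emeasure (interval_measure h) {a<..<b} = ennreal (h b - h a)"
    if h: "mono h" "continuous_on UNIV h" and ab: "a \<le> b" for h and a b :: real
  proof (cases "a = b")
    case False
    have pt: "emeasure (interval_measure h) {x} = 0" for x
      using emeasure_interval_measure_Icc[of x x h] h by (auto dest: monoD)
    have "emeasure (interval_measure h) ({a<..<b} \<union> {a,b}) = emeasure (interval_measure h) {a<..<b}"
    proof (rule emeasure_Un_null_set)
      have "{a,b} = {a} \<union> {b}" by auto
      then show "{a,b} \<in> null_sets (interval_measure h)"
        using pt by (metis null_sets.Un null_setsI sets_interval_measure borel_singleton sets.empty_sets)
    qed simp
    moreover have "{a<..<b} \<union> {a,b} = {a..b}" using ab by auto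
    ultimately show ?thesis
      using emeasure_interval_measure_Icc[of a b h] h ab by (auto dest: monoD)
  qed simp
  have "lborel = M"
  proof (rule lborel_eqI)
    fix l u :: real assume "\<And>b. b \<in> Basis \<Longrightarrow> l \<bullet> b \<le> u \<bullet> b"
    then have lu: "l \<le> u" by simp
    have "f l \<le> f u" "g l \<le> g u" using f g lu by (auto dest: monoD)
    moreover have "f u - f l + (g u - g l) = u - l" using fg[of u] fg[of l] by simp
    ultimately show "emeasure M (box l u) = ennreal (\<Prod>b\<in>Basis. (u - l) \<bullet> b)"
      using lu f g by (simp add: eM box_real Ioo ennreal_plus[symmetric] del: ennreal_plus)
  qed (simp add: sets_M)
  then show ?thesis using eM[OF A] by simp
qed

text \<open>In an open U almost as small as E, the Vitali bound gives H-mass at least q |E| and,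
  applied to x - H x, complementary mass at least (1 - p) |E|. The two masses add up to |U|, so (q -
  p) |E| is at most an arbitrarily small excess.\<close>

lemma Lipschitz_mono_slope_gap_null:
  fixes H :: "real \<Rightarrow> real"
  assumes mono: "mono H" and lip: "\<And>x y. \<bar>H x - H y\<bar> \<le> \<bar>x - y\<bar>" and pq: "p < q" "0 \<le> q" "p \<le> 1"
  defines "E \<equiv> {x. (\<forall>e>0. \<exists>h. h \<noteq> 0 \<and> \<bar>h\<bar> < e \<and> (H (x + h) - H x) / h > q) \<and>
                   (\<forall>e>0. \<exists>h. h \<noteq> 0 \<and> \<bar>h\<bar> < e \<and> (H (x + h) - H x) / h < p)}"
  shows "E \<in> null_sets lborel"
proof -
  have contH: "continuous_on UNIV H"
    by (rule lipschitz_on_continuous_on[of 1], rule lipschitz_onI) (use lip in \<open>auto simp: dist_real_def\<close>)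
  \<comment> \<open>It suffices to let \<open>e\<close> run through the numbers 1 / (n + 1); each
    condition is then a union over h of open sets.\<close>
  have [measurable]: "E \<in> sets borel"
  proof -
    have o1: "open {x. \<exists>h. h \<noteq> 0 \<and> \<bar>h\<bar> < e \<and> (H (x + h) - H x) / h > q}" for e
    proof -
      have "{x. \<exists>h. h \<noteq> 0 \<and> \<bar>h\<bar> < e \<and> (H (x + h) - H x) / h > q} =
        (\<Union>h\<in>{h. h \<noteq> 0 \<and> \<bar>h\<bar> < e}. {x. q < (H (x + h) - H x) / h})" by auto
      moreover have "open {x. q < (H (x + h) - H x) / h}" if "h \<noteq> 0" for h
        using that contH by (intro open_Collect_less) (auto intro!: continuous_intros
            continuous_on_compose2[OF contH])
      ultimately show ?thesis by auto
    qed
    have o2: "open {x. \<exists>h. h \<noteq> 0 \<and> \<bar>h\<bar> < e \<and> (H (x + h) - H x) / h < p}" for e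
    proof -
      have "{x. \<exists>h. h \<noteq> 0 \<and> \<bar>h\<bar> < e \<and> (H (x + h) - H x) / h < p} =
        (\<Union>h\<in>{h. h \<noteq> 0 \<and> \<bar>h\<bar> < e}. {x. (H (x + h) - H x) / h < p})" by auto
      moreover have "open {x. (H (x + h) - H x) / h < p}" if "h \<noteq> 0" for h
        using that contH by (intro open_Collect_less) (auto intro!: continuous_intros
            continuous_on_compose2[OF contH])
      ultimately show ?thesis by auto
    qed
    have eq: "E = (\<Inter>n::nat. {x. \<exists>h. h \<noteq> 0 \<and> \<bar>h\<bar> < inverse (real (Suc n)) \<and> (H (x + h) - H x) / h > q}) \<inter>
      (\<Inter>n::nat. {x. \<exists>h. h \<noteq> 0 \<and> \<bar>h\<bar> < inverse (real (Suc n)) \<and> (H (x + h) - H x) / h < p})"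
      (is "_ = ?R")
    proof
      show "E \<subseteq> ?R" unfolding E_def by auto
      show "?R \<subseteq> E"
      proof
        fix x assume x: "x \<in> ?R"
        have "\<exists>h. h \<noteq> 0 \<and> \<bar>h\<bar> < e \<and> (H (x + h) - H x) / h > q" 
             "\<exists>h. h \<noteq> 0 \<and> \<bar>h\<bar> < e \<and> (H (x + h) - H x) / h < p" if e: "e > 0" for e
        proof -
          obtain n where n: "inverse (real (Suc n)) < e" using reals_Archimedean[OF e] by auto
          have "\<exists>h. h \<noteq> 0 \<and> \<bar>h\<bar> < inverse (real (Suc n)) \<and> (H (x + h) - H x) / h > q" 
             "\<exists>h. h \<noteq> 0 \<and> \<bar>h\<bar> < inverse (real (Suc n)) \<and> (H (x + h) - H x) / h < p"
            using x by blast+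
          then show "\<exists>h. h \<noteq> 0 \<and> \<bar>h\<bar> < e \<and> (H (x + h) - H x) / h > q" 
             "\<exists>h. h \<noteq> 0 \<and> \<bar>h\<bar> < e \<and> (H (x + h) - H x) / h < p" using n less_trans by blast+
        qed
        then show "x \<in> E" by (auto simp: E_def)
      qed
    qed
    show ?thesis unfolding eq
      by (intro sets.Int sets.countable_INT) (use o1 o2 in \<open>auto intro!: borel_open\<close>)
  qed
  define g where "g x = x - H x" for x
  have gmono: "mono g"
  proof (rule monoI)
    fix x y :: real assume "x \<le> y"
    then show "g x \<le> g y" using lip[of x y] unfolding g_def by linarith
  qed
  have gcont: "continuous_on UNIV g" unfolding g_def by (intro continuous_intros contH)
  \<comment> \<open>Bounded pieces have finite measure, which allows \<open>m\<close> to be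
    cancelled below.\<close>
  have bdd: "E \<inter> ball 0 R \<in> null_sets lborel" for R :: real
  proof -
    let ?F = "E \<inter> ball 0 R"
    have fin: "emeasure lborel ?F < \<infinity>"
      by (rule emeasure_bounded_finite) auto
    then obtain m where m: "emeasure lborel ?F = ennreal m" "m \<ge> 0" 
      by (cases "emeasure lborel ?F" rule: ennreal_cases) auto
    have le: "(q + (1 - p)) * m \<le> m + e" if "e > 0" for e
    proof -
      obtain U where U: "open U" "?F \<subseteq> U" "emeasure lborel (U - ?F) < e"
        using outer_regular_lborel[of ?F e] \<open>e > 0\<close> by auto
      have "ennreal q * emeasure lborel ?F \<le> emeasure (interval_measure H) U"
      proof (rule vitali_slope_bound[OF mono contH U(1,2)])
        fix x e :: real assume "x \<in> ?F" "0 < e"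
        then show "\<exists>h. h \<noteq> 0 \<and> \<bar>h\<bar> < e \<and> q < (H (x + h) - H x) / h" by (simp add: E_def)
      qed (use pq in simp_all)
      moreover have "ennreal (1 - p) * emeasure lborel ?F \<le> emeasure (interval_measure g) U"
      proof (rule vitali_slope_bound[OF gmono gcont U(1,2)])
        fix x e :: real assume "x \<in> ?F" "0 < e"
        then obtain h where h: "h \<noteq> 0" "\<bar>h\<bar> < e" "(H (x + h) - H x) / h < p" by (auto simp: E_def)
        have "(g (x + h) - g x) / h = 1 - (H (x + h) - H x) / h"
          using h by (simp add: g_def field_simps)
        then show "\<exists>h. h \<noteq> 0 \<and> \<bar>h\<bar> < e \<and> 1 - p < (g (x + h) - g x) / h"
          using h by (intro exI[of _ h]) auto
      qed (use pq in simp_all)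
      ultimately have "ennreal q * emeasure lborel ?F + ennreal (1 - p) * emeasure lborel ?F
          \<le> emeasure (interval_measure H) U + emeasure (interval_measure g) U"
        by (rule add_mono)
      also have "\<dots> = emeasure lborel U"
        by (rule emeasure_interval_measure_add[OF mono contH gmono gcont]) (use U in \<open>auto simp: g_def\<close>)
      also have "\<dots> = emeasure lborel ?F + emeasure lborel (U - ?F)"
        using U by (subst plus_emeasure) (auto intro!: arg_cong[where f="emeasure lborel"])
      also have "\<dots> \<le> ennreal m + ennreal e" using U m by (intro add_mono) auto
      finally show ?thesis
        using m pq that by (simp add: ennreal_mult'[symmetric] ennreal_plus[symmetric] distrib_right del: ennreal_plus)
    qed
    have "(q + (1 - p)) * m \<le> m" by (rule field_le_epsilon) (use le in auto)
    then have "(q - p) * m \<le> 0" by (simp add: algebra_simps)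
    then have "m \<le> 0" using pq by (simp add: mult_le_0_iff)
    then show ?thesis using m by (auto intro!: null_setsI)
  qed
  have "E = (\<Union>n::nat. E \<inter> ball 0 (real n))"
    by (auto simp: dist_real_def reals_Archimedean2)
  also have "\<dots> \<in> null_sets lborel" using bdd by (intro null_sets_UN) auto
  finally show ?thesis .
qed

text \<open>Where the difference quotient has no limit, two rationals p < q separate its lower from
  its upper limit, and there are only countably many such pairs.\<close>

lemma Lipschitz_mono_AE_differentiable:
  fixes H :: "real \<Rightarrow> real"
  assumes mono: "mono H" and lip: "\<And>x y. \<bar>H x - H y\<bar> \<le> \<bar>x - y\<bar>"
  shows "negligible {x. \<not> H differentiable (at x)}"
proof -
  define E where "E p q = {x. (\<forall>e>0. \<exists>h. h \<noteq> 0 \<and> \<bar>h\<bar> < e \<and> (H (x + h) - H x) / h > q) \<and>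
                   (\<forall>e>0. \<exists>h. h \<noteq> 0 \<and> \<bar>h\<bar> < e \<and> (H (x + h) - H x) / h < p)}" for p q
  have null: "(\<Union>p\<in>\<rat>\<inter>{0..1}. \<Union>q\<in>\<rat>\<inter>{p<..}. E p q) \<in> null_sets lborel"
    using Lipschitz_mono_slope_gap_null[OF mono lip] 
    by (intro null_sets_UN') (auto simp: E_def countable_rat intro!: countable_Int1)
  have quot: "0 \<le> (H (x + h) - H x) / h \<and> (H (x + h) - H x) / h \<le> 1" for x h
  proof (cases "h = 0")
    case False
    then show ?thesis
      using lip[of "x + h" x] mono[THEN monoD, of x "x+h"] mono[THEN monoD, of "x+h" x]
      by (cases "h > 0") (auto simp: field_simps)
  qed simp
  have "H differentiable (at x)" if x: "x \<notin> (\<Union>p\<in>\<rat>\<inter>{0..1}. \<Union>q\<in>\<rat>\<inter>{p<..}. E p q)" for x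
  proof -
    let ?Q = "\<lambda>h. (H (x + h) - H x) / h"
    \<comment> \<open>The supremum of \<open>S\<close> is the lower limit of the quotient at 0. All
      quotients lie in [0, 1], so it does too.\<close>
    define S where "S = {p. 0 \<le> p \<and> p \<le> 1 \<and> eventually (\<lambda>h. p \<le> ?Q h) (at 0)}"
    have S0: "0 \<in> S" using quot by (simp add: S_def)
    have Sb: "bdd_above S" by (rule bdd_aboveI[of _ 1]) (simp add: S_def)
    define l where "l = Sup S"
    have "0 \<le> l" unfolding l_def by (rule cSup_upper[OF S0 Sb])
    moreover have "l \<le> 1" unfolding l_def
    proof (rule cSup_least)
      show "S \<noteq> {}" using S0 by blast
    qed (simp add: S_def)
    ultimately have l: "0 \<le> l" "l \<le> 1" by simp_all
    have ev: "eventually (\<lambda>h. P (?Q h)) (at 0)" if "\<not> (\<forall>e>0. \<exists>h. h \<noteq> 0 \<and> \<bar>h\<bar> < e \<and> \<not> P (?Q h))" for P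
    proof -
      from that[unfolded not_all not_imp] obtain e where e: "e > 0" "\<not> (\<exists>h. h \<noteq> 0 \<and> \<bar>h\<bar> < e \<and> \<not> P (?Q h))"
        by (elim exE conjE)
      show ?thesis unfolding eventually_at
      proof (intro exI[of _ e] conjI ballI impI)
        fix h :: real assume "h \<noteq> 0 \<and> dist h 0 < e"
        then show "P (?Q h)" using e(2) by (metis dist_0_norm dist_commute real_norm_def)
      qed (rule e(1))
    qed
    have "(?Q \<longlongrightarrow> l) (at 0)"
    proof (rule order_tendstoI)
      fix a assume "a < l"
      then obtain p where "p \<in> S" "a < p" using less_cSup_iff[of S a] S0 Sb unfolding l_def by auto
      then show "eventually (\<lambda>h. a < ?Q h) (at 0)"
        by (auto simp: S_def elim!: eventually_mono)
    next
      fix a assume "l < a"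
      show "eventually (\<lambda>h. ?Q h < a) (at 0)"
      proof (cases "a > 1")
        case True
        then show ?thesis using quot by (intro always_eventually) (auto intro: le_less_trans)
      next
        case False
        obtain q where q: "q \<in> \<rat>" "l < q" "q < a" using Rats_dense_in_real[OF \<open>l < a\<close>] by auto
        obtain p where p: "p \<in> \<rat>" "l < p" "p < q" using Rats_dense_in_real[OF \<open>l < q\<close>] by auto
        have "p \<notin> S" using p cSup_upper[OF _ Sb, of p] unfolding l_def by auto
        then have "\<not> eventually (\<lambda>h. \<not> ?Q h < p) (at 0)"
          using p q l False by (auto simp: S_def not_less)
        then have "\<forall>e>0. \<exists>h. h \<noteq> 0 \<and> \<bar>h\<bar> < e \<and> ?Q h < p"
          using ev[of "\<lambda>y. \<not> y < p"] by auto
        moreover have "x \<notin> E p q" using x p q l False by auto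
        ultimately have "\<not> (\<forall>e>0. \<exists>h. h \<noteq> 0 \<and> \<bar>h\<bar> < e \<and> q < ?Q h)" by (auto simp: E_def)
        then have "eventually (\<lambda>h. \<not> q < ?Q h) (at 0)" using ev[of "\<lambda>y. \<not> q < y"] by auto
        then show ?thesis by eventually_elim (use q in auto)
      qed
    qed
    then have "(H has_real_derivative l) (at x)" by (simp add: DERIV_def)
    then show ?thesis using real_differentiable_def by blast
  qed
  then have "{x. \<not> H differentiable (at x)} \<subseteq> (\<Union>p\<in>\<rat>\<inter>{0..1}. \<Union>q\<in>\<rat>\<inter>{p<..}. E p q)" by blast
  moreover have "negligible (\<Union>p\<in>\<rat>\<inter>{0..1}. \<Union>q\<in>\<rat>\<inter>{p<..}. E p q)"
    using null by (simp add: negligible_iff_null_sets null_sets_completionI)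
  ultimately show ?thesis by (rule negligible_subset[rotated])
qed

text \<open>The one-dimensional Sard theorem. The detour through \<open>real^1\<close> is made
  because \<open>baby_Sard\<close> speaks of the rank of a matrix.\<close>

lemma negligible_image_zero_deriv:
  fixes H :: "real \<Rightarrow> real"
  assumes "\<And>x. x \<in> S \<Longrightarrow> (H has_real_derivative 0) (at x)"
  shows "negligible (H ` S)"
proof -
  let ?H = "\<lambda>v :: real^1. vec (H (v $ 1)) :: real^1"
  have "negligible (?H ` (vec ` S))"
  proof (rule baby_Sard[where f' = "\<lambda>_ _. 0"])
    fix x :: "real^1" assume "x \<in> vec ` S"
    then have "(H has_derivative (\<lambda>h. 0)) (at (x $ 1))" 
      using assms by (auto simp: has_field_derivative_def lambda_zero)
    then have "((\<lambda>v. H (v $ 1)) has_derivative (\<lambda>h. 0)) (at x within vec ` S)"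
      using has_derivative_compose[of "\<lambda>v::real^1. v $ 1" "\<lambda>v. v $ 1" x "vec ` S" H "\<lambda>h. 0"]
        bounded_linear.has_derivative[OF bounded_linear_vec_nth has_derivative_ident] by blast
    then show "(?H has_derivative (\<lambda>_. 0)) (at x within vec ` S)"
      by (auto simp: has_derivative_componentwise_within[of ?H] Basis_vec_def inner_axis)
  next
    show "rank (matrix (\<lambda>_::real^1. 0::real^1)) < CARD(1)" 
      by (simp add: matrix_def zero_vec_def[symmetric]) 
  qed simp
  then have "negligible ((\<lambda>v::real^1. v $ 1) ` (?H ` (vec ` S)))"
  proof (rule negligible_locally_Lipschitz_image[rotated])
    fix x :: "real^1"
    show "\<exists>T B. open T \<and> x \<in> T \<and> (\<forall>y\<in>?H ` (vec ` S) \<inter> T. norm (y $ 1 - x $ 1) \<le> B * norm (y - x))"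
      by (rule exI[of _ UNIV], rule exI[of _ 1]) (metis UNIV_I component_le_norm_cart mult_1 open_UNIV real_norm_def vector_minus_component)
  qed simp
  moreover have "(\<lambda>v::real^1. v $ 1) ` (?H ` (vec ` S)) = H ` S" by (auto simp: image_image)
  ultimately show ?thesis by simp
qed

text \<open>The Lipschitz case is transferred to f by inversion: G = id + f expands distances, so
  its generalized inverse H is monotone and 1-Lipschitz. At a continuity point x of f where H' is
  nonzero at G x, the inverse function rule differentiates G. The exceptional x are values of H on a
  null set or on its critical set, or are among the countably many jumps of f.\<close>

theorem mono_AE_differentiable:
  fixes f :: "real \<Rightarrow> real"
  assumes mono: "mono f"
  shows "\<exists>N\<in>null_sets lborel. \<forall>x. x \<notin> N \<longrightarrow> f differentiable (at x)"
proof -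
  define G where "G x = x + f x" for x
  have G: "y - x \<le> G y - G x" if "x \<le> y" for x y
    using monoD[OF mono that] by (simp add: G_def)
  define T where "T y = {x. G x \<le> y}" for y
  define H where "H y = Sup (T y)" for y
  have T_ne: "T y \<noteq> {}" for y
  proof -
    have "f (min 0 (y - f 0)) \<le> f 0" by (rule monoD[OF mono]) simp
    then have "min 0 (y - f 0) \<in> T y" by (simp add: T_def G_def)
    then show ?thesis by auto
  qed
  have T_bdd: "bdd_above (T y)" for y
  proof (rule bdd_aboveI[of _ "max 0 (y - f 0)"])
    fix x assume "x \<in> T y"
    then show "x \<le> max 0 (y - f 0)" using monoD[OF mono, of 0 x]
      by (cases "0 \<le> x") (auto simp: T_def G_def)
  qed
  have HG: "H (G x) = x" for x
    unfolding H_def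
  proof (rule cSup_eq_maximum)
    show "x \<in> T (G x)" by (simp add: T_def)
    fix y assume "y \<in> T (G x)"
    then show "y \<le> x" using G[of x y] by (cases "x \<le> y") (auto simp: T_def)
  qed
  have Hmono: "mono H" unfolding H_def
    by (intro monoI cSup_subset_mono T_ne T_bdd) (auto simp: T_def)
  have Hle: "H y' \<le> H y + (y' - y)" if "y \<le> y'" for y y'
    unfolding H_def
  proof (rule cSup_least[OF T_ne])
    fix x assume "x \<in> T y'"
    then have "x - (y' - y) \<in> T y" using that G[of "x - (y' - y)" x] by (auto simp: T_def)
    then have "x - (y' - y) \<le> Sup (T y)" by (rule cSup_upper[OF _ T_bdd])
    then show "x \<le> Sup (T y) + (y' - y)" by simp
  qed
  have Hlip: "\<bar>H x - H y\<bar> \<le> \<bar>x - y\<bar>" for x y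
    using Hle[of x y] Hle[of y x] monoD[OF Hmono, of x y] monoD[OF Hmono, of y x] by (cases "x \<le> y") auto
  let ?N1 = "{y. \<not> H differentiable (at y)}"
  let ?N2 = "{y. (H has_real_derivative 0) (at y)}"
  let ?N3 = "{x. \<not> isCont f x}"
  have "negligible (H ` ?N1)"
    using Lipschitz_mono_AE_differentiable[OF Hmono Hlip]
  proof (rule negligible_locally_Lipschitz_image[rotated])
    fix x
    show "\<exists>T B. open T \<and> x \<in> T \<and> (\<forall>y\<in>?N1 \<inter> T. norm (H y - H x) \<le> B * norm (y - x))"
      by (rule exI[of _ UNIV], rule exI[of _ 1]) (use Hlip in auto)
  qed simp
  moreover have "negligible (H ` ?N2)" by (rule negligible_image_zero_deriv) auto
  moreover have "negligible ?N3" 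
    using countable_imp_null_set_lborel[OF mono_ctble_discont[OF mono]]
    by (simp add: negligible_iff_null_sets null_sets_completionI)
  ultimately have neg: "negligible (H ` ?N1 \<union> H ` ?N2 \<union> ?N3)" by auto
  have sub: "f differentiable (at x)" if x: "x \<notin> H ` ?N1 \<union> H ` ?N2 \<union> ?N3" for x
  proof -
    have "G x \<notin> ?N1" "G x \<notin> ?N2" using x HG[of x] by (auto simp: image_iff) 
    then obtain D where D: "(H has_real_derivative D) (at (G x))" "D \<noteq> 0"
      using real_differentiable_def by auto
    have "isCont f x" using x by auto
    then have "isCont G x" unfolding G_def by (intro continuous_intros)
    then have "(G has_real_derivative inverse D) (at x)"
      using DERIV_inverse_function[where f = H and g = G and x = x and a = "x - 1" and b = "x + 1", OF D] HG by auto
    then have "((\<lambda>x. G x - x) has_real_derivative inverse D - 1) (at x)" by (intro derivative_intros)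
    moreover have "(\<lambda>x. G x - x) = f" by (auto simp: G_def)
    ultimately show ?thesis using real_differentiable_def by auto
  qed
  have "H ` ?N1 \<union> H ` ?N2 \<union> ?N3 \<in> null_sets lebesgue" using neg by (simp add: negligible_iff_null_sets)
  then obtain N where N: "N \<in> null_sets lborel" "H ` ?N1 \<union> H ` ?N2 \<union> ?N3 \<subseteq> N"
    unfolding null_sets_completion_iff2 by blast
  show ?thesis
  proof (intro bexI[OF _ N(1)] allI impI)
    fix x assume "x \<notin> N"
    then have "x \<notin> H ` ?N1 \<union> H ` ?N2 \<union> ?N3" using N(2) by blast
    then show "f differentiable (at x)" by (rule sub)
  qed
qed

section \<open>Fractional integration\<close>

lemma nn_integral_even_le:
  fixes f :: "real \<Rightarrow> ennreal"
  assumes [measurable]: "f \<in> borel_measurable borel" and even: "\<And>x. f (- x) = f x"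
  shows "(\<integral>\<^sup>+x. f x \<partial>lborel) \<le> 2 * (\<integral>\<^sup>+x. f x * indicator {0..} x \<partial>lborel)"
proof -
  have "(\<integral>\<^sup>+x. f x \<partial>lborel) \<le> (\<integral>\<^sup>+x. f x * indicator {0..} x + f x * indicator {..0} x \<partial>lborel)"
    by (intro nn_integral_mono) (auto simp: indicator_def)
  also have "\<dots> = (\<integral>\<^sup>+x. f x * indicator {0..} x \<partial>lborel) + (\<integral>\<^sup>+x. f x * indicator {..0} x \<partial>lborel)"
    by (rule nn_integral_add) auto
  also have "(\<integral>\<^sup>+x. f x * indicator {..0} x \<partial>lborel) = (\<integral>\<^sup>+x. f (0 + (-1) * x) * indicator {..0} (0 + (-1) * x) \<partial>lborel)"
    by (subst nn_integral_real_affine[where c = "-1" and t = 0]) auto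
  also have "\<dots> = (\<integral>\<^sup>+x. f x * indicator {0..} x \<partial>lborel)"
    by (intro nn_integral_cong) (auto simp: even indicator_def)
  finally show ?thesis by (simp add: mult_2)
qed

lemma nn_integral_abs_powr_near:
  fixes s R :: real
  assumes "s < 1" "0 \<le> R"
  shows "(\<integral>\<^sup>+y. ennreal (\<bar>y\<bar> powr (- s)) * indicator {- R..R} y \<partial>lborel) \<le> ennreal (2 * R powr (1 - s) / (1 - s))"
proof -
  have "(\<integral>\<^sup>+y. ennreal (\<bar>y\<bar> powr (- s)) * indicator {- R..R} y \<partial>lborel) \<le>
     2 * (\<integral>\<^sup>+y. ennreal (\<bar>y\<bar> powr (- s)) * indicator {- R..R} y * indicator {0..} y \<partial>lborel)"
    by (rule nn_integral_even_le) (auto simp: indicator_def)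
  also have "(\<integral>\<^sup>+y. ennreal (\<bar>y\<bar> powr (- s)) * indicator {- R..R} y * indicator {0..} y \<partial>lborel)
     = (\<integral>\<^sup>+y. ennreal (y powr (- s)) * indicator {0..R} y \<partial>lborel)"
    by (intro nn_integral_cong) (auto simp: indicator_def)
  also have "\<dots> = ennreal (R powr (- s + 1) / (- s + 1))"
    by (rule nn_integral_has_integral_lebesgue'[OF _ has_integral_powr_from_0]) (use assms in auto)
  finally show ?thesis using assms by (simp add: ennreal_mult'[symmetric] flip: ennreal_numeral)
qed

lemma nn_integral_abs_powr_far:
  fixes R :: real
  assumes "0 < R"
  shows "(\<integral>\<^sup>+y. ennreal (\<bar>y\<bar> powr (- 2)) * indicator {y. R < \<bar>y\<bar>} y \<partial>lborel) \<le> ennreal (2 / R)"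
proof -
  have "(\<integral>\<^sup>+y. ennreal (\<bar>y\<bar> powr (- 2)) * indicator {y. R < \<bar>y\<bar>} y \<partial>lborel) \<le>
     2 * (\<integral>\<^sup>+y. ennreal (\<bar>y\<bar> powr (- 2)) * indicator {y. R < \<bar>y\<bar>} y * indicator {0..} y \<partial>lborel)"
    by (rule nn_integral_even_le) (auto simp: indicator_def)
  also have "(\<integral>\<^sup>+y. ennreal (\<bar>y\<bar> powr (- 2)) * indicator {y. R < \<bar>y\<bar>} y * indicator {0..} y \<partial>lborel)
     \<le> (\<integral>\<^sup>+y. ennreal (y powr (- 2)) * indicator {R..} y \<partial>lborel)"
    by (intro nn_integral_mono) (auto simp: indicator_def)
  also have "\<dots> = ennreal (- (R powr (- 2 + 1)) / (- 2 + 1))"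
    by (rule nn_integral_has_integral_lebesgue'[OF _ has_integral_powr_to_inf]) (use assms in auto)
  also have "- (R powr (- 2 + 1)) / (- 2 + 1) = 1 / R"
    using assms by (simp add: powr_minus_divide)
  finally show ?thesis using assms
    by (simp add: mult_left_mono ennreal_mult'[symmetric] flip: ennreal_numeral)
qed

text \<open>Near the singularity v is replaced by its bound h. Far away
  \<open>v * \<bar>y\<bar> powr (- s)\<close> is \<open>R powr (- s / 2)\<close> times a geometric
  mean, with weights 1 - s / 2 and s / 2, of \<open>v powr m\<close> and
  \<open>R * \<bar>y\<bar> powr (- 2)\<close>; the value of m makes the first factor come out as
  v.\<close>

lemma fractional_kernel_Young:
  fixes v h y R s m :: real
  assumes s: "0 < s" "s < 1" and m: "m = 2 / (2 - s)" and v: "0 \<le> v" "v \<le> h" and R: "0 < R"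
  shows "v * \<bar>y\<bar> powr (- s) \<le> h * (\<bar>y\<bar> powr (- s) * indicator {- R..R} y) +
     R powr (- s / 2) * (v powr m + R * (\<bar>y\<bar> powr (- 2) * indicator {y. R < \<bar>y\<bar>} y))"
proof (cases "\<bar>y\<bar> \<le> R")
  case True
  then have "v * \<bar>y\<bar> powr (- s) \<le> h * \<bar>y\<bar> powr (- s)" using v by (intro mult_right_mono) auto
  moreover have "0 \<le> R powr (- s / 2) * v powr m" by simp
  ultimately have "v * \<bar>y\<bar> powr (- s) \<le> h * \<bar>y\<bar> powr (- s) + R powr (- s / 2) * v powr m" by linarith
  moreover have "indicator {- R..R} y = (1 :: real)" "indicator {y. R < \<bar>y\<bar>} y = (0 :: real)"
    using True by (auto simp: indicator_def)
  ultimately show ?thesis by simp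
next
  case False
  show ?thesis
  proof (cases "v = 0")
    case True
    then show ?thesis using v R by (auto simp: indicator_def)
  next
    case v0: False
    let ?X = "R * \<bar>y\<bar> powr (- 2)"
    have y: "\<bar>y\<bar> > 0" "R < \<bar>y\<bar>" using False R by auto
    have X: "0 < ?X" using y R by simp
    have "(v powr m) powr (1 - s / 2) * ?X powr (s / 2) \<le> (1 - s / 2) * v powr m + (s / 2) * ?X"
      using s v v0 X by (intro Youngs_inequality_0) auto
    also have "\<dots> \<le> 1 * v powr m + 1 * ?X" using s X by (intro add_mono mult_right_mono) auto
    finally have Y: "(v powr m) powr (1 - s / 2) * ?X powr (s / 2) \<le> v powr m + ?X" by simp
    have "m * (1 - s / 2) = 1" using s m by (simp add: field_simps)
    then have "(v powr m) powr (1 - s / 2) = v" using v by (simp add: powr_powr)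
    moreover have "?X powr (s / 2) = R powr (s / 2) * \<bar>y\<bar> powr (- s)"
      using R by (simp add: powr_mult powr_powr)
    ultimately have "R powr (- s / 2) * (v * (R powr (s / 2) * \<bar>y\<bar> powr (- s))) \<le> R powr (- s / 2) * (v powr m + ?X)"
      using Y by (intro mult_left_mono) auto
    moreover have "R powr (- s / 2) * (v * (R powr (s / 2) * \<bar>y\<bar> powr (- s))) = v * \<bar>y\<bar> powr (- s)"
    proof -
      have "R powr (- s / 2) * R powr (s / 2) = 1" using R by (simp flip: powr_add)
      then show ?thesis by (metis (no_types, opaque_lifting) mult.assoc mult.left_commute mult_1)
    qed
    ultimately have "v * \<bar>y\<bar> powr (- s) \<le> R powr (- s / 2) * (v powr m + ?X)" by (simp only:)
    moreover have "indicator {- R..R} y = (0 :: real)" "indicator {y. R < \<bar>y\<bar>} y = (1 :: real)"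
      using y by (auto simp: indicator_def)
    ultimately show ?thesis by simp
  qed
qed

lemma fractional_integral_sublevel:
  fixes v \<psi> :: "'a \<Rightarrow> real"
  assumes [measurable]: "v \<in> borel_measurable M" "\<psi> \<in> borel_measurable M"
    and push: "\<And>g. g \<in> borel_measurable borel \<Longrightarrow> (\<integral>\<^sup>+t. g (\<psi> t) \<partial>M) \<le> (\<integral>\<^sup>+y. g y \<partial>lborel)"
    and s: "0 < s" "s < 1" and m: "m = 2 / (2 - s)" and v: "\<And>t. 0 \<le> v t"
    and vm: "(\<integral>\<^sup>+t. ennreal (v t powr m) \<partial>M) \<le> 1" and h: "0 < h"
  shows "(\<integral>\<^sup>+t. ennreal (v t * \<bar>\<psi> t - c\<bar> powr (- s)) * indicator {t. v t \<le> h} t \<partial>M)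
          \<le> ennreal ((2 / (1 - s) + 3) * h powr (m - 1))"
proof -
  have push': "(\<integral>\<^sup>+t. g (\<psi> t - c) \<partial>M) \<le> (\<integral>\<^sup>+y. g y \<partial>lborel)" if [measurable]: "g \<in> borel_measurable borel" for g
  proof -
    have "(\<integral>\<^sup>+t. g (\<psi> t - c) \<partial>M) \<le> (\<integral>\<^sup>+y. g (y - c) \<partial>lborel)"
      using push[of "\<lambda>y. g (y - c)"] by simp
    also have "\<dots> = (\<integral>\<^sup>+y. g y \<partial>lborel)"
      using nn_integral_real_affine[of g 1 "- c"] by simp
    finally show ?thesis .
  qed
  \<comment> \<open>This radius balances the two regions: \<open>h * R powr (1 - s)\<close> and
    \<open>R powr (- s / 2)\<close> both equal \<open>h powr (m - 1)\<close>. The 3 in the constant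
    is 1 from the norm of v plus R * (2 / R) from the tail of the kernel.\<close>
  define R where "R = h powr (- m)"
  have R: "0 < R" using h by (simp add: R_def)
  let ?n = "\<lambda>y. ennreal (\<bar>y\<bar> powr (- s)) * indicator {- R..R} y"
  let ?f = "\<lambda>y. ennreal (\<bar>y\<bar> powr (- 2)) * indicator {y. R < \<bar>y\<bar>} y"
  have "(\<integral>\<^sup>+t. ennreal (v t * \<bar>\<psi> t - c\<bar> powr (- s)) * indicator {t. v t \<le> h} t \<partial>M) \<le>
    (\<integral>\<^sup>+t. ennreal h * ?n (\<psi> t - c) + ennreal (R powr (- s / 2)) * (ennreal (v t powr m) + ennreal R * ?f (\<psi> t - c)) \<partial>M)"
  proof (intro nn_integral_mono)
    fix t
    have "ennreal (v t * \<bar>\<psi> t - c\<bar> powr (- s)) \<le> 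
       ennreal h * ?n (\<psi> t - c) + ennreal (R powr (- s / 2)) * (ennreal (v t powr m) + ennreal R * ?f (\<psi> t - c))" if "v t \<le> h"
    proof -
      have "ennreal (v t * \<bar>\<psi> t - c\<bar> powr (- s)) \<le> ennreal (h * (\<bar>\<psi> t - c\<bar> powr (- s) * indicator {- R..R} (\<psi> t - c)) +
       R powr (- s / 2) * (v t powr m + R * (\<bar>\<psi> t - c\<bar> powr (- 2) * indicator {y. R < \<bar>y\<bar>} (\<psi> t - c))))"
        by (intro ennreal_leI fractional_kernel_Young s m v that R)
      also have "\<dots> = ennreal h * ?n (\<psi> t - c) + ennreal (R powr (- s / 2)) * (ennreal (v t powr m) + ennreal R * ?f (\<psi> t - c))"
        using h R by (simp add: ennreal_plus ennreal_mult' ennreal_indicator)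
      finally show ?thesis .
    qed
    then show "ennreal (v t * \<bar>\<psi> t - c\<bar> powr (- s)) * indicator {t. v t \<le> h} t \<le> 
       ennreal h * ?n (\<psi> t - c) + ennreal (R powr (- s / 2)) * (ennreal (v t powr m) + ennreal R * ?f (\<psi> t - c))"
      by (auto simp: indicator_def)
  qed
  also have "\<dots> = ennreal h * (\<integral>\<^sup>+t. ?n (\<psi> t - c) \<partial>M) + ennreal (R powr (- s / 2)) *
      ((\<integral>\<^sup>+t. ennreal (v t powr m) \<partial>M) + ennreal R * (\<integral>\<^sup>+t. ?f (\<psi> t - c) \<partial>M))"
    by (simp add: nn_integral_add nn_integral_cmult)
  also have "\<dots> \<le> ennreal h * ennreal (2 * R powr (1 - s) / (1 - s)) + ennreal (R powr (- s / 2)) * (1 + ennreal R * ennreal (2 / R))"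
    using push'[of ?n] push'[of ?f] nn_integral_abs_powr_near[of s R] nn_integral_abs_powr_far[of R] s R vm
    by (intro add_mono mult_left_mono) (auto intro: order_trans)
  also have "\<dots> = ennreal (h * (2 * R powr (1 - s) / (1 - s)) + R powr (- s / 2) * (1 + R * (2 / R)))"
  proof -
    have *: "ennreal h * ennreal x + ennreal r * (1 + ennreal R * ennreal y) = ennreal (h * x + r * (1 + R * y))"
      if "0 \<le> x" "0 \<le> r" "0 \<le> y" for x r y
      using that h R by (simp add: ennreal_plus ennreal_mult')
    show ?thesis by (rule *) (use R s in auto)
  qed
  also have "h * (2 * R powr (1 - s) / (1 - s)) + R powr (- s / 2) * (1 + R * (2 / R)) = (2 / (1 - s) + 3) * h powr (m - 1)"
  proof -
    have ms: "m * s = 2 * m - 2" using m s by (simp add: field_simps)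
    have "h * R powr (1 - s) = h powr (1 + (- m) * (1 - s))"
      using h unfolding R_def powr_powr by (subst powr_add) auto
    also have "1 + (- m) * (1 - s) = m - 1" using ms by (simp add: algebra_simps)
    finally have 1: "h * R powr (1 - s) = h powr (m - 1)" .
    have 2: "R powr (- s / 2) = h powr (m - 1)"
    proof -
      have "- m * (- s / 2) = m * s / 2" by simp
      also have "\<dots> = m - 1" using ms by linarith
      finally have "- m * (- s / 2) = m - 1" .
      then show ?thesis unfolding R_def powr_powr by (rule arg_cong)
    qed
    have "h * (2 * R powr (1 - s) / (1 - s)) = 2 / (1 - s) * (h * R powr (1 - s))" by simp
    then show ?thesis unfolding 1 2 using R by (simp add: algebra_simps)
  qed
  finally show ?thesis .
qed

text \<open>Symmetry lets one integrate first over the smaller of \<open>v s\<close>, \<open>v t\<close>, which makes the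
  Hardy-Littlewood-Sobolev inequality at the diagonal exponent elementary.\<close>

theorem Hardy_Littlewood_Sobolev_pushforward:
  fixes v \<psi> :: "'a \<Rightarrow> real"
  assumes "sigma_finite_measure M"
    and [measurable]: "v \<in> borel_measurable M" "\<psi> \<in> borel_measurable M"
    and push: "\<And>g. g \<in> borel_measurable borel \<Longrightarrow> (\<integral>\<^sup>+t. g (\<psi> t) \<partial>M) \<le> (\<integral>\<^sup>+y. g y \<partial>lborel)"
    and s: "0 < s" "s < 1" and m: "m = 2 / (2 - s)" and v: "\<And>t. 0 \<le> v t"
    and vm: "(\<integral>\<^sup>+t. ennreal (v t powr m) \<partial>M) \<le> 1"
  shows "(\<integral>\<^sup>+x. \<integral>\<^sup>+t. ennreal (v x * v t * \<bar>\<psi> x - \<psi> t\<bar> powr (- s)) \<partial>M \<partial>M) \<le> ennreal (2 * (2 / (1 - s) + 3))"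
proof -
  interpret sigma_finite_measure M by fact
  interpret P: pair_sigma_finite M M ..
  let ?C = "2 / (1 - s) + 3"
  have C: "0 < ?C" using s by (simp add: add_pos_pos)
  define A where "A x t = ennreal (v x) * (if v t \<le> v x then ennreal (v t * \<bar>\<psi> t - \<psi> x\<bar> powr (- s)) else 0)" for x t
  have [measurable]: "(\<lambda>(x, t). A x t) \<in> borel_measurable (M \<Otimes>\<^sub>M M)"
    unfolding A_def by measurable
  have [measurable]: "(\<lambda>(x, t). A t x) \<in> borel_measurable (M \<Otimes>\<^sub>M M)"
    unfolding A_def by measurable
  have [measurable]: "A x \<in> borel_measurable M" "(\<lambda>t. A t x) \<in> borel_measurable M" for x
    unfolding A_def by measurable
  have A: "(\<integral>\<^sup>+x. \<integral>\<^sup>+t. A x t \<partial>M \<partial>M) \<le> ennreal ?C"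
  proof -
    have "(\<integral>\<^sup>+t. A x t \<partial>M) \<le> ennreal ?C * ennreal (v x powr m)" for x
    proof (cases "v x = 0")
      case True
      then show ?thesis by (simp add: A_def)
    next
      case False
      then have vx: "0 < v x" using v[of x] by simp
      have "(\<integral>\<^sup>+t. A x t \<partial>M) = ennreal (v x) * (\<integral>\<^sup>+t. ennreal (v t * \<bar>\<psi> t - \<psi> x\<bar> powr (- s)) * indicator {t. v t \<le> v x} t \<partial>M)"
        unfolding A_def by (subst nn_integral_cmult[symmetric]) (auto intro!: nn_integral_cong simp: indicator_def)
      also have "\<dots> \<le> ennreal (v x) * ennreal (?C * v x powr (m - 1))"
        by (intro mult_left_mono fractional_integral_sublevel[OF _ _ push s m v vm vx]) auto
      also have "\<dots> = ennreal (?C * (v x * v x powr (m - 1)))"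
        using C vx by (simp add: ennreal_mult'[symmetric] mult_ac)
      also have "v x * v x powr (m - 1) = v x powr m"
        using vx by (simp add: powr_mult_base)
      finally show ?thesis using C by (simp add: ennreal_mult')
    qed
    then have "(\<integral>\<^sup>+x. \<integral>\<^sup>+t. A x t \<partial>M \<partial>M) \<le> (\<integral>\<^sup>+x. ennreal ?C * ennreal (v x powr m) \<partial>M)"
      by (intro nn_integral_mono)
    also have "\<dots> = ennreal ?C * (\<integral>\<^sup>+x. ennreal (v x powr m) \<partial>M)" by (simp add: nn_integral_cmult)
    also have "\<dots> \<le> ennreal ?C * 1" using vm by (intro mult_left_mono) auto
    finally show ?thesis by simp
  qed
  have "(\<integral>\<^sup>+x. \<integral>\<^sup>+t. ennreal (v x * v t * \<bar>\<psi> x - \<psi> t\<bar> powr (- s)) \<partial>M \<partial>M) \<le> (\<integral>\<^sup>+x. \<integral>\<^sup>+t. A x t + A t x \<partial>M \<partial>M)"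
  proof (intro nn_integral_mono)
    fix x t
    have "ennreal (v x * v t * \<bar>\<psi> x - \<psi> t\<bar> powr (- s)) = ennreal (v x) * ennreal (v t * \<bar>\<psi> t - \<psi> x\<bar> powr (- s))"
      using v by (simp add: ennreal_mult'[symmetric] mult_ac abs_minus_commute)
    moreover have "ennreal (v x * v t * \<bar>\<psi> x - \<psi> t\<bar> powr (- s)) = ennreal (v t) * ennreal (v x * \<bar>\<psi> x - \<psi> t\<bar> powr (- s))"
      using v by (simp add: ennreal_mult'[symmetric] mult_ac)
    ultimately show "ennreal (v x * v t * \<bar>\<psi> x - \<psi> t\<bar> powr (- s)) \<le> A x t + A t x"
      by (cases "v t \<le> v x") (auto simp: A_def)
  qed
  also have "\<dots> = (\<integral>\<^sup>+x. \<integral>\<^sup>+t. A x t \<partial>M \<partial>M) + (\<integral>\<^sup>+x. \<integral>\<^sup>+t. A t x \<partial>M \<partial>M)"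
    by (simp add: nn_integral_add)
  also have "(\<integral>\<^sup>+x. \<integral>\<^sup>+t. A t x \<partial>M \<partial>M) = (\<integral>\<^sup>+x. \<integral>\<^sup>+t. A x t \<partial>M \<partial>M)"
    using P.Fubini'[of "\<lambda>x t. A x t"] by simp
  also have "(\<integral>\<^sup>+x. \<integral>\<^sup>+t. A x t \<partial>M \<partial>M) + (\<integral>\<^sup>+x. \<integral>\<^sup>+t. A x t \<partial>M \<partial>M) \<le> ennreal ?C + ennreal ?C"
    by (intro add_mono A)
  finally show ?thesis using C by (simp add: ennreal_plus[symmetric] del: ennreal_plus)
qed

section \<open>Hausdorff-Young inequality\<close>

lemma vector2_eq: "(vector [a, b] :: real^2) = a *\<^sub>R axis 1 1 + b *\<^sub>R axis 2 1"
  by (simp add: vec_eq_iff forall_2 axis_def)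

lemma borel_measurable_vector2 [measurable]:
  "(\<lambda>(a, b). vector [a, b] :: real^2) \<in> borel_measurable (borel \<Otimes>\<^sub>M borel)"
  by (simp add: vector2_eq split_beta')

lemma inner_real2: "(x :: real^2) \<bullet> y = x $ 1 * y $ 1 + x $ 2 * y $ 2"
  by (simp add: inner_vec_def sum_2)

lemma norm_real2_sq: "(norm (x :: real^2))\<^sup>2 = (x $ 1)\<^sup>2 + (x $ 2)\<^sup>2"
  unfolding power2_norm_eq_inner inner_real2 by (simp add: power2_eq_square)

lemma lborel_real2: "(lborel :: (real^2) measure) = distr (lborel \<Otimes>\<^sub>M lborel) borel (\<lambda>(a, b). vector [a, b])"
proof (rule lborel_eqI)
  fix l u :: "real^2" assume le: "\<And>b. b \<in> Basis \<Longrightarrow> l \<bullet> b \<le> u \<bullet> b"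
  have "axis 1 1 \<in> (Basis :: (real^2) set)" "axis 2 1 \<in> (Basis :: (real^2) set)"
    by (auto simp: Basis_vec_def)
  from this[THEN le] have lu: "l $ 1 \<le> u $ 1" "l $ 2 \<le> u $ 2" by (simp_all add: inner_axis)
  have pre: "(\<lambda>(a, b). vector [a, b]) -` box l u \<inter> space (lborel \<Otimes>\<^sub>M lborel) = {l $ 1<..<u $ 1} \<times> {l $ 2<..<u $ 2}"
    by (auto simp: mem_box_cart forall_2 space_pair_measure)
  have B: "(Basis :: (real^2) set) = {axis 1 1, axis 2 1}"
    by (simp add: Basis_vec_def UNIV_2 insert_commute)
  have "emeasure (distr (lborel \<Otimes>\<^sub>M lborel) borel (\<lambda>(a, b). vector [a, b])) (box l u)
      = emeasure (lborel \<Otimes>\<^sub>M lborel) ({l $ 1<..<u $ 1} \<times> {l $ 2<..<u $ 2})"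
    by (subst emeasure_distr) (auto simp: pre)
  also have "\<dots> = ennreal (u $ 1 - l $ 1) * ennreal (u $ 2 - l $ 2)"
    using lu by (subst lborel.emeasure_pair_measure_Times) auto
  also have "\<dots> = ennreal (\<Prod>b\<in>Basis. (u - l) \<bullet> b)"
    using lu by (simp add: B inner_axis ennreal_mult' axis_eq_axis)
  finally show "emeasure (distr (lborel \<Otimes>\<^sub>M lborel) borel (\<lambda>(a, b). vector [a, b])) (box l u) = ennreal (\<Prod>b\<in>Basis. (u - l) \<bullet> b)" .
qed simp

lemma integrable_times_pair:
  fixes a :: "'a \<Rightarrow> complex" and b :: "'b \<Rightarrow> complex"
  assumes "pair_sigma_finite M N" and a: "integrable M a" and b: "integrable N b"
  shows "integrable (M \<Otimes>\<^sub>M N) (\<lambda>(x, y). a x * b y)"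
    and "(LINT p|(M \<Otimes>\<^sub>M N). a (fst p) * b (snd p)) = (LINT x|M. a x) * (LINT y|N. b y)"
proof -
  interpret pair_sigma_finite M N by fact
  have [measurable]: "a \<in> borel_measurable M" "b \<in> borel_measurable N" using a b by auto
  show int: "integrable (M \<Otimes>\<^sub>M N) (\<lambda>(x, y). a x * b y)"
  proof (rule integrableI_bounded)
    have "(\<integral>\<^sup>+p. ennreal (norm (case p of (x, y) \<Rightarrow> a x * b y)) \<partial>(M \<Otimes>\<^sub>M N)) =
        (\<integral>\<^sup>+x. \<integral>\<^sup>+y. ennreal (norm (a x)) * ennreal (norm (b y)) \<partial>N \<partial>M)"
      by (subst M2.nn_integral_fst[symmetric]) (auto simp: norm_mult ennreal_mult)
    also have "\<dots> = (\<integral>\<^sup>+x. ennreal (norm (a x)) \<partial>M) * (\<integral>\<^sup>+y. ennreal (norm (b y)) \<partial>N)"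
      by (simp add: nn_integral_cmult nn_integral_multc)
    also have "\<dots> < \<infinity>" using a b by (simp add: integrable_iff_bounded ennreal_mult_less_top)
    finally show "(\<integral>\<^sup>+p. ennreal (norm (case p of (x, y) \<Rightarrow> a x * b y)) \<partial>(M \<Otimes>\<^sub>M N)) < \<infinity>" .
  qed simp
  have "(LINT p|(M \<Otimes>\<^sub>M N). a (fst p) * b (snd p)) = (LINT x|M. LINT y|N. a x * b y)"
    using integral_fst'[OF int] by (simp add: split_beta')
  then show "(LINT p|(M \<Otimes>\<^sub>M N). a (fst p) * b (snd p)) = (LINT x|M. a x) * (LINT y|N. b y)" by simp
qed

section \<open>Characters and Gaussian weights\<close>

definition fchar :: "real^2 \<Rightarrow> real^2 \<Rightarrow> complex" where
  "fchar x \<xi> = exp (- (2 * pi * (x \<bullet> \<xi>)) *\<^sub>R \<i>)"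

lemma norm_fchar [simp]: "norm (fchar x \<xi>) = 1"
  by (simp add: fchar_def)

lemma fchar_add: "fchar x (\<xi> + \<eta>) = fchar x \<xi> * fchar x \<eta>"
  by (simp add: fchar_def exp_add[symmetric] algebra_simps)

lemma cnj_fchar: "cnj (fchar x \<xi>) = fchar x (- \<xi>)"
  by (simp add: fchar_def exp_cnj)

lemma borel_measurable_fchar [measurable (raw)]:
  assumes [measurable]: "f \<in> borel_measurable M" "g \<in> borel_measurable M"
  shows "(\<lambda>x. fchar (f x) (g x)) \<in> borel_measurable M"
proof -
  have "continuous_on UNIV (\<lambda>p. fchar (fst p) (snd p))"
    unfolding fchar_def by (intro continuous_intros)
  then have "(\<lambda>p. fchar (fst p) (snd p)) \<in> borel_measurable borel"
    by (rule borel_measurable_continuous_onI)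
  then have "(\<lambda>p. fchar (fst p) (snd p)) \<in> borel_measurable (borel \<Otimes>\<^sub>M borel)"
    by (simp add: borel_prod)
  from measurable_compose[OF _ this, of "\<lambda>x. (f x, g x)" M] show ?thesis by simp
qed

lemma fchar_vector2: "fchar (vector [a, b]) \<xi> = exp (\<i> * of_real (- (2 * pi * \<xi> $ 1) * a)) * exp (\<i> * of_real (- (2 * pi * \<xi> $ 2) * b))"
  by (simp add: fchar_def inner_real2 exp_add[symmetric] scaleR_conv_of_real algebra_simps)

text \<open>The substitution a = s * x reduces the integral to the characteristic function of the
  standard normal distribution.\<close>

lemma gaussian_fourier_1:
  fixes s :: real
  assumes s: "0 < s"
  shows "integrable lborel (\<lambda>a. complex_of_real (exp (- (a / s)\<^sup>2 / 2)) * exp (\<i> * of_real (t * a)))"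
    and "(LINT a|lborel. complex_of_real (exp (- (a / s)\<^sup>2 / 2)) * exp (\<i> * of_real (t * a))) = of_real (s * sqrt (2 * pi) * exp (- (s * t)\<^sup>2 / 2))"
proof -
  let ?f = "\<lambda>x. complex_of_real (exp (- x\<^sup>2 / 2)) * exp (\<i> * of_real (s * t * x))"
  have f: "?f x = of_real (sqrt (2 * pi)) * (std_normal_density x *\<^sub>R exp (\<i> * of_real (s * t * x)))" for x
    by (simp add: std_normal_density_def scaleR_conv_of_real of_real_exp field_simps)
  have i1: "integrable lborel (\<lambda>x. std_normal_density x *\<^sub>R exp (\<i> * of_real (s * t * x)))"
    by (rule Bochner_Integration.integrable_bound[OF integrable_std_normal_moment[of 0]]) auto
  then have i: "integrable lborel ?f" unfolding f by (rule integrable_mult_right)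
  have ch: "char std_normal_distribution (s * t) = (LINT x|lborel. std_normal_density x *\<^sub>R exp (\<i> * of_real (s * t * x)))"
    unfolding char_def by (subst integral_density) auto
  have v: "(LINT x|lborel. ?f x) = of_real (sqrt (2 * pi) * exp (- (s * t)\<^sup>2 / 2))"
  proof -
    have "(LINT x|lborel. ?f x) = of_real (sqrt (2 * pi)) * (LINT x|lborel. std_normal_density x *\<^sub>R exp (\<i> * of_real (s * t * x)))"
      unfolding f by (rule integral_mult_right_zero)
    also have "\<dots> = of_real (sqrt (2 * pi) * exp (- (s * t)\<^sup>2 / 2))"
      unfolding ch[symmetric] char_std_normal_distribution by (rule of_real_mult[symmetric])
    finally show ?thesis .
  qed
  let ?g = "\<lambda>a. complex_of_real (exp (- (a / s)\<^sup>2 / 2)) * exp (\<i> * of_real (t * a))"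
  have g: "?g (0 + s * x) = ?f x" for x using s by (simp add: mult_ac)
  show "integrable lborel ?g"
    using lborel_integrable_real_affine_iff[of s ?g 0] i s unfolding g by auto
  have "(LINT a|lborel. ?g a) = \<bar>s\<bar> *\<^sub>R (LINT x|lborel. ?g (0 + s * x))"
    using s by (intro lborel_integral_real_affine) simp
  also have "\<dots> = of_real (s * sqrt (2 * pi) * exp (- (s * t)\<^sup>2 / 2))"
    unfolding g v using s by (simp add: scaleR_conv_of_real)
  finally show "(LINT a|lborel. ?g a) = of_real (s * sqrt (2 * pi) * exp (- (s * t)\<^sup>2 / 2))" .
qed

definition gauss_weight :: "real \<Rightarrow> real^2 \<Rightarrow> real" where
  "gauss_weight s x = exp (- (norm x / s)\<^sup>2 / 2)"

lemma gauss_weight_vector2: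
  "gauss_weight s (vector [a, b]) = exp (- (a / s)\<^sup>2 / 2) * exp (- (b / s)\<^sup>2 / 2)"
  by (simp add: gauss_weight_def power_divide norm_real2_sq exp_add[symmetric] add_divide_distrib)

lemma gauss_weight_pos [simp]: "0 < gauss_weight s x" "0 \<le> gauss_weight s x"
  by (simp_all add: gauss_weight_def)

lemma borel_measurable_gauss_weight [measurable]: "gauss_weight s \<in> borel_measurable borel"
  unfolding gauss_weight_def by measurable

lemma gauss_weight_fourier:
  fixes s :: real
  assumes s: "0 < s"
  shows "integrable lborel (gauss_weight s)"
    and "(LINT x|lborel. of_real (gauss_weight s x) * fchar x \<xi>) =
      of_real (2 * pi * s\<^sup>2 * gauss_weight (1 / (2 * pi * s)) \<xi>)"
proof -
  let ?g = "\<lambda>\<xi> a b. (complex_of_real (exp (- (a / s)\<^sup>2 / 2)) * exp (\<i> * of_real (- (2 * pi * \<xi> $ 1) * a))) *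
      (complex_of_real (exp (- (b / s)\<^sup>2 / 2)) * exp (\<i> * of_real (- (2 * pi * \<xi> $ 2) * b)))"
  have g: "of_real (gauss_weight s (vector [a, b])) * fchar (vector [a, b]) \<xi> = ?g \<xi> a b" for a b \<xi>
    by (simp add: gauss_weight_vector2 fchar_vector2 mult_ac)
  have P: "pair_sigma_finite lborel (lborel :: real measure)" ..
  have I: "integrable (lborel \<Otimes>\<^sub>M lborel) (\<lambda>(a, b). ?g \<xi> a b)" for \<xi>
    by (rule integrable_times_pair(1)[OF P gaussian_fourier_1(1)[OF s] gaussian_fourier_1(1)[OF s]])
  have J: "integrable lborel (\<lambda>x. of_real (gauss_weight s x) * fchar x \<xi>)" for \<xi>
    by (subst lborel_real2, subst integrable_distr_eq) (use I[of \<xi>] g in \<open>auto simp: split_beta'\<close>)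
  show "integrable lborel (gauss_weight s)"
    using integrable_norm[OF J[of 0]] by (simp add: norm_mult)
  have "(LINT x|lborel. of_real (gauss_weight s x) * fchar x \<xi>) = (LINT p|(lborel \<Otimes>\<^sub>M lborel). ?g \<xi> (fst p) (snd p))"
    by (subst lborel_real2, subst integral_distr) (auto simp: split_beta' g)
  also have "\<dots> = of_real (s * sqrt (2 * pi) * exp (- (s * (- (2 * pi * \<xi> $ 1)))\<^sup>2 / 2)) *
      of_real (s * sqrt (2 * pi) * exp (- (s * (- (2 * pi * \<xi> $ 2)))\<^sup>2 / 2))"
    by (subst integrable_times_pair(2)[OF P gaussian_fourier_1(1)[OF s] gaussian_fourier_1(1)[OF s]])
       (simp only: gaussian_fourier_1(2)[OF s])
  also have "\<dots> = of_real (2 * pi * s\<^sup>2 * gauss_weight (1 / (2 * pi * s)) \<xi>)"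
  proof -
    have "exp (- (s * (- (2 * pi * \<xi> $ 1)))\<^sup>2 / 2) * exp (- (s * (- (2 * pi * \<xi> $ 2)))\<^sup>2 / 2) = gauss_weight (1 / (2 * pi * s)) \<xi>"
      using s by (simp add: gauss_weight_def power_mult_distrib norm_real2_sq exp_add[symmetric] algebra_simps add_divide_distrib)
    moreover have "sqrt (2 * pi) * sqrt (2 * pi) = 2 * pi" by simp
    moreover have "(s * c * a) * (s * c * b) = (c * c) * s\<^sup>2 * (a * b)" for a b c :: real
      by (simp add: power2_eq_square)
    ultimately have "(s * sqrt (2 * pi) * exp (- (s * (- (2 * pi * \<xi> $ 1)))\<^sup>2 / 2)) *
      (s * sqrt (2 * pi) * exp (- (s * (- (2 * pi * \<xi> $ 2)))\<^sup>2 / 2)) = 2 * pi * s\<^sup>2 * gauss_weight (1 / (2 * pi * s)) \<xi>"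
      by (simp only:)
    then show ?thesis by (simp only: of_real_mult[symmetric])
  qed
  finally show "(LINT x|lborel. of_real (gauss_weight s x) * fchar x \<xi>) =
      of_real (2 * pi * s\<^sup>2 * gauss_weight (1 / (2 * pi * s)) \<xi>)" .
qed

text \<open>The mass of a Gaussian is its Fourier transform at 0, so the transform formula can be
  used a second time, for the reciprocal width; the two prefactors multiply to 1.\<close>

lemma nn_integral_gauss_weight:
  assumes s: "0 < s"
  shows "(\<integral>\<^sup>+x. ennreal (2 * pi * s\<^sup>2 * gauss_weight (1 / (2 * pi * s)) x) \<partial>lborel) = 1"
proof -
  let ?t = "1 / (2 * pi * s)"
  have t: "?t > 0" using s by simp
  have "complex_of_real (LINT x|lborel. gauss_weight ?t x) = (LINT x|lborel. of_real (gauss_weight ?t x) * fchar x 0)"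
    by (simp add: fchar_def)
  also have "\<dots> = of_real (2 * pi * ?t\<^sup>2)"
    unfolding gauss_weight_fourier(2)[OF t] by (simp add: gauss_weight_def)
  finally have "(LINT x|lborel. gauss_weight ?t x) = 2 * pi * ?t\<^sup>2" by (simp only: of_real_eq_iff)
  moreover have "(\<integral>\<^sup>+x. ennreal (gauss_weight ?t x) \<partial>lborel) = ennreal (LINT x|lborel. gauss_weight ?t x)"
    by (rule nn_integral_eq_integral[OF gauss_weight_fourier(1)[OF t]]) simp
  ultimately have "(\<integral>\<^sup>+x. ennreal (2 * pi * s\<^sup>2) * ennreal (gauss_weight ?t x) \<partial>lborel) = ennreal (2 * pi * s\<^sup>2) * ennreal (2 * pi * ?t\<^sup>2)"
    by (simp add: nn_integral_cmult)
  also have "\<dots> = ennreal (2 * pi * s\<^sup>2 * (2 * pi * ?t\<^sup>2))" by (rule ennreal_mult'[symmetric]) simp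
  also have "2 * pi * s\<^sup>2 * (2 * pi * ?t\<^sup>2) = 1" using s by (simp add: field_simps power2_eq_square)
  finally show ?thesis
    by (subst ennreal_mult') simp_all
qed

text \<open>The density \<open>2 * pi * s\<^sup>2 * gauss_weight (1 / (2 * pi * s))\<close> is the Fourier transform
  of \<open>gauss_weight s\<close>; its positivity and unit mass turn the \<open>L\<^sup>2\<close> bound into Schur's test.\<close>

definition gauss_density :: "real \<Rightarrow> real^2 \<Rightarrow> real" where
  "gauss_density s x = 2 * pi * s\<^sup>2 * gauss_weight (1 / (2 * pi * s)) x"

lemma gauss_density_nonneg [simp]: "0 \<le> gauss_density s x"
  by (simp add: gauss_density_def)

lemma gauss_density_minus: "gauss_density s (- x) = gauss_density s x"
  by (simp add: gauss_density_def gauss_weight_def)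

lemma borel_measurable_gauss_density [measurable]: "gauss_density s \<in> borel_measurable borel"
  unfolding gauss_density_def by measurable

text \<open>The Fourier transform of the push-forward under \<Phi> of the complex measure with
  density F. Written on the source space, it avoids forming the pushed function on the
  plane.\<close>

definition fourier_along :: "'a measure \<Rightarrow> ('a \<Rightarrow> real^2) \<Rightarrow> ('a \<Rightarrow> complex) \<Rightarrow> real^2 \<Rightarrow> complex" where
  "fourier_along M \<Phi> F x = (LINT u|M. F u * fchar x (\<Phi> u))"

text \<open>The domination of the image measure by Lebesgue measure is the one geometric input of
  Hausdorff-Young. It will hold for pairs of points on an arc by injectivity and the
  Jacobian.\<close>

locale pushed_below_lborel = sigma_finite_measure M for M :: "'a measure" +
  fixes \<Phi> :: "'a \<Rightarrow> real^2"
  assumes \<Phi>_measurable [measurable]: "\<Phi> \<in> borel_measurable M"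
    and push: "\<And>g. g \<in> borel_measurable borel \<Longrightarrow> (\<integral>\<^sup>+u. g (\<Phi> u) \<partial>M) \<le> (\<integral>\<^sup>+y. g y \<partial>lborel)"
begin

lemma borel_measurable_fourier_along [measurable]:
  assumes [measurable]: "F \<in> borel_measurable M"
  shows "fourier_along M \<Phi> F \<in> borel_measurable borel"
  unfolding fourier_along_def by measurable

lemma integrable_fchar: "integrable M F \<Longrightarrow> integrable M (\<lambda>u. F u * fchar x (\<Phi> u))"
  by (rule Bochner_Integration.integrable_bound[of M F]) (auto simp: norm_mult)

lemma norm_fourier_along_le:
  assumes "integrable M F"
  shows "ennreal (norm (fourier_along M \<Phi> F x)) \<le> (\<integral>\<^sup>+u. ennreal (norm (F u)) \<partial>M)"
  using integral_norm_bound_ennreal[OF integrable_fchar[OF assms, of x]]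
  by (simp add: fourier_along_def norm_mult)

lemma gauss_density_push:
  assumes s: "0 < s"
  shows "(\<integral>\<^sup>+v. ennreal (gauss_density s (c - \<Phi> v)) \<partial>M) \<le> 1"
proof -
  have "(\<integral>\<^sup>+v. ennreal (gauss_density s (c - \<Phi> v)) \<partial>M) = (\<integral>\<^sup>+v. ennreal (gauss_density s (- c + \<Phi> v)) \<partial>M)"
    by (intro nn_integral_cong arg_cong[where f = ennreal]) (metis gauss_density_minus minus_diff_eq uminus_add_conv_diff)
  also have "\<dots> \<le> (\<integral>\<^sup>+y. ennreal (gauss_density s (- c + y)) \<partial>lborel)"
    by (rule push) measurable
  also have "\<dots> = (\<integral>\<^sup>+y. ennreal (gauss_density s y) \<partial>distr lborel borel ((+) (- c)))"
    by (subst nn_integral_distr) auto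
  also have "\<dots> = 1"
    unfolding lborel_distr_plus using nn_integral_gauss_weight[OF s] by (simp add: gauss_density_def)
  finally show ?thesis .
qed

text \<open>The weight makes the triple integral absolutely convergent, so the x-integration can be
  done first. It leaves the positive kernel \<open>gauss_density s (\<Phi> u - \<Phi> v)\<close>,
  whose integral in v is at most 1 by \<open>gauss_density_push\<close>; the product of norms is
  then split by 2ab \<le> a^2 + b^2.\<close>

lemma fourier_along_gauss_L2:
  assumes s: "0 < s" and F: "integrable M F"
  shows "(\<integral>\<^sup>+x. ennreal (gauss_weight s x * (norm (fourier_along M \<Phi> F x))\<^sup>2) \<partial>lborel)
     \<le> (\<integral>\<^sup>+u. ennreal ((norm (F u))\<^sup>2) \<partial>M)"
proof -
  interpret P: pair_sigma_finite M M ..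
  interpret Q: pair_sigma_finite lborel "M \<Otimes>\<^sub>M M" ..
  have [measurable]: "F \<in> borel_measurable M" using F by auto
  let ?T = "fourier_along M \<Phi> F"
  let ?FF = "\<lambda>p. F (fst p) * cnj (F (snd p))"
  let ?h = "\<lambda>p. \<Phi> (fst p) - \<Phi> (snd p)"
  have cF: "integrable M (\<lambda>v. cnj (F v))" using F by simp
  have FF: "integrable (M \<Otimes>\<^sub>M M) ?FF"
    using integrable_times_pair(1)[OF P.pair_sigma_finite_axioms F cF] by (simp add: split_beta')
  have TT: "?T x * cnj (?T x) = (LINT p|(M \<Otimes>\<^sub>M M). ?FF p * fchar x (?h p))" for x
  proof -
    have "cnj (?T x) = (LINT v|M. cnj (F v * fchar x (\<Phi> v)))"
      unfolding fourier_along_def by (rule Bochner_Integration.integral_cnj[symmetric])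
    moreover have i: "integrable M (\<lambda>v. cnj (F v * fchar x (\<Phi> v)))"
      using integrable_fchar[OF F, of x] by (simp del: complex_cnj_mult)
    ultimately have "?T x * cnj (?T x) = (LINT p|(M \<Otimes>\<^sub>M M). (F (fst p) * fchar x (\<Phi> (fst p))) * cnj (F (snd p) * fchar x (\<Phi> (snd p))))"
      unfolding integrable_times_pair(2)[OF P.pair_sigma_finite_axioms integrable_fchar[OF F] i]
      by (simp only: fourier_along_def)
    also have "\<dots> = (LINT p|(M \<Otimes>\<^sub>M M). ?FF p * fchar x (?h p))"
      by (intro Bochner_Integration.integral_cong refl)
         (simp add: cnj_fchar fchar_add[of x _ "- _", simplified] mult_ac)
    finally show ?thesis .
  qed
  let ?K = "\<lambda>x p. of_real (gauss_weight s x) * (?FF p * fchar x (?h p))"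
  have intK: "integrable (lborel \<Otimes>\<^sub>M (M \<Otimes>\<^sub>M M)) (\<lambda>(x, p). ?K x p)"
  proof (rule Bochner_Integration.integrable_bound)
    show "integrable (lborel \<Otimes>\<^sub>M (M \<Otimes>\<^sub>M M)) (\<lambda>(x, p). of_real (gauss_weight s x) * ?FF p)"
      by (rule integrable_times_pair(1)[OF Q.pair_sigma_finite_axioms _ FF])
         (use gauss_weight_fourier(1)[OF s] in auto)
    show "(\<lambda>(x, p). ?K x p) \<in> borel_measurable (lborel \<Otimes>\<^sub>M (M \<Otimes>\<^sub>M M))"
    proof -
      have [measurable]: "(\<lambda>q. fchar (fst q) (?h (snd q))) \<in> borel_measurable (lborel \<Otimes>\<^sub>M (M \<Otimes>\<^sub>M M))"
      proof (rule borel_measurable_fchar)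
        show "fst \<in> borel_measurable (lborel \<Otimes>\<^sub>M (M \<Otimes>\<^sub>M M))"
          using measurable_fst[of lborel "M \<Otimes>\<^sub>M M"] by simp
      qed measurable
      have [measurable]: "?FF \<in> borel_measurable (M \<Otimes>\<^sub>M M)" using FF by auto
      show ?thesis unfolding split_beta' by measurable
    qed
  qed (auto simp: norm_mult)
  have Tb: "norm (?T x) \<le> enn2real (\<integral>\<^sup>+u. ennreal (norm (F u)) \<partial>M)" for x
  proof -
    have "(\<integral>\<^sup>+u. ennreal (norm (F u)) \<partial>M) < \<infinity>" using F by (simp add: integrable_iff_bounded)
    then show ?thesis
      using norm_fourier_along_le[OF F, of x]
      by (metis enn2real_mono enn2real_ennreal norm_ge_zero infinity_ennreal_def)
  qed
  let ?R = "\<lambda>x. gauss_weight s x * (norm (?T x))\<^sup>2"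
  have intR: "integrable lborel ?R"
  proof (rule Bochner_Integration.integrable_bound)
    show "integrable lborel (\<lambda>x. gauss_weight s x * (enn2real (\<integral>\<^sup>+u. ennreal (norm (F u)) \<partial>M))\<^sup>2)"
      using gauss_weight_fourier(1)[OF s] by simp
    show "AE x in lborel. norm (?R x) \<le> norm (gauss_weight s x * (enn2real (\<integral>\<^sup>+u. ennreal (norm (F u)) \<partial>M))\<^sup>2)"
      using Tb by (intro AE_I2) (auto simp: abs_mult intro!: mult_left_mono power_mono)
  qed simp
  have R_eq: "complex_of_real (?R x) = of_real (gauss_weight s x) * (?T x * cnj (?T x))" for x
    by (simp only: of_real_mult complex_norm_square)
  have "complex_of_real (LINT x|lborel. ?R x) = (LINT x|lborel. of_real (gauss_weight s x) * (?T x * cnj (?T x)))"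
    unfolding R_eq[symmetric] by (rule integral_complex_of_real[symmetric])
  also have "\<dots> = (LINT x|lborel. LINT p|(M \<Otimes>\<^sub>M M). ?K x p)"
    unfolding TT by simp
  also have "\<dots> = (LINT p|(M \<Otimes>\<^sub>M M). LINT x|lborel. ?K x p)"
    by (rule Q.Fubini_integral[OF intK, symmetric])
  also have "\<dots> = (LINT p|(M \<Otimes>\<^sub>M M). ?FF p * of_real (gauss_density s (?h p)))"
  proof (intro Bochner_Integration.integral_cong refl)
    fix p
    have "(LINT x|lborel. ?K x p) = (LINT x|lborel. ?FF p * (of_real (gauss_weight s x) * fchar x (?h p)))"
      by (intro Bochner_Integration.integral_cong refl) (simp add: mult_ac)
    also have "\<dots> = ?FF p * (LINT x|lborel. of_real (gauss_weight s x) * fchar x (?h p))"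
      by (rule integral_mult_right_zero)
    finally show "(LINT x|lborel. ?K x p) = ?FF p * of_real (gauss_density s (?h p))"
      unfolding gauss_weight_fourier(2)[OF s] gauss_density_def .
  qed
  finally have eq: "complex_of_real (LINT x|lborel. ?R x) = (LINT p|(M \<Otimes>\<^sub>M M). ?FF p * of_real (gauss_density s (?h p)))" .
  have R0: "0 \<le> (LINT x|lborel. ?R x)" by (intro Bochner_Integration.integral_nonneg) simp
  have "(\<integral>\<^sup>+x. ennreal (?R x) \<partial>lborel) = ennreal (LINT x|lborel. ?R x)"
    by (rule nn_integral_eq_integral[OF intR]) simp
  also have "\<dots> = ennreal (norm (LINT p|(M \<Otimes>\<^sub>M M). ?FF p * of_real (gauss_density s (?h p))))"
    using R0 by (simp flip: eq)
  also have "\<dots> \<le> (\<integral>\<^sup>+p. ennreal (norm (?FF p * of_real (gauss_density s (?h p)))) \<partial>(M \<Otimes>\<^sub>M M))"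
    by (cases "integrable (M \<Otimes>\<^sub>M M) (\<lambda>p. ?FF p * of_real (gauss_density s (?h p)))")
       (auto intro!: integral_norm_bound_ennreal simp: not_integrable_integral_eq)
  also have "\<dots> = (\<integral>\<^sup>+u. \<integral>\<^sup>+v. ennreal (norm (F u) * norm (F v) * gauss_density s (\<Phi> u - \<Phi> v)) \<partial>M \<partial>M)"
    by (subst nn_integral_fst[symmetric]) (auto simp: norm_mult)
  also have "\<dots> \<le> ennreal (1/2) * (\<integral>\<^sup>+u. ennreal ((norm (F u))\<^sup>2) \<partial>M) + ennreal (1/2) * (\<integral>\<^sup>+u. ennreal ((norm (F u))\<^sup>2) \<partial>M)"
  proof -
    define A where "A u v = ennreal (1/2) * (ennreal ((norm (F u))\<^sup>2) * ennreal (gauss_density s (\<Phi> u - \<Phi> v)))" for u v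
    have [measurable]: "(\<lambda>(u, v). A u v) \<in> borel_measurable (M \<Otimes>\<^sub>M M)" "(\<lambda>(u, v). A v u) \<in> borel_measurable (M \<Otimes>\<^sub>M M)"
      "A u \<in> borel_measurable M" "(\<lambda>v. A v u) \<in> borel_measurable M" for u
      unfolding A_def by measurable
    have A: "(\<integral>\<^sup>+u. \<integral>\<^sup>+v. A u v \<partial>M \<partial>M) \<le> ennreal (1/2) * (\<integral>\<^sup>+u. ennreal ((norm (F u))\<^sup>2) \<partial>M)"
    proof -
      have "(\<integral>\<^sup>+v. A u v \<partial>M) \<le> ennreal (1/2) * ennreal ((norm (F u))\<^sup>2)" for u
      proof -
        have "(\<integral>\<^sup>+v. A u v \<partial>M) = ennreal (1/2) * (ennreal ((norm (F u))\<^sup>2) * (\<integral>\<^sup>+v. ennreal (gauss_density s (\<Phi> u - \<Phi> v)) \<partial>M))"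
          unfolding A_def by (simp add: nn_integral_cmult)
        also have "\<dots> \<le> ennreal (1/2) * (ennreal ((norm (F u))\<^sup>2) * 1)"
          by (intro mult_left_mono gauss_density_push s) auto
        finally show ?thesis by simp
      qed
      then have "(\<integral>\<^sup>+u. \<integral>\<^sup>+v. A u v \<partial>M \<partial>M) \<le> (\<integral>\<^sup>+u. ennreal (1/2) * ennreal ((norm (F u))\<^sup>2) \<partial>M)"
        by (intro nn_integral_mono)
      then show ?thesis by (simp add: nn_integral_cmult)
    qed
    have "(\<integral>\<^sup>+u. \<integral>\<^sup>+v. ennreal (norm (F u) * norm (F v) * gauss_density s (\<Phi> u - \<Phi> v)) \<partial>M \<partial>M) \<le>
       (\<integral>\<^sup>+u. \<integral>\<^sup>+v. A u v + A v u \<partial>M \<partial>M)"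
    proof (intro nn_integral_mono)
      fix u v
      let ?g = "gauss_density s (\<Phi> u - \<Phi> v)"
      have "norm (F u) * norm (F v) \<le> 1/2 * (norm (F u))\<^sup>2 + 1/2 * (norm (F v))\<^sup>2"
        using sum_squares_bound[of "norm (F u)" "norm (F v)"] by simp
      then have "norm (F u) * norm (F v) * ?g \<le> (1/2 * (norm (F u))\<^sup>2 + 1/2 * (norm (F v))\<^sup>2) * ?g"
        by (intro mult_right_mono) auto
      also have "\<dots> = 1/2 * ((norm (F u))\<^sup>2 * ?g) + 1/2 * ((norm (F v))\<^sup>2 * ?g)" by (simp add: algebra_simps)
      finally have "ennreal (norm (F u) * norm (F v) * ?g) \<le> ennreal (1/2 * ((norm (F u))\<^sup>2 * ?g) + 1/2 * ((norm (F v))\<^sup>2 * ?g))"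
        by (rule ennreal_leI)
      also have "\<dots> = ennreal (1/2 * ((norm (F u))\<^sup>2 * ?g)) + ennreal (1/2 * ((norm (F v))\<^sup>2 * ?g))"
        by (rule ennreal_plus) auto
      also have "\<dots> = A u v + A v u"
        unfolding A_def using gauss_density_minus[of s "\<Phi> u - \<Phi> v"] by (simp only: ennreal_mult' minus_diff_eq gauss_density_nonneg zero_le_power norm_ge_zero)
      finally show "ennreal (norm (F u) * norm (F v) * ?g) \<le> A u v + A v u" .
    qed
    also have "\<dots> = (\<integral>\<^sup>+u. \<integral>\<^sup>+v. A u v \<partial>M \<partial>M) + (\<integral>\<^sup>+u. \<integral>\<^sup>+v. A v u \<partial>M \<partial>M)"
      by (simp add: nn_integral_add)
    also have "(\<integral>\<^sup>+u. \<integral>\<^sup>+v. A v u \<partial>M \<partial>M) = (\<integral>\<^sup>+u. \<integral>\<^sup>+v. A u v \<partial>M \<partial>M)"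
      using P.Fubini'[of "\<lambda>x t. A x t"] by simp
    finally show ?thesis using A by (auto intro: order_trans add_mono)
  qed
  also have "\<dots> = (\<integral>\<^sup>+u. ennreal ((norm (F u))\<^sup>2) \<partial>M)"
  proof -
    have "ennreal (1/2) + ennreal (1/2) = 1" by (subst ennreal_plus[symmetric]) simp_all
    then show ?thesis by (simp only: distrib_right[symmetric] mult_1)
  qed
  finally show ?thesis .
qed

text \<open>As the Gaussian widens, the weight tends to 1, and Fatou's lemma removes it.\<close>

theorem fourier_along_L2:
  assumes F: "integrable M F"
  shows "(\<integral>\<^sup>+x. ennreal ((norm (fourier_along M \<Phi> F x))\<^sup>2) \<partial>lborel) \<le> (\<integral>\<^sup>+u. ennreal ((norm (F u))\<^sup>2) \<partial>M)"
proof -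
  have [measurable]: "F \<in> borel_measurable M" using F by auto
  let ?T = "fourier_along M \<Phi> F"
  let ?f = "\<lambda>n x. ennreal (gauss_weight (real (Suc n)) x * (norm (?T x))\<^sup>2)"
  have "(\<lambda>n. ?f n x) \<longlonglongrightarrow> ennreal ((norm (?T x))\<^sup>2)" for x
  proof -
    have "(\<lambda>n. norm x * inverse (real (Suc n))) \<longlonglongrightarrow> norm x * 0"
      by (intro tendsto_intros LIMSEQ_inverse_real_of_nat)
    then have "(\<lambda>n. norm x / real (Suc n)) \<longlonglongrightarrow> 0" by (simp add: divide_inverse)
    then have "(\<lambda>n. exp (- (norm x / real (Suc n))\<^sup>2 / 2) * (norm (?T x))\<^sup>2) \<longlonglongrightarrow> exp (- 0\<^sup>2 / 2) * (norm (?T x))\<^sup>2"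
      by (intro tendsto_intros) auto
    then show ?thesis unfolding gauss_weight_def by (intro tendsto_ennrealI) simp
  qed
  then have "(\<integral>\<^sup>+x. ennreal ((norm (?T x))\<^sup>2) \<partial>lborel) = (\<integral>\<^sup>+x. liminf (\<lambda>n. ?f n x) \<partial>lborel)"
    by (intro nn_integral_cong lim_imp_Liminf[symmetric]) auto
  also have "\<dots> \<le> liminf (\<lambda>n. \<integral>\<^sup>+x. ?f n x \<partial>lborel)"
    by (rule nn_integral_liminf) measurable
  also have "\<dots> \<le> liminf (\<lambda>n::nat. \<integral>\<^sup>+u. ennreal ((norm (F u))\<^sup>2) \<partial>M)"
    by (intro Liminf_mono always_eventually allI fourier_along_gauss_L2 F) simp
  also have "\<dots> = (\<integral>\<^sup>+u. ennreal ((norm (F u))\<^sup>2) \<partial>M)" by (simp add: Liminf_const)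
  finally show ?thesis .
qed

text \<open>The large part \<open>F1\<close> has L^1 norm at most \<alpha> / (2 * B) times the
  integral of \<open>norm (F u) powr r\<close>, hence at most \<alpha> / 2. On the level set the
  transform of the small part \<open>F2\<close> is thus at least \<alpha> / 2, and Chebyshev's
  inequality with the L^2 bound gives the factor 4 / \<alpha>^2.\<close>

lemma fourier_along_distribution:
  assumes r: "1 < r" and F: "integrable M F" and B: "0 < B"
    and FB: "(\<integral>\<^sup>+u. ennreal (norm (F u) powr r) \<partial>M) \<le> ennreal B" and \<alpha>: "0 < \<alpha>"
  shows "emeasure lborel {x. \<alpha> \<le> norm (fourier_along M \<Phi> F x)} \<le>
    ennreal (4 / \<alpha>\<^sup>2) * (\<integral>\<^sup>+u. ennreal ((norm (F u))\<^sup>2) * indicator {u. \<alpha> * norm (F u) powr (r - 1) \<le> 2 * B} u \<partial>M)"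
proof -
  have [measurable]: "F \<in> borel_measurable M" using F by auto
  let ?S = "{u. \<alpha> * norm (F u) powr (r - 1) \<le> 2 * B}"
  define F2 where "F2 u = (if \<alpha> * norm (F u) powr (r - 1) \<le> 2 * B then F u else 0)" for u
  define F1 where "F1 u = (if \<alpha> * norm (F u) powr (r - 1) \<le> 2 * B then 0 else F u)" for u
  have [measurable]: "F1 \<in> borel_measurable M" "F2 \<in> borel_measurable M"
    unfolding F1_def F2_def by measurable
  have F1: "integrable M F1" and F2: "integrable M F2"
    by (rule Bochner_Integration.integrable_bound[OF F]; auto simp: F1_def F2_def)+
  have "fourier_along M \<Phi> F x = fourier_along M \<Phi> F1 x + fourier_along M \<Phi> F2 x" for x
  proof -
    have F12: "F u * fchar x (\<Phi> u) = F1 u * fchar x (\<Phi> u) + F2 u * fchar x (\<Phi> u)" for u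
      by (simp add: F1_def F2_def)
    show ?thesis unfolding fourier_along_def F12
      by (rule Bochner_Integration.integral_add) (intro integrable_fchar F1 F2)+
  qed
  moreover have "norm (fourier_along M \<Phi> F1 x) \<le> \<alpha> / 2" for x
  proof -
    have "ennreal (norm (F1 u)) \<le> ennreal (\<alpha> / (2 * B)) * ennreal (norm (F u) powr r)" for u
    proof (cases "\<alpha> * norm (F u) powr (r - 1) \<le> 2 * B")
      case False
      then have "1 \<le> \<alpha> / (2 * B) * norm (F u) powr (r - 1)" using B by (simp add: field_simps)
      then have "norm (F u) * 1 \<le> norm (F u) * (\<alpha> / (2 * B) * norm (F u) powr (r - 1))"
        by (intro mult_left_mono) auto
      also have "\<dots> = \<alpha> / (2 * B) * (norm (F u) * norm (F u) powr (r - 1))" by (simp only: mult_ac)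
      also have "norm (F u) * norm (F u) powr (r - 1) = norm (F u) powr r"
        by (subst powr_mult_base) auto
      finally show ?thesis using False \<alpha> B by (simp add: F1_def ennreal_mult'[symmetric] ennreal_leI)
    qed (simp add: F1_def)
    then have "(\<integral>\<^sup>+u. ennreal (norm (F1 u)) \<partial>M) \<le> (\<integral>\<^sup>+u. ennreal (\<alpha> / (2 * B)) * ennreal (norm (F u) powr r) \<partial>M)"
      by (intro nn_integral_mono)
    also have "\<dots> = ennreal (\<alpha> / (2 * B)) * (\<integral>\<^sup>+u. ennreal (norm (F u) powr r) \<partial>M)"
      by (rule nn_integral_cmult) simp
    also have "\<dots> \<le> ennreal (\<alpha> / (2 * B)) * ennreal B" by (intro mult_left_mono FB) simp
    also have "\<dots> = ennreal (\<alpha> / 2)" using B \<alpha> by (simp add: ennreal_mult'[symmetric])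
    finally have "ennreal (norm (fourier_along M \<Phi> F1 x)) \<le> ennreal (\<alpha> / 2)"
      using norm_fourier_along_le[OF F1, of x] by (rule order_trans[rotated])
    then show ?thesis using \<alpha> by (simp add: ennreal_le_iff)
  qed
  ultimately have sub: "\<alpha> / 2 \<le> norm (fourier_along M \<Phi> F2 x)" if "\<alpha> \<le> norm (fourier_along M \<Phi> F x)" for x
    using that norm_triangle_ineq[of "fourier_along M \<Phi> F1 x" "fourier_along M \<Phi> F2 x"]
    by (smt (verit, ccfv_threshold) field_sum_of_halves)
  have "emeasure lborel {x. \<alpha> \<le> norm (fourier_along M \<Phi> F x)} \<le>
     emeasure lborel ({x\<in>UNIV. 1 \<le> ennreal (4 / \<alpha>\<^sup>2) * ennreal ((norm (fourier_along M \<Phi> F2 x))\<^sup>2)})"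
  proof (rule emeasure_mono)
    show "{x. \<alpha> \<le> norm (fourier_along M \<Phi> F x)} \<subseteq> {x\<in>UNIV. 1 \<le> ennreal (4 / \<alpha>\<^sup>2) * ennreal ((norm (fourier_along M \<Phi> F2 x))\<^sup>2)}"
    proof safe
      fix x assume "\<alpha> \<le> norm (fourier_along M \<Phi> F x)"
      then have "(\<alpha> / 2)\<^sup>2 \<le> (norm (fourier_along M \<Phi> F2 x))\<^sup>2" using \<alpha> by (intro power_mono sub) auto
      then have "1 \<le> 4 / \<alpha>\<^sup>2 * (norm (fourier_along M \<Phi> F2 x))\<^sup>2" using \<alpha> by (simp add: field_simps)
      then show "1 \<le> ennreal (4 / \<alpha>\<^sup>2) * ennreal ((norm (fourier_along M \<Phi> F2 x))\<^sup>2)"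
        by (simp add: ennreal_mult'[symmetric] ennreal_ge_1)
    qed auto
  qed measurable
  also have "\<dots> \<le> ennreal (4 / \<alpha>\<^sup>2) * (\<integral>\<^sup>+x. ennreal ((norm (fourier_along M \<Phi> F2 x))\<^sup>2) * indicator UNIV x \<partial>lborel)"
    by (rule nn_integral_Markov_inequality) auto
  also have "\<dots> \<le> ennreal (4 / \<alpha>\<^sup>2) * (\<integral>\<^sup>+u. ennreal ((norm (F2 u))\<^sup>2) \<partial>M)"
    using fourier_along_L2[OF F2] by (intro mult_left_mono) auto
  also have "(\<integral>\<^sup>+u. ennreal ((norm (F2 u))\<^sup>2) \<partial>M) = (\<integral>\<^sup>+u. ennreal ((norm (F u))\<^sup>2) * indicator ?S u \<partial>M)"
    by (intro nn_integral_cong) (auto simp: F2_def)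
  finally show ?thesis .
qed

lemma powr_layer_cake:
  fixes y a :: real
  assumes "0 \<le> y" "0 < a"
  shows "ennreal (y powr a) = (\<integral>\<^sup>+t. ennreal (a * t powr (a - 1)) * indicator {0..y} t \<partial>lborel)"
proof -
  have "((\<lambda>t. a * t powr (a - 1)) has_integral (a * (y powr (a - 1 + 1) / (a - 1 + 1)))) {0..y}"
    by (intro has_integral_mult_right has_integral_powr_from_0) (use assms in auto)
  from nn_integral_has_integral_lebesgue'[OF _ this] assms show ?thesis by simp
qed

text \<open>Marcinkiewicz interpolation between the trivial bound \<open>L\<^sup>1 \<rightarrow> L\<^sup>\<infinity>\<close> and the
  \<open>L\<^sup>2\<close> bound. The truncation level of \<open>F\<close> is chosen at height \<open>\<alpha>\<close> so that
  the large part contributes at most \<open>\<alpha> / 2\<close> pointwise.\<close>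

theorem Hausdorff_Young_along:
  assumes r: "1 < r" "r < 2" and r': "r' = r / (r - 1)" and F: "integrable M F" and B: "0 < B"
    and FB: "(\<integral>\<^sup>+u. ennreal (norm (F u) powr r) \<partial>M) \<le> ennreal B"
  shows "(\<integral>\<^sup>+x. ennreal (norm (fourier_along M \<Phi> F x) powr r') \<partial>lborel)
     \<le> ennreal (4 * r' / (r' - 2) * (2 * B) powr (r' - 2) * B)"
proof -
  interpret LM: pair_sigma_finite lborel M ..
  have [measurable]: "F \<in> borel_measurable M" using F by auto
  have r'2: "2 < r'" using r unfolding r' by (simp add: field_simps)
  let ?T = "fourier_along M \<Phi> F"
  let ?S = "\<lambda>\<alpha> u. \<alpha> * norm (F u) powr (r - 1) \<le> 2 * B"
  have "(\<integral>\<^sup>+x. ennreal (norm (?T x) powr r') \<partial>lborel) =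
      (\<integral>\<^sup>+x. \<integral>\<^sup>+\<alpha>. ennreal (r' * \<alpha> powr (r' - 1)) * indicator {(\<alpha>, x). 0 \<le> \<alpha> \<and> \<alpha> \<le> norm (?T x)} (\<alpha>, x) \<partial>lborel \<partial>lborel)"
    using r'2 by (subst powr_layer_cake) (auto intro!: nn_integral_cong simp: indicator_def)
  also have "\<dots> = (\<integral>\<^sup>+\<alpha>. \<integral>\<^sup>+x. ennreal (r' * \<alpha> powr (r' - 1)) * indicator {(\<alpha>, x). 0 \<le> \<alpha> \<and> \<alpha> \<le> norm (?T x)} (\<alpha>, x) \<partial>lborel \<partial>lborel)"
    by (rule lborel_pair.Fubini') measurable
  also have "\<dots> \<le> (\<integral>\<^sup>+\<alpha>. \<integral>\<^sup>+u. ennreal ((norm (F u))\<^sup>2) * (ennreal (4 * r' * \<alpha> powr (r' - 3)) * indicator {(\<alpha>, u). 0 < \<alpha> \<and> ?S \<alpha> u} (\<alpha>, u)) \<partial>M \<partial>lborel)"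
  proof (rule nn_integral_mono)
    fix \<alpha> :: real
    show "(\<integral>\<^sup>+x. ennreal (r' * \<alpha> powr (r' - 1)) * indicator {(\<alpha>, x). 0 \<le> \<alpha> \<and> \<alpha> \<le> norm (?T x)} (\<alpha>, x) \<partial>lborel)
      \<le> (\<integral>\<^sup>+u. ennreal ((norm (F u))\<^sup>2) * (ennreal (4 * r' * \<alpha> powr (r' - 3)) * indicator {(\<alpha>, u). 0 < \<alpha> \<and> ?S \<alpha> u} (\<alpha>, u)) \<partial>M)"
    proof (cases "0 < \<alpha>")
      case True
      have "(\<integral>\<^sup>+x. ennreal (r' * \<alpha> powr (r' - 1)) * indicator {(\<alpha>, x). 0 \<le> \<alpha> \<and> \<alpha> \<le> norm (?T x)} (\<alpha>, x) \<partial>lborel)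
         = (\<integral>\<^sup>+x. ennreal (r' * \<alpha> powr (r' - 1)) * indicator {x. \<alpha> \<le> norm (?T x)} x \<partial>lborel)"
        using True by (intro nn_integral_cong) (auto simp: indicator_def)
      also have "\<dots> = ennreal (r' * \<alpha> powr (r' - 1)) * emeasure lborel {x. \<alpha> \<le> norm (?T x)}"
        by (rule nn_integral_cmult_indicator) measurable
      also have "\<dots> \<le> ennreal (r' * \<alpha> powr (r' - 1)) * (ennreal (4 / \<alpha>\<^sup>2) * (\<integral>\<^sup>+u. ennreal ((norm (F u))\<^sup>2) * indicator {u. ?S \<alpha> u} u \<partial>M))"
        by (intro mult_left_mono fourier_along_distribution r F B FB True) auto
      also have "\<dots> = (ennreal (r' * \<alpha> powr (r' - 1)) * ennreal (4 / \<alpha>\<^sup>2)) * (\<integral>\<^sup>+u. ennreal ((norm (F u))\<^sup>2) * indicator {u. ?S \<alpha> u} u \<partial>M)"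
        by (simp only: mult.assoc)
      also have "ennreal (r' * \<alpha> powr (r' - 1)) * ennreal (4 / \<alpha>\<^sup>2) = ennreal (4 * r' * \<alpha> powr (r' - 3))"
      proof -
        have "\<alpha> powr (r' - 1) = \<alpha> powr (r' - 3 + 2)" by simp
        also have "\<dots> = \<alpha> powr (r' - 3) * \<alpha>\<^sup>2" using True by (subst powr_add) (simp add: powr_numeral)
        finally show ?thesis using True r'2 by (simp add: ennreal_mult'[symmetric])
      qed
      also have "ennreal (4 * r' * \<alpha> powr (r' - 3)) * (\<integral>\<^sup>+u. ennreal ((norm (F u))\<^sup>2) * indicator {u. ?S \<alpha> u} u \<partial>M)
        = (\<integral>\<^sup>+u. ennreal (4 * r' * \<alpha> powr (r' - 3)) * (ennreal ((norm (F u))\<^sup>2) * indicator {u. ?S \<alpha> u} u) \<partial>M)"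
        by (rule nn_integral_cmult[symmetric]) measurable
      also have "\<dots> = (\<integral>\<^sup>+u. ennreal ((norm (F u))\<^sup>2) * (ennreal (4 * r' * \<alpha> powr (r' - 3)) * indicator {(\<alpha>, u). 0 < \<alpha> \<and> ?S \<alpha> u} (\<alpha>, u)) \<partial>M)"
        using True by (intro nn_integral_cong) (auto simp: indicator_def mult.commute)
      finally show ?thesis .
    next
      case False
      then have "(\<integral>\<^sup>+x. ennreal (r' * \<alpha> powr (r' - 1)) * indicator {(\<alpha>, x). 0 \<le> \<alpha> \<and> \<alpha> \<le> norm (?T x)} (\<alpha>, x) \<partial>lborel) = (\<integral>\<^sup>+x. 0 \<partial>(lborel :: (real^2) measure))"
        by (intro nn_integral_cong) (auto simp: indicator_def)
      then show ?thesis by simp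
    qed
  qed
  also have "\<dots> = (\<integral>\<^sup>+u. \<integral>\<^sup>+\<alpha>. ennreal ((norm (F u))\<^sup>2) * (ennreal (4 * r' * \<alpha> powr (r' - 3)) * indicator {(\<alpha>, u). 0 < \<alpha> \<and> ?S \<alpha> u} (\<alpha>, u)) \<partial>lborel \<partial>M)"
    by (rule LM.Fubini'[symmetric]) measurable
  also have "\<dots> \<le> (\<integral>\<^sup>+u. ennreal (4 * r' / (r' - 2) * (2 * B) powr (r' - 2)) * ennreal (norm (F u) powr r) \<partial>M)"
  proof (rule nn_integral_mono)
    fix u
    show "(\<integral>\<^sup>+\<alpha>. ennreal ((norm (F u))\<^sup>2) * (ennreal (4 * r' * \<alpha> powr (r' - 3)) * indicator {(\<alpha>, u). 0 < \<alpha> \<and> ?S \<alpha> u} (\<alpha>, u)) \<partial>lborel)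
       \<le> ennreal (4 * r' / (r' - 2) * (2 * B) powr (r' - 2)) * ennreal (norm (F u) powr r)"
    proof (cases "F u = 0")
      case False
      \<comment> \<open>The truncation condition solved for \<alpha>: the value at u belongs to the
        small part only up to height \<open>b\<close>. The power r' - 3 is integrable at 0 because
        r' > 2.\<close>
      define b where "b = 2 * B * norm (F u) powr (1 - r)"
      have b: "0 < b" using B False by (simp add: b_def)
      have Sb: "\<alpha> \<le> b" if "?S \<alpha> u" for \<alpha>
      proof -
        have "\<alpha> * norm (F u) powr (r - 1) * norm (F u) powr (1 - r) \<le> b"
          unfolding b_def using that by (intro mult_right_mono) auto
        moreover have "norm (F u) powr (r - 1) * norm (F u) powr (1 - r) = 1" using False by (simp flip: powr_add)
        ultimately show ?thesis by (simp add: mult.assoc)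
      qed
      have "((\<lambda>t. (4 * r') * t powr (r' - 3)) has_integral ((4 * r') * (b powr (r' - 3 + 1) / (r' - 3 + 1)))) {0..b}"
        by (intro has_integral_mult_right has_integral_powr_from_0) (use b r'2 in auto)
      from nn_integral_has_integral_lebesgue'[OF _ this] r'2
      have I: "(\<integral>\<^sup>+\<alpha>. ennreal (4 * r' * \<alpha> powr (r' - 3)) * indicator {0..b} \<alpha> \<partial>lborel) = ennreal (4 * r' * (b powr (r' - 2) / (r' - 2)))"
        by simp
      have "(\<integral>\<^sup>+\<alpha>. ennreal ((norm (F u))\<^sup>2) * (ennreal (4 * r' * \<alpha> powr (r' - 3)) * indicator {(\<alpha>, u). 0 < \<alpha> \<and> ?S \<alpha> u} (\<alpha>, u)) \<partial>lborel)
         \<le> (\<integral>\<^sup>+\<alpha>. ennreal ((norm (F u))\<^sup>2) * (ennreal (4 * r' * \<alpha> powr (r' - 3)) * indicator {0..b} \<alpha>) \<partial>lborel)"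
        using Sb by (intro nn_integral_mono mult_left_mono) (auto simp: indicator_def)
      also have "\<dots> = ennreal ((norm (F u))\<^sup>2) * ennreal (4 * r' * (b powr (r' - 2) / (r' - 2)))"
        by (subst nn_integral_cmult) (auto simp: I)
      also have "\<dots> = ennreal ((norm (F u))\<^sup>2 * (4 * r' * (b powr (r' - 2) / (r' - 2))))"
        by (rule ennreal_mult'[symmetric]) simp
      also have "(norm (F u))\<^sup>2 * (4 * r' * (b powr (r' - 2) / (r' - 2))) = 4 * r' / (r' - 2) * (2 * B) powr (r' - 2) * norm (F u) powr r"
      proof -
        \<comment> \<open>Indeed r' - 2 = (2 - r) / (r - 1), so the powers of
          \<open>norm (F u)\<close> recombine to exactly r.\<close>
        have "2 + (1 - r) * (r' - 2) = r" using r by (simp add: r' field_simps)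
        then have "norm (F u) powr r = norm (F u) powr 2 * norm (F u) powr ((1 - r) * (r' - 2))"
          by (metis powr_add)
        moreover have "norm (F u) powr 2 = (norm (F u))\<^sup>2" using False by (simp add: powr_numeral)
        moreover have "b powr (r' - 2) = (2 * B) powr (r' - 2) * norm (F u) powr ((1 - r) * (r' - 2))"
          unfolding b_def using B by (simp add: powr_mult powr_powr)
        ultimately show ?thesis by simp
      qed
      finally have "(\<integral>\<^sup>+\<alpha>. ennreal ((norm (F u))\<^sup>2) * (ennreal (4 * r' * \<alpha> powr (r' - 3)) * indicator {(\<alpha>, u). 0 < \<alpha> \<and> ?S \<alpha> u} (\<alpha>, u)) \<partial>lborel)
         \<le> ennreal (4 * r' / (r' - 2) * (2 * B) powr (r' - 2) * norm (F u) powr r)" .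
      moreover have "0 \<le> 4 * r' / (r' - 2) * (2 * B) powr (r' - 2)" using r'2 by simp
      ultimately show ?thesis by (simp only: ennreal_mult')
    qed (use r'2 in simp)
  qed
  also have "\<dots> = ennreal (4 * r' / (r' - 2) * (2 * B) powr (r' - 2)) * (\<integral>\<^sup>+u. ennreal (norm (F u) powr r) \<partial>M)"
    by (rule nn_integral_cmult) measurable
  also have "\<dots> \<le> ennreal (4 * r' / (r' - 2) * (2 * B) powr (r' - 2)) * ennreal B"
    by (intro mult_left_mono FB) simp
  also have "\<dots> = ennreal (4 * r' / (r' - 2) * (2 * B) powr (r' - 2) * B)"
    by (rule ennreal_mult'[symmetric]) (use r'2 in simp)
  finally show ?thesis .
qed

end

section \<open>Changes of variables\<close>

text \<open>Monotone convergence over balls reduces the domination to bounded sets. Images contained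
  in a bounded set have finite measure, which the change of variables theorems ask for.\<close>

lemma nn_integral_push_le:
  fixes \<Phi> :: "'a \<Rightarrow> 'b::euclidean_space"
  assumes [measurable]: "\<Phi> \<in> borel_measurable M"
    and le: "\<And>B. B \<in> sets borel \<Longrightarrow> bounded B \<Longrightarrow> emeasure M (\<Phi> -` B \<inter> space M) \<le> emeasure lborel B"
    and [measurable]: "g \<in> borel_measurable borel"
  shows "(\<integral>\<^sup>+u. g (\<Phi> u) \<partial>M) \<le> (\<integral>\<^sup>+y. g y \<partial>lborel)"
proof -
  have le': "emeasure (distr M borel \<Phi>) B \<le> emeasure lborel B" for B
  proof (cases "B \<in> sets borel")
    case [measurable]: True
    have U: "B = (\<Union>n::nat. B \<inter> ball 0 (real n))"
      by (auto simp: reals_Archimedean2)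
    have "emeasure (distr M borel \<Phi>) B = (SUP n::nat. emeasure (distr M borel \<Phi>) (B \<inter> ball 0 (real n)))"
      by (subst (1) U, rule SUP_emeasure_incseq[symmetric]) (auto simp: incseq_def)
    also have "\<dots> \<le> emeasure lborel B"
    proof (rule SUP_least)
      fix n :: nat
      have "emeasure (distr M borel \<Phi>) (B \<inter> ball 0 (real n)) = emeasure M (\<Phi> -` (B \<inter> ball 0 (real n)) \<inter> space M)"
        by (subst emeasure_distr) auto
      also have "\<dots> \<le> emeasure lborel (B \<inter> ball 0 (real n))"
        by (rule le) (auto intro: bounded_subset[OF bounded_ball])
      also have "\<dots> \<le> emeasure lborel B" by (rule emeasure_mono) auto
      finally show "emeasure (distr M borel \<Phi>) (B \<inter> ball 0 (real n)) \<le> emeasure lborel B" .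
    qed
    finally show ?thesis .
  qed (simp add: emeasure_notin_sets)
  have "(\<integral>\<^sup>+u. g (\<Phi> u) \<partial>M) = (\<integral>\<^sup>+y. g y \<partial>distr M borel \<Phi>)"
    by (subst nn_integral_distr) auto
  also have "\<dots> \<le> (\<integral>\<^sup>+y. g y \<partial>lborel)"
    by (rule nn_integral_mono_measure) (auto simp: le_measure_iff le_fun_def le')
  finally show ?thesis .
qed

lemma has_measure_differentiable_image_real:
  fixes f :: "real \<Rightarrow> real"
  assumes S: "S \<in> sets borel" and der: "\<And>x. x \<in> S \<Longrightarrow> (f has_real_derivative h x) (at x)"
    and inj: "inj_on f S" and bdd: "bounded (f ` S)" and [measurable]: "h \<in> borel_measurable borel"
  shows "(\<integral>\<^sup>+x. ennreal \<bar>h x\<bar> * indicator S x \<partial>lborel) = ennreal (measure lebesgue (f ` S))" and "f ` S \<in> lmeasurable"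
proof -
  have S': "S \<in> sets lebesgue" using S by auto
  have der': "(f has_real_derivative h x) (at x within S)" if "x \<in> S" for x
    using der[OF that] by (rule has_field_derivative_at_within)
  have "f ` S \<in> sets lebesgue"
    by (rule differentiable_image_in_sets_lebesgue[OF S'])
       (use der' in \<open>auto simp: differentiable_on_def real_differentiable_def\<close>)
  then show im: "f ` S \<in> lmeasurable" using bdd by (rule bounded_set_imp_lmeasurable[rotated])
  have "(\<lambda>x. 1 :: real) absolutely_integrable_on f ` S \<and> integral (f ` S) (\<lambda>x. 1) = measure lebesgue (f ` S)"
    using im by (simp add: lmeasure_integral absolutely_integrable_on_def lmeasurable_iff_integrable_on)
  then have "(\<lambda>x. \<bar>h x\<bar> *\<^sub>R (1::real)) absolutely_integrable_on S \<and> integral S (\<lambda>x. \<bar>h x\<bar> *\<^sub>R (1::real)) = measure lebesgue (f ` S)"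
    by (subst has_absolute_integral_change_of_variables_real[OF S' der' inj]) auto
  then have "((\<lambda>x. \<bar>h x\<bar>) has_integral measure lebesgue (f ` S)) S"
    by (auto simp: has_integral_iff absolutely_integrable_on_def)
  from nn_integral_has_integral_lebesgue'[OF _ this]
  show "(\<integral>\<^sup>+x. ennreal \<bar>h x\<bar> * indicator S x \<partial>lborel) = ennreal (measure lebesgue (f ` S))" by simp
qed

lemma measure_lebesgue_le_lborel:
  assumes "A \<in> lmeasurable" "A \<subseteq> B" "B \<in> sets borel"
  shows "ennreal (measure lebesgue A) \<le> emeasure lborel B"
proof -
  have "ennreal (measure lebesgue A) = emeasure lebesgue A" using assms(1) by (simp add: emeasure_eq_measure2)
  also have "\<dots> \<le> emeasure lebesgue B" using assms by (intro emeasure_mono) auto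
  also have "\<dots> = emeasure lborel B" using assms by simp
  finally show ?thesis .
qed

text \<open>The part of S that f sends into B is mapped injectively into B, so the area formula
  bounds its mass for the density |h| by the measure of B.\<close>

lemma nn_integral_deriv_push_le:
  fixes f :: "real \<Rightarrow> real"
  assumes S [measurable]: "S \<in> sets borel" and der: "\<And>x. x \<in> S \<Longrightarrow> (f has_real_derivative h x) (at x)"
    and inj: "inj_on f S" and [measurable]: "h \<in> borel_measurable borel" "f \<in> borel_measurable borel" "g \<in> borel_measurable borel"
  shows "(\<integral>\<^sup>+x. g (f x) \<partial>density lborel (\<lambda>x. ennreal \<bar>h x\<bar> * indicator S x)) \<le> (\<integral>\<^sup>+y. g y \<partial>lborel)"
proof (rule nn_integral_push_le)
  fix B :: "real set" assume B [measurable]: "B \<in> sets borel" and "bounded B"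
  let ?S = "S \<inter> f -` B"
  have S' [measurable]: "?S \<in> sets borel"
    using measurable_sets_borel[OF \<open>f \<in> borel_measurable borel\<close> B] by auto
  have bdd: "bounded (f ` ?S)" by (rule bounded_subset[OF \<open>bounded B\<close>]) auto
  have inj': "inj_on f ?S" using inj by (rule inj_on_subset) auto
  note im = has_measure_differentiable_image_real[OF S' der inj' bdd \<open>h \<in> borel_measurable borel\<close>]
  have "f -` B \<inter> space (density lborel (\<lambda>x. ennreal \<bar>h x\<bar> * indicator S x)) = f -` B" by simp
  then have "emeasure (density lborel (\<lambda>x. ennreal \<bar>h x\<bar> * indicator S x)) (f -` B \<inter> space (density lborel (\<lambda>x. ennreal \<bar>h x\<bar> * indicator S x)))
     = (\<integral>\<^sup>+x. ennreal \<bar>h x\<bar> * indicator S x * indicator (f -` B) x \<partial>lborel)"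
    using measurable_sets_borel[OF \<open>f \<in> borel_measurable borel\<close> B] by (simp add: emeasure_density)
  also have "\<dots> = (\<integral>\<^sup>+x. ennreal \<bar>h x\<bar> * indicator ?S x \<partial>lborel)"
    by (intro nn_integral_cong) (auto simp: indicator_def)
  also have "\<dots> = ennreal (measure lebesgue (f ` ?S))" by (rule im(1)) auto
  also have "\<dots> \<le> emeasure lborel B" by (rule measure_lebesgue_le_lborel[OF im(2)]) auto
  finally show "emeasure (density lborel (\<lambda>x. ennreal \<bar>h x\<bar> * indicator S x)) (f -` B \<inter> space (density lborel (\<lambda>x. ennreal \<bar>h x\<bar> * indicator S x))) \<le> emeasure lborel B" .
qed auto

lemma nn_integral_jacobian_push_le:
  fixes f :: "real^2 \<Rightarrow> real^2"
  assumes S [measurable]: "S \<in> sets borel" and der: "\<And>x. x \<in> S \<Longrightarrow> (f has_derivative f' x) (at x)"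
    and J: "\<And>x. x \<in> S \<Longrightarrow> \<bar>det (matrix (f' x))\<bar> = J x" and [measurable]: "J \<in> borel_measurable borel"
    and inj: "inj_on f S" and [measurable]: "f \<in> borel_measurable borel" "g \<in> borel_measurable borel"
  shows "(\<integral>\<^sup>+x. ennreal (J x) * indicator S x * g (f x) \<partial>lborel) \<le> (\<integral>\<^sup>+y. g y \<partial>lborel)"
proof -
  let ?M = "density lborel (\<lambda>x. ennreal (J x) * indicator S x)"
  have "(\<integral>\<^sup>+x. g (f x) \<partial>?M) \<le> (\<integral>\<^sup>+y. g y \<partial>lborel)"
  proof (rule nn_integral_push_le)
    fix B :: "(real^2) set" assume B [measurable]: "B \<in> sets borel" and "bounded B"
    let ?S = "S \<inter> f -` B"
    have S' [measurable]: "?S \<in> sets borel"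
      using measurable_sets_borel[OF \<open>f \<in> borel_measurable borel\<close> B] by auto
    have der': "(f has_derivative f' x) (at x within ?S)" if "x \<in> ?S" for x
      using der that by (auto intro: has_derivative_at_withinI)
    have "f ` ?S \<in> sets lebesgue"
      by (rule differentiable_image_in_sets_lebesgue)
         (use der' S' in \<open>auto simp: differentiable_on_def differentiable_def\<close>)
    then have im: "f ` ?S \<in> lmeasurable"
      by (rule bounded_set_imp_lmeasurable[rotated]) (rule bounded_subset[OF \<open>bounded B\<close>], auto)
    have inj': "inj_on f ?S" using inj by (rule inj_on_subset) auto
    have SL: "?S \<in> sets lebesgue" using S' by auto
    have "((\<lambda>x. \<bar>det (matrix (f' x))\<bar>) has_integral measure lebesgue (f ` ?S)) ?S"
      using has_measure_differentiable_image[OF SL der' inj', of "measure lebesgue (f ` ?S)"] im by blast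
    from nn_integral_has_integral_lebesgue'[OF _ this]
    have I: "(\<integral>\<^sup>+x. ennreal \<bar>det (matrix (f' x))\<bar> * indicator ?S x \<partial>lborel) = ennreal (measure lebesgue (f ` ?S))" by simp
    have "emeasure ?M (f -` B \<inter> space ?M) = (\<integral>\<^sup>+x. ennreal (J x) * indicator S x * indicator (f -` B) x \<partial>lborel)"
      using measurable_sets_borel[OF \<open>f \<in> borel_measurable borel\<close> B] by (simp add: emeasure_density)
    also have "\<dots> = (\<integral>\<^sup>+x. ennreal \<bar>det (matrix (f' x))\<bar> * indicator ?S x \<partial>lborel)"
      using J by (intro nn_integral_cong) (auto simp: indicator_def)
    also have "\<dots> \<le> emeasure lborel B" unfolding I by (rule measure_lebesgue_le_lborel[OF im]) auto
    finally show "emeasure ?M (f -` B \<inter> space ?M) \<le> emeasure lborel B" .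
  qed auto
  then show ?thesis by (simp add: nn_integral_density)
qed

section \<open>Restriction to a convex arc\<close>

definition dir :: "real \<Rightarrow> real^2" where
  "dir a = vector [cos a, sin a]"

definition cross2 :: "real^2 \<Rightarrow> real^2 \<Rightarrow> real" where
  "cross2 a b = a $ 1 * b $ 2 - a $ 2 * b $ 1"

lemma dir_nth [simp]: "dir a $ 1 = cos a" "dir a $ 2 = sin a"
  by (simp_all add: dir_def)

lemma cross2_dir: "cross2 (dir a) (dir b) = sin (b - a)"
  by (simp add: cross2_def sin_diff mult.commute)

lemma inner_dir: "dir a \<bullet> dir b = cos (b - a)"
  by (simp add: inner_real2 cos_diff mult.commute)

lemma norm_dir [simp]: "norm (dir a) = 1"
  by (simp add: norm_eq_1 inner_dir)

text \<open>The cosine is at least 1/2 up to \<pi>/3, which exceeds 1. On arcs of angle at most 1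
  this makes the Jacobian comparable to the angle difference.\<close>

lemma sin_ge_half:
  fixes x :: real
  assumes "0 \<le> x" "x \<le> 1"
  shows "x / 2 \<le> sin x"
proof -
  have "(\<lambda>x. sin x - x / 2) 0 \<le> (\<lambda>x. sin x - x / 2) x"
  proof (rule DERIV_nonneg_imp_nondecreasing[OF assms(1)])
    fix y assume y: "0 \<le> y" "y \<le> x"
    have "y \<le> pi / 3" using y assms pi_gt3 by simp
    then have "cos (pi / 3) \<le> cos y" using y pi_gt3 by (intro cos_monotone_0_pi_le) auto
    then have "0 \<le> cos y - 1 / 2" by (simp add: cos_60)
    moreover have "((\<lambda>x. sin x - x / 2) has_real_derivative (cos y - 1 / 2)) (at y)"
      by (auto intro!: derivative_eq_intros)
    ultimately show "\<exists>d. ((\<lambda>x. sin x - x / 2) has_real_derivative d) (at y) \<and> 0 \<le> d" by blast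
  qed
  then show ?thesis by simp
qed

lemma lborel_AE_neq: "AE p in lborel \<Otimes>\<^sub>M (lborel :: real measure). fst p \<noteq> snd p"
proof (rule lborel_pair.AE_pair_measure)
  show "{p \<in> space (lborel \<Otimes>\<^sub>M lborel). fst p \<noteq> (snd p :: real)} \<in> sets (lborel \<Otimes>\<^sub>M lborel)"
    by measurable
  show "AE x in lborel. AE y in lborel. fst (x, y) \<noteq> (snd (x, y) :: real)"
  proof (rule AE_I2)
    fix x :: real
    show "AE y in lborel. fst (x, y) \<noteq> snd (x, y)"
      using AE_lborel_singleton[of x] by eventually_elim auto
  qed
qed

lemma nn_integral_lborel_pair_real2:
  assumes [measurable]: "f \<in> borel_measurable (borel \<Otimes>\<^sub>M borel)"
  shows "(\<integral>\<^sup>+p. f p \<partial>(lborel \<Otimes>\<^sub>M lborel)) = (\<integral>\<^sup>+x. f ((x :: real^2) $ 1, x $ 2) \<partial>lborel)"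
proof -
  have "(\<integral>\<^sup>+x. f ((x :: real^2) $ 1, x $ 2) \<partial>lborel) = (\<integral>\<^sup>+p. f (fst p, snd p) \<partial>(lborel \<Otimes>\<^sub>M lborel))"
    by (subst lborel_real2, subst nn_integral_distr) (auto simp: split_beta')
  then show ?thesis by simp
qed

text \<open>A convex arc whose tangent angle \<open>\<theta>\<close> varies by at most 1, restricted to a set \<open>D\<close> of
  parameters at which the curvature \<open>\<kappa> = \<theta>'\<close> exists and is positive.\<close>

locale convex_arc =
  fixes z :: "real \<Rightarrow> real^2" and \<theta> \<kappa> :: "real \<Rightarrow> real" and D :: "real set" and c :: real
  assumes D [measurable]: "D \<in> sets borel" "bounded D"
    and z_measurable [measurable]: "z \<in> borel_measurable borel"
    and \<kappa>_measurable [measurable]: "\<kappa> \<in> borel_measurable borel"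
    and \<theta>_mono: "mono \<theta>"
    and \<theta>_deriv: "\<And>t. t \<in> D \<Longrightarrow> (\<theta> has_real_derivative \<kappa> t) (at t)"
    and \<kappa>_pos: "\<And>t. t \<in> D \<Longrightarrow> 0 < \<kappa> t"
    and z_deriv: "\<And>t. t \<in> D \<Longrightarrow> (z has_vector_derivative dir (\<theta> t)) (at t)"
    and \<theta>_range: "\<And>t. t \<in> D \<Longrightarrow> c \<le> \<theta> t \<and> \<theta> t \<le> c + 1"
    and chord: "\<And>s t. s \<in> D \<Longrightarrow> t \<in> D \<Longrightarrow> s < t \<Longrightarrow>
      \<exists>\<rho> \<phi>. 0 < \<rho> \<and> \<theta> s \<le> \<phi> \<and> \<phi> \<le> \<theta> t \<and> z t - z s = \<rho> *\<^sub>R dir \<phi>"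
begin

lemma \<theta>_measurable [measurable]: "\<theta> \<in> borel_measurable borel"
  by (rule borel_measurable_mono[OF \<theta>_mono])

lemma \<theta>_strict:
  assumes "s \<in> D" "s < t"
  shows "\<theta> s < \<theta> t"
proof -
  obtain d where d: "d > 0" "\<And>h. 0 < h \<Longrightarrow> h < d \<Longrightarrow> \<theta> s < \<theta> (s + h)"
    using DERIV_pos_inc_right[OF \<theta>_deriv[OF assms(1)] \<kappa>_pos[OF assms(1)]] by auto
  let ?h = "min (d / 2) (t - s)"
  have "\<theta> s < \<theta> (s + ?h)" using d assms by (intro d(2)) auto
  also have "\<dots> \<le> \<theta> t" using monoD[OF \<theta>_mono, of "s + ?h" t] by simp
  finally show ?thesis .
qed

lemma angle_diff: "s \<in> D \<Longrightarrow> t \<in> D \<Longrightarrow> s < t \<Longrightarrow> 0 < \<theta> t - \<theta> s \<and> \<theta> t - \<theta> s \<le> 1"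
  using \<theta>_strict[of s t] \<theta>_range[of s] \<theta>_range[of t] by auto

definition offdiag :: "(real \<times> real) set" where
  "offdiag = {p. fst p \<in> D \<and> snd p \<in> D \<and> fst p < snd p}"

definition jac :: "real \<times> real \<Rightarrow> real" where
  "jac p = sin (\<theta> (snd p) - \<theta> (fst p))"

definition pair_sum :: "real \<times> real \<Rightarrow> real^2" where
  "pair_sum p = z (fst p) + z (snd p)"

text \<open>The density is the Jacobian of \<open>pair_sum\<close>, so that the image of this
  measure lies below Lebesgue measure.\<close>

definition pair_measure :: "(real \<times> real) measure" where
  "pair_measure = density (lborel \<Otimes>\<^sub>M lborel) (\<lambda>p. ennreal (jac p * indicator offdiag p))"

lemma offdiag_measurable [measurable]: "offdiag \<in> sets (borel \<Otimes>\<^sub>M borel)"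
proof -
  have "offdiag = {p \<in> space (borel \<Otimes>\<^sub>M borel). fst p \<in> D \<and> snd p \<in> D \<and> fst p < snd p}"
    by (simp add: offdiag_def space_pair_measure)
  also have "\<dots> \<in> sets (borel \<Otimes>\<^sub>M borel)" by measurable
  finally show ?thesis .
qed

lemma jac_measurable [measurable]: "jac \<in> borel_measurable (borel \<Otimes>\<^sub>M borel)"
  unfolding jac_def by measurable

lemma pair_sum_measurable [measurable]: "pair_sum \<in> borel_measurable (borel \<Otimes>\<^sub>M borel)"
  unfolding pair_sum_def by measurable

lemma jac_bounds:
  assumes "p \<in> offdiag"
  shows "(\<theta> (snd p) - \<theta> (fst p)) / 2 \<le> jac p" "0 < jac p" "jac p \<le> 1"
proof -
  have *: "0 < \<theta> (snd p) - \<theta> (fst p)" "\<theta> (snd p) - \<theta> (fst p) \<le> 1"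
    using assms angle_diff[of "fst p" "snd p"] by (auto simp: offdiag_def)
  then show "(\<theta> (snd p) - \<theta> (fst p)) / 2 \<le> jac p" unfolding jac_def by (intro sin_ge_half) auto
  moreover have "0 < (\<theta> (snd p) - \<theta> (fst p)) / 2" using * by simp
  ultimately show "0 < jac p" by (rule less_le_trans[rotated])
  show "jac p \<le> 1" by (simp add: jac_def)
qed

text \<open>Every chord has a direction within angle 1 < \<pi>/2 of \<open>dir c\<close>, so the
  projection to that line orders the points of the arc.\<close>

lemma increasing_along_chord:
  assumes "s \<in> D" "t \<in> D" "s < t"
  shows "(z s) \<bullet> dir c < (z t) \<bullet> dir c"
proof -
  obtain \<rho> \<phi> where *: "0 < \<rho>" "\<theta> s \<le> \<phi>" "\<phi> \<le> \<theta> t" "z t - z s = \<rho> *\<^sub>R dir \<phi>"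
    using chord[OF assms] by blast
  have "- (pi / 2) < c - \<phi>" "c - \<phi> < pi / 2" using * \<theta>_range[of s] \<theta>_range[of t] assms pi_gt3 by auto
  then have "0 < cos (c - \<phi>)" by (intro cos_gt_zero_pi) auto
  then have "0 < (z t - z s) \<bullet> dir c" using * by (simp add: inner_dir)
  then show ?thesis by (simp add: inner_diff_left)
qed

text \<open>If two pairs with equal sums had s < s', projecting to \<open>dir c\<close> would give
  t' < t. The chords from z s to z s' and from z t' to z t would then be the same vector, although
  the first has an angle at most \<theta> s', the second an angle at least \<theta> t' > \<theta>
  s', and the two differ by less than \<pi>.\<close>

lemma pair_sum_inj: "inj_on pair_sum offdiag"
proof (rule inj_onI)
  have no: False if D: "s \<in> D" "t \<in> D" "s' \<in> D" "t' \<in> D" and "s < t" "s' < t'" "s < s'" and eq: "z s + z t = z s' + z t'" for s t s' t'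
  proof -
    have "z s \<bullet> dir c < z s' \<bullet> dir c" using increasing_along_chord D \<open>s < s'\<close> by blast
    then have "z t' \<bullet> dir c < z t \<bullet> dir c"
      using arg_cong[OF eq, of "\<lambda>x. x \<bullet> dir c"] by (simp add: inner_add_left)
    then have "t' < t" using increasing_along_chord[of t t'] D by (metis less_irrefl linorder_neqE less_trans)
    obtain \<rho> \<phi> where 1: "0 < \<rho>" "\<theta> s \<le> \<phi>" "\<phi> \<le> \<theta> s'" "z s' - z s = \<rho> *\<^sub>R dir \<phi>"
      using chord[of s s'] D \<open>s < s'\<close> by blast
    obtain \<rho>' \<psi> where 2: "0 < \<rho>'" "\<theta> t' \<le> \<psi>" "\<psi> \<le> \<theta> t" "z t - z t' = \<rho>' *\<^sub>R dir \<psi>"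
      using chord[of t' t] D \<open>t' < t\<close> by blast
    have "\<rho> *\<^sub>R dir \<phi> = \<rho>' *\<^sub>R dir \<psi>"
      using eq by (simp add: 1(4)[symmetric] 2(4)[symmetric] algebra_simps)
    then have "cross2 (\<rho> *\<^sub>R dir \<phi>) (dir \<psi>) = cross2 (\<rho>' *\<^sub>R dir \<psi>) (dir \<psi>)" by simp
    then have "\<rho> * sin (\<psi> - \<phi>) = 0"
      by (simp add: cross2_def cross2_dir[symmetric] algebra_simps)
    then have "sin (\<psi> - \<phi>) = 0" using 1 by simp
    moreover have "0 < \<psi> - \<phi>" using 1 2 \<theta>_strict[of s' t'] D \<open>s' < t'\<close> by simp
    moreover have "\<psi> - \<phi> < pi" using 1 2 \<theta>_range[of s] \<theta>_range[of t] D pi_gt3 by simp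
    ultimately show False using sin_gt_zero[of "\<psi> - \<phi>"] by simp
  qed
  fix p q assume p: "p \<in> offdiag" and q: "q \<in> offdiag" and eq: "pair_sum p = pair_sum q"
  then have eq': "z (fst p) + z (snd p) = z (fst q) + z (snd q)" by (simp add: pair_sum_def)
  have fst: "fst p = fst q"
    using no[of "fst p" "snd p" "fst q" "snd q"] no[of "fst q" "snd q" "fst p" "snd p"] p q eq'
    by (metis (mono_tags, lifting) linorder_neqE mem_Collect_eq offdiag_def)
  then have "z (snd p) = z (snd q)" using eq' by simp
  then have "snd p = snd q"
    using increasing_along_chord[of "snd p" "snd q"] increasing_along_chord[of "snd q" "snd p"] p q
    by (cases "snd p" "snd q" rule: linorder_cases) (auto simp: offdiag_def)
  with fst show "p = q" by (simp add: prod_eq_iff)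
qed

lemma pair_measure_sets [simp, measurable_cong]: "sets pair_measure = sets (borel \<Otimes>\<^sub>M borel)"
  by (simp add: pair_measure_def)

lemma nn_integral_pair_measure:
  assumes [measurable]: "g \<in> borel_measurable (borel \<Otimes>\<^sub>M borel)"
  shows "(\<integral>\<^sup>+p. g p \<partial>pair_measure) = (\<integral>\<^sup>+p. ennreal (jac p * indicator offdiag p) * g p \<partial>(lborel \<Otimes>\<^sub>M lborel))"
  unfolding pair_measure_def by (rule nn_integral_density) measurable

text \<open>The derivative of (s, t) \<mapsto> z s + z t has the columns
  \<open>dir (\<theta> s)\<close> and \<open>dir (\<theta> t)\<close>, whose determinant is the sine
  of the angle difference.\<close>

sublocale pushed: pushed_below_lborel pair_measure pair_sum
proof -
  have pos: "0 \<le> jac p * indicator offdiag p" for p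
    using jac_bounds(2)[of p] by (auto simp: indicator_def)
  have LL: "sigma_finite_measure (lborel \<Otimes>\<^sub>M (lborel :: real measure))"
    by (simp add: lborel_prod lborel.sigma_finite_measure_axioms)
  have sf: "sigma_finite_measure pair_measure"
    unfolding pair_measure_def
    by (subst sigma_finite_measure.sigma_finite_iff_density_finite[OF LL]) auto
  have pushf: "(\<integral>\<^sup>+p. g (pair_sum p) \<partial>pair_measure) \<le> (\<integral>\<^sup>+y. g y \<partial>lborel)"
    if [measurable]: "g \<in> borel_measurable borel" for g
  proof -
    let ?q = "\<lambda>x :: real^2. (x $ 1, x $ 2)"
    have q [measurable]: "?q \<in> borel_measurable (borel :: (real^2) measure)" "?q \<in> measurable borel (borel \<Otimes>\<^sub>M borel)"
      by (simp_all add: borel_prod)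
    let ?S = "{x. ?q x \<in> offdiag}"
    have S [measurable]: "?S \<in> sets borel"
      using measurable_sets_borel[OF q(1), of offdiag] offdiag_measurable by (simp add: borel_prod vimage_def)
    let ?d = "\<lambda>x h. (h $ 1) *\<^sub>R dir (\<theta> (x $ 1)) + (h $ 2) *\<^sub>R dir (\<theta> (x $ 2))"
    have "(\<integral>\<^sup>+p. g (pair_sum p) \<partial>pair_measure) = (\<integral>\<^sup>+p. ennreal (jac p * indicator offdiag p) * g (pair_sum p) \<partial>(lborel \<Otimes>\<^sub>M lborel))"
      by (rule nn_integral_pair_measure) measurable
    also have "\<dots> = (\<integral>\<^sup>+x. ennreal (jac (?q x) * indicator offdiag (?q x)) * g (pair_sum (?q x)) \<partial>lborel)"
      by (rule nn_integral_lborel_pair_real2) measurable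
    also have "\<dots> = (\<integral>\<^sup>+x. ennreal (jac (?q x)) * indicator ?S x * g (pair_sum (?q x)) \<partial>lborel)"
      by (intro nn_integral_cong) (auto simp: indicator_def)
    also have "\<dots> \<le> (\<integral>\<^sup>+y. g y \<partial>lborel)"
    proof (rule nn_integral_jacobian_push_le[OF S])
      fix x assume x: "x \<in> ?S"
      then have xD: "x $ 1 \<in> D" "x $ 2 \<in> D" by (auto simp: offdiag_def)
      have "((\<lambda>x::real^2. z (x $ i)) has_derivative (\<lambda>h. (h $ i) *\<^sub>R dir (\<theta> (x $ i)))) (at x)" if "x $ i \<in> D" for i
        using has_derivative_compose[OF bounded_linear.has_derivative[OF bounded_linear_vec_nth has_derivative_ident]
            z_deriv[OF that, unfolded has_vector_derivative_def]] by simp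
      then show "((\<lambda>x. pair_sum (?q x)) has_derivative ?d x) (at x)"
        unfolding pair_sum_def fst_conv snd_conv using xD by (intro has_derivative_add) auto
      have "det (matrix (?d x)) = jac (?q x)"
        by (simp add: det_2 matrix_def axis_def jac_def sin_diff)
      moreover have "0 < jac (?q x)" using x jac_bounds(2)[of "?q x"] by simp
      ultimately show "\<bar>det (matrix (?d x))\<bar> = jac (?q x)" by simp
    next
      show "inj_on (\<lambda>x. pair_sum (?q x)) ?S"
      proof (rule inj_onI)
        fix x y assume "x \<in> ?S" "y \<in> ?S" "pair_sum (?q x) = pair_sum (?q y)"
        then have "?q x = ?q y" using pair_sum_inj by (auto dest: inj_onD)
        then show "x = y" by (simp add: vec_eq_iff forall_2)
      qed
    qed measurable
    finally show ?thesis .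
  qed
  interpret sigma_finite_measure pair_measure by (rule sf)
  show "pushed_below_lborel pair_measure pair_sum"
    by unfold_locales (use pushf in auto)
qed

end

text \<open>Here B is the Hardy-Littlewood-Sobolev constant for s = r - 1 times the loss 2 powr (r -
  1) from \<open>sin_ge_half\<close>. It is fed into the Hausdorff-Young constant, and 2 powr r'
  comes from writing the square as twice an integral over ordered pairs.\<close>

definition extension_const :: "real \<Rightarrow> real" where
  "extension_const r =
     (let r' = r / (r - 1); B = 2 powr (r - 1) * (2 * (2 / (1 - (r - 1)) + 3))
      in 2 powr r' * (4 * r' / (r' - 2) * (2 * B) powr (r' - 2) * B))"

section \<open>Curvature measure and extension operator\<close>

context convex_arc
begin

text \<open>On D this is d\<theta>: integration against it is integration in the tangent angle. Its
  image under \<theta> lies below Lebesgue measure.\<close>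

definition curvature_measure :: "real measure" where
  "curvature_measure = density lborel (\<lambda>t. ennreal \<bar>\<kappa> t\<bar> * indicator D t)"

lemma sets_curvature_measure [simp, measurable_cong]: "sets curvature_measure = sets borel"
  by (simp add: curvature_measure_def)

lemma nn_integral_curvature_measure:
  assumes [measurable]: "g \<in> borel_measurable borel"
  shows "(\<integral>\<^sup>+t. g t \<partial>curvature_measure) = (\<integral>\<^sup>+t. ennreal \<bar>\<kappa> t\<bar> * indicator D t * g t \<partial>lborel)"
  unfolding curvature_measure_def by (rule nn_integral_density) measurable

lemma sigma_finite_curvature_measure: "sigma_finite_measure curvature_measure"
  unfolding curvature_measure_def
  by (subst sigma_finite_measure.sigma_finite_iff_density_finite[OF lborel.sigma_finite_measure_axioms])
    (auto simp: indicator_def)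

lemma \<theta>_inj: "inj_on \<theta> D"
  by (rule inj_onI) (metis \<theta>_strict less_irrefl linorder_neqE)

lemma curvature_measure_push:
  assumes [measurable]: "g \<in> borel_measurable borel"
  shows "(\<integral>\<^sup>+t. g (\<theta> t) \<partial>curvature_measure) \<le> (\<integral>\<^sup>+y. g y \<partial>lborel)"
  unfolding curvature_measure_def
  by (rule nn_integral_deriv_push_le[OF D(1) \<theta>_deriv \<theta>_inj]) measurable

lemma total_curvature_le: "(\<integral>\<^sup>+t. ennreal \<bar>\<kappa> t\<bar> * indicator D t \<partial>lborel) \<le> 1"
proof -
  have "(\<integral>\<^sup>+t. ennreal \<bar>\<kappa> t\<bar> * indicator D t \<partial>lborel) = (\<integral>\<^sup>+t. ennreal \<bar>\<kappa> t\<bar> * indicator D t * indicator {c..c + 1} (\<theta> t) \<partial>lborel)"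
    using \<theta>_range by (intro nn_integral_cong) (auto simp: indicator_def)
  also have "\<dots> = (\<integral>\<^sup>+t. indicator {c..c + 1} (\<theta> t) \<partial>curvature_measure)"
    by (rule nn_integral_curvature_measure[symmetric]) measurable
  also have "\<dots> \<le> (\<integral>\<^sup>+y. indicator {c..c + 1} y \<partial>lborel)"
    by (rule curvature_measure_push) measurable
  finally show ?thesis by simp
qed

text \<open>Since \<open>\<kappa> powr (1/3)\<close> is at most 1 + \<kappa>, the bounded set D and
  the total curvature bound suffice. The bound depends on the arc, but only finiteness is taken from
  it.\<close>

lemma affine_arclength_finite: "(\<integral>\<^sup>+t. ennreal (\<kappa> t powr (1/3)) * indicator D t \<partial>lborel) < \<infinity>"
proof -
  have "(\<integral>\<^sup>+t. ennreal (\<kappa> t powr (1/3)) * indicator D t \<partial>lborel) \<le> (\<integral>\<^sup>+t. indicator D t + ennreal \<bar>\<kappa> t\<bar> * indicator D t \<partial>lborel)"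
  proof (rule nn_integral_mono)
    fix t
    have "ennreal (\<kappa> t powr (1/3)) \<le> 1 + ennreal \<bar>\<kappa> t\<bar>" if "t \<in> D"
    proof -
      have "\<kappa> t powr (1/3) \<le> 1 + \<kappa> t"
      proof (cases "\<kappa> t \<le> 1")
        case True
        then have "\<kappa> t powr (1/3) \<le> 1 powr (1/3)" using \<kappa>_pos[OF that] by (intro powr_mono2) auto
        then show ?thesis using \<kappa>_pos[OF that] by simp
      next
        case False
        then have "\<kappa> t powr (1/3) \<le> \<kappa> t powr 1" by (intro powr_mono) auto
        then show ?thesis using False by simp
      qed
      then have "ennreal (\<kappa> t powr (1/3)) \<le> ennreal (1 + \<bar>\<kappa> t\<bar>)"
        using \<kappa>_pos[OF that] by (intro ennreal_leI) simp
      then show ?thesis by (simp add: ennreal_plus)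
    qed
    then show "ennreal (\<kappa> t powr (1/3)) * indicator D t \<le> indicator D t + ennreal \<bar>\<kappa> t\<bar> * indicator D t"
      by (auto simp: indicator_def)
  qed
  also have "\<dots> = emeasure lborel D + (\<integral>\<^sup>+t. ennreal \<bar>\<kappa> t\<bar> * indicator D t \<partial>lborel)"
    by (subst nn_integral_add) auto
  also have "\<dots> \<le> emeasure lborel D + 1" by (intro add_left_mono total_curvature_le)
  also have "\<dots> < \<infinity>" using emeasure_bounded_finite[OF D(2)] by simp
  finally show ?thesis .
qed

text \<open>The weights of the two copies of the arc are distributed so that the energy of the
  tensor square becomes a one-dimensional Hardy-Littlewood-Sobolev form in the tangent angle.\<close>

lemma tensor_energy:
  assumes r: "1 < r" "r < 2" and [measurable]: "g \<in> borel_measurable borel"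
    and norm: "(\<integral>\<^sup>+t. ennreal (norm (g t) powr (2 * r / (3 - r)) * \<kappa> t powr (1/3)) * indicator D t \<partial>lborel) \<le> 1"
  defines "a \<equiv> (\<lambda>t. indicator D t * (norm (g t :: complex) * \<kappa> t powr (1/3)))"
  shows "(\<integral>\<^sup>+p. ennreal ((a (fst p) * a (snd p) / jac p) powr r) \<partial>pair_measure)
     \<le> ennreal (2 powr (r - 1) * (2 * (2 / (1 - (r - 1)) + 3)))"
proof -
  have [measurable]: "a \<in> borel_measurable borel" unfolding a_def by measurable
  define m where "m = 2 / (2 - (r - 1))"
  \<comment> \<open>Chosen so that \<open>a t powr r\<close> is \<kappa> times v: one factor
    \<kappa> becomes part of the curvature measure, and v is the density left over.\<close>
  define v where "v t = indicator D t * (norm (g t) powr r * \<kappa> t powr ((r - 3) / 3))" for t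
  have [measurable]: "v \<in> borel_measurable borel" unfolding v_def by measurable
  have v0: "0 \<le> v t" for t by (simp add: v_def)
  have a_powr: "a t powr r = \<bar>\<kappa> t\<bar> * v t" if "t \<in> D" for t
  proof -
    have "\<kappa> t * \<kappa> t powr ((r - 3) / 3) = \<kappa> t powr (1 + (r - 3) / 3)"
      using \<kappa>_pos[OF that] by (simp add: powr_add)
    also have "1 + (r - 3) / 3 = 1 / 3 * r" by (simp add: field_simps)
    finally have "\<kappa> t * \<kappa> t powr ((r - 3) / 3) = (\<kappa> t powr (1/3)) powr r" by (simp add: powr_powr)
    then show ?thesis using that \<kappa>_pos[OF that] by (simp add: a_def v_def powr_mult)
  qed
  have "(\<integral>\<^sup>+t. ennreal (v t powr m) \<partial>curvature_measure) = (\<integral>\<^sup>+t. ennreal \<bar>\<kappa> t\<bar> * indicator D t * ennreal (v t powr m) \<partial>lborel)"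
    by (rule nn_integral_curvature_measure) measurable
  also have "\<dots> = (\<integral>\<^sup>+t. ennreal (norm (g t) powr (2 * r / (3 - r)) * \<kappa> t powr (1/3)) * indicator D t \<partial>lborel)"
  proof (rule nn_integral_cong)
    fix t
    have "\<bar>\<kappa> t\<bar> * v t powr m = norm (g t) powr (2 * r / (3 - r)) * \<kappa> t powr (1/3)" if "t \<in> D"
    proof -
      \<comment> \<open>Both identities hold because m = 2 / (3 - r). They turn the m-norm of v for
        d\<theta> into the norm of g for affine arclength.\<close>
      have e: "r * m = 2 * r / (3 - r)" "1 + (r - 3) / 3 * m = 1 / 3"
        using r by (simp_all add: m_def field_simps)
      have "\<kappa> t * (\<kappa> t powr ((r - 3) / 3)) powr m = \<kappa> t powr (1 + (r - 3) / 3 * m)"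
        using \<kappa>_pos[OF that] by (simp add: powr_add powr_powr)
      then have "\<kappa> t * (\<kappa> t powr ((r - 3) / 3)) powr m = \<kappa> t powr (1 / 3)" unfolding e .
      moreover have "(norm (g t) powr r) powr m = norm (g t) powr (2 * r / (3 - r))"
        unfolding powr_powr e ..
      ultimately show ?thesis using that \<kappa>_pos[OF that] by (simp add: v_def powr_mult)
    qed
    then show "ennreal \<bar>\<kappa> t\<bar> * indicator D t * ennreal (v t powr m) = ennreal (norm (g t) powr (2 * r / (3 - r)) * \<kappa> t powr (1/3)) * indicator D t"
      by (auto simp: indicator_def ennreal_mult'[symmetric])
  qed
  finally have vm: "(\<integral>\<^sup>+t. ennreal (v t powr m) \<partial>curvature_measure) \<le> 1" using norm by simp
  have HLS: "(\<integral>\<^sup>+s. \<integral>\<^sup>+t. ennreal (v s * v t * \<bar>\<theta> s - \<theta> t\<bar> powr (- (r - 1))) \<partial>curvature_measure \<partial>curvature_measure)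
      \<le> ennreal (2 * (2 / (1 - (r - 1)) + 3))"
    by (rule Hardy_Littlewood_Sobolev_pushforward[OF sigma_finite_curvature_measure _ _ curvature_measure_push _ _ m_def v0 vm])
       (use r in auto)
  interpret C: sigma_finite_measure curvature_measure by (rule sigma_finite_curvature_measure)
  let ?H = "\<lambda>s t. v s * v t * \<bar>\<theta> s - \<theta> t\<bar> powr (- (r - 1))"
  let ?d = "\<lambda>t. ennreal \<bar>\<kappa> t\<bar> * indicator D t :: ennreal"
  have "(\<integral>\<^sup>+p. ennreal ((a (fst p) * a (snd p) / jac p) powr r) \<partial>pair_measure)
      = (\<integral>\<^sup>+p. ennreal (jac p * indicator offdiag p) * ennreal ((a (fst p) * a (snd p) / jac p) powr r) \<partial>(lborel \<Otimes>\<^sub>M lborel))"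
    by (rule nn_integral_pair_measure) measurable
  also have "\<dots> \<le> (\<integral>\<^sup>+p. ennreal (2 powr (r - 1)) * (?d (fst p) * (?d (snd p) * ennreal (?H (fst p) (snd p)))) \<partial>(lborel \<Otimes>\<^sub>M lborel))"
  proof (rule nn_integral_mono)
    fix p :: "real \<times> real"
    obtain s t where p: "p = (s, t)" by (cases p)
    show "ennreal (jac p * indicator offdiag p) * ennreal ((a (fst p) * a (snd p) / jac p) powr r)
       \<le> ennreal (2 powr (r - 1)) * (?d (fst p) * (?d (snd p) * ennreal (?H (fst p) (snd p))))"
    proof (cases "p \<in> offdiag")
      case True
      then have D': "s \<in> D" "t \<in> D" "s < t" by (auto simp: offdiag_def p)
      note J = jac_bounds[OF True]
      have a0: "0 \<le> a s" "0 \<le> a t" by (auto simp: a_def)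
      have th: "0 < (\<theta> t - \<theta> s) / 2" using angle_diff[OF D'] by simp
      \<comment> \<open>One power of the Jacobian comes from the density of
        \<open>pair_measure\<close>, the power - r from the division inside. As r > 1, the remaining
        exponent is negative, and the lower bound on the Jacobian gives an upper bound.\<close>
      have "jac p * (a s * a t / jac p) powr r = (a s powr r * a t powr r) * (jac p * jac p powr (- r))"
      proof -
        have "(a s * a t / jac p) powr r = a s powr r * a t powr r / jac p powr r"
          using a0 J by (simp add: powr_divide powr_mult)
        moreover have "x / jac p powr r = x * jac p powr (- r)" for x
          by (subst powr_minus) (rule divide_inverse)
        ultimately show ?thesis by (simp only: mult_ac)
      qed
      also have "jac p * jac p powr (- r) = jac p powr (1 + (- r))" using J by (simp only: powr_add) simp
      also have "1 + (- r) = - (r - 1)" by simp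
      also have "(a s powr r * a t powr r) * jac p powr (- (r - 1)) \<le> (a s powr r * a t powr r) * ((\<theta> t - \<theta> s) / 2) powr (- (r - 1))"
        using J(1) th r by (intro mult_left_mono powr_mono2') (auto simp: p)
      also have "((\<theta> t - \<theta> s) / 2) powr (- (r - 1)) = 2 powr (r - 1) * \<bar>\<theta> s - \<theta> t\<bar> powr (- (r - 1))"
      proof -
        have abs: "\<bar>\<theta> s - \<theta> t\<bar> = \<theta> t - \<theta> s" using th by simp
        have "((\<theta> t - \<theta> s) / 2) powr (- (r - 1)) = (\<theta> t - \<theta> s) powr (- (r - 1)) / 2 powr (- (r - 1))"
          by (rule powr_divide)
        also have "2 powr (- (r - 1)) = 1 / 2 powr (r - 1)" by (rule powr_minus_divide)
        finally show ?thesis unfolding abs by (simp only: divide_divide_eq_right div_by_1 mult.commute)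
      qed
      also have "(a s powr r * a t powr r) * (2 powr (r - 1) * \<bar>\<theta> s - \<theta> t\<bar> powr (- (r - 1)))
          = 2 powr (r - 1) * (\<bar>\<kappa> s\<bar> * (\<bar>\<kappa> t\<bar> * ?H s t))"
        unfolding a_powr[OF D'(1)] a_powr[OF D'(2)] by (simp only: mult_ac)
      finally have le: "jac p * (a s * a t / jac p) powr r \<le> 2 powr (r - 1) * (\<bar>\<kappa> s\<bar> * (\<bar>\<kappa> t\<bar> * ?H s t))" .
      have "ennreal (jac p) * ennreal ((a s * a t / jac p) powr r) = ennreal (jac p * (a s * a t / jac p) powr r)"
        using J by (intro ennreal_mult'[symmetric]) simp
      also have "\<dots> \<le> ennreal (2 powr (r - 1) * (\<bar>\<kappa> s\<bar> * (\<bar>\<kappa> t\<bar> * ?H s t)))" using le by (rule ennreal_leI)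
      also have "\<dots> = ennreal (2 powr (r - 1)) * (ennreal \<bar>\<kappa> s\<bar> * (ennreal \<bar>\<kappa> t\<bar> * ennreal (?H s t)))"
        by (simp only: ennreal_mult' abs_ge_zero powr_ge_zero)
      finally show ?thesis using True D' by (simp add: p)
    qed simp
  qed
  also have "\<dots> = ennreal (2 powr (r - 1)) * (\<integral>\<^sup>+p. ?d (fst p) * (?d (snd p) * ennreal (?H (fst p) (snd p))) \<partial>(lborel \<Otimes>\<^sub>M lborel))"
    by (rule nn_integral_cmult) measurable
  also have "(\<integral>\<^sup>+p. ?d (fst p) * (?d (snd p) * ennreal (?H (fst p) (snd p))) \<partial>(lborel \<Otimes>\<^sub>M lborel))
      = (\<integral>\<^sup>+s. \<integral>\<^sup>+t. ?d s * (?d t * ennreal (?H s t)) \<partial>lborel \<partial>lborel)"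
    by (subst lborel.nn_integral_fst[symmetric]) auto
  also have "\<dots> = (\<integral>\<^sup>+s. ?d s * (\<integral>\<^sup>+t. ennreal (?H s t) \<partial>curvature_measure) \<partial>lborel)"
  proof (rule nn_integral_cong)
    fix s
    have "(\<integral>\<^sup>+t. ?d s * (?d t * ennreal (?H s t)) \<partial>lborel) = ?d s * (\<integral>\<^sup>+t. ?d t * ennreal (?H s t) \<partial>lborel)"
      by (rule nn_integral_cmult) measurable
    also have "(\<integral>\<^sup>+t. ?d t * ennreal (?H s t) \<partial>lborel) = (\<integral>\<^sup>+t. ennreal (?H s t) \<partial>curvature_measure)"
      by (rule nn_integral_curvature_measure[symmetric]) measurable
    finally show "(\<integral>\<^sup>+t. ?d s * (?d t * ennreal (?H s t)) \<partial>lborel) = ?d s * (\<integral>\<^sup>+t. ennreal (?H s t) \<partial>curvature_measure)" .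
  qed
  also have "\<dots> = (\<integral>\<^sup>+s. \<integral>\<^sup>+t. ennreal (?H s t) \<partial>curvature_measure \<partial>curvature_measure)"
    by (rule nn_integral_curvature_measure[symmetric]) measurable
  also have "ennreal (2 powr (r - 1)) * \<dots> \<le> ennreal (2 powr (r - 1)) * ennreal (2 * (2 / (1 - (r - 1)) + 3))"
    by (intro mult_left_mono HLS) simp
  finally show ?thesis by (simp only: ennreal_mult'[OF powr_ge_zero])
qed

definition extension :: "(real \<Rightarrow> complex) \<Rightarrow> real^2 \<Rightarrow> complex" where
  "extension g x = (LINT t|lborel. (indicator D t *\<^sub>R (g t * of_real (\<kappa> t powr (1/3)))) * fchar x (z t))"

lemma integrable_times_fchar:
  assumes "integrable M a" and [measurable]: "(\<zeta> :: 'a \<Rightarrow> real^2) \<in> borel_measurable M"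
  shows "integrable M (\<lambda>t. a t * fchar x (\<zeta> t))"
proof -
  have [measurable]: "a \<in> borel_measurable M" using assms(1) by auto
  show ?thesis by (rule Bochner_Integration.integrable_bound[OF assms(1)]) (auto simp: norm_mult)
qed

text \<open>The exponent doubles because Hausdorff-Young is applied to the square of the extension,
  a transform on the plane to which \<open>tensor_energy\<close> supplies the r-norm.\<close>

lemma extension_estimate:
  assumes r: "1 < r" "r < 2" and [measurable]: "g \<in> borel_measurable borel"
    and int: "integrable lborel (\<lambda>t. indicator D t *\<^sub>R (g t * of_real (\<kappa> t powr (1/3))))"
    and norm: "(\<integral>\<^sup>+t. ennreal (norm (g t) powr (2 * r / (3 - r)) * \<kappa> t powr (1/3)) * indicator D t \<partial>lborel) \<le> 1"
  shows "(\<integral>\<^sup>+x. ennreal (norm (extension g x) powr (2 * (r / (r - 1)))) \<partial>lborel) \<le> ennreal (extension_const r)"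
proof -
  define a where "a t = indicator D t *\<^sub>R (g t * of_real (\<kappa> t powr (1/3)))" for t
  have [measurable]: "a \<in> borel_measurable borel" unfolding a_def by measurable
  have inta: "integrable lborel a" using int by (simp add: a_def[abs_def])
  \<comment> \<open>Dividing by the Jacobian cancels the density of \<open>pair_measure\<close>, so
    integrating F against it is integrating the tensor square over ordered pairs.\<close>
  define F where "F p = a (fst p) * a (snd p) / of_real (jac p)" for p
  have [measurable]: "F \<in> borel_measurable (borel \<Otimes>\<^sub>M borel)" unfolding F_def by measurable
  have P: "pair_sigma_finite lborel (lborel :: real measure)" ..
  define B where "B = 2 powr (r - 1) * (2 * (2 / (1 - (r - 1)) + 3))"
  have B: "0 < B" unfolding B_def using r by (intro mult_pos_pos add_pos_pos divide_pos_pos) auto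
  have aa: "integrable (lborel \<Otimes>\<^sub>M lborel) (\<lambda>p. a (fst p) * a (snd p))"
    using integrable_times_pair(1)[OF P inta inta] by (simp add: split_beta')
  have intF: "integrable pair_measure F"
  proof (rule integrableI_bounded)
    have "(\<integral>\<^sup>+p. ennreal (norm (F p)) \<partial>pair_measure) = (\<integral>\<^sup>+p. ennreal (jac p * indicator offdiag p) * ennreal (norm (F p)) \<partial>(lborel \<Otimes>\<^sub>M lborel))"
      by (rule nn_integral_pair_measure) measurable
    also have "\<dots> \<le> (\<integral>\<^sup>+p. ennreal (norm (a (fst p) * a (snd p))) \<partial>(lborel \<Otimes>\<^sub>M lborel))"
    proof (rule nn_integral_mono)
      fix p
      show "ennreal (jac p * indicator offdiag p) * ennreal (norm (F p)) \<le> ennreal (norm (a (fst p) * a (snd p)))"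
        using jac_bounds(2)[of p]
        by (cases "p \<in> offdiag") (auto simp: F_def norm_divide ennreal_mult'[symmetric] simp del: norm_mult)
    qed
    also have "\<dots> < \<infinity>" using aa by (simp add: integrable_iff_bounded)
    finally show "(\<integral>\<^sup>+p. ennreal (norm (F p)) \<partial>pair_measure) < \<infinity>" .
  qed measurable
  have "(\<integral>\<^sup>+p. ennreal (norm (F p) powr r) \<partial>pair_measure) = (\<integral>\<^sup>+p. ennreal ((indicator D (fst p) * (norm (g (fst p)) * \<kappa> (fst p) powr (1/3)) *
      (indicator D (snd p) * (norm (g (snd p)) * \<kappa> (snd p) powr (1/3))) / jac p) powr r) \<partial>pair_measure)"
  proof -
    have "AE p in pair_measure. 0 < jac p"
      unfolding pair_measure_def using jac_bounds(2) by (subst AE_density) (auto simp: indicator_def)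
    then have *: "AE p in pair_measure. norm (F p) = indicator D (fst p) * (norm (g (fst p)) * \<kappa> (fst p) powr (1/3)) *
      (indicator D (snd p) * (norm (g (snd p)) * \<kappa> (snd p) powr (1/3))) / jac p"
      by eventually_elim (auto simp: F_def a_def norm_mult norm_divide indicator_def)
    show ?thesis by (rule nn_integral_cong_AE, rule eventually_mono[OF *]) (simp only:)
  qed
  also have "\<dots> \<le> ennreal B" unfolding B_def by (rule tensor_energy[OF r _ norm]) measurable
  finally have FB: "(\<integral>\<^sup>+p. ennreal (norm (F p) powr r) \<partial>pair_measure) \<le> ennreal B" .
  note HY = pushed.Hausdorff_Young_along[OF r refl intF B FB]
  \<comment> \<open>The diagonal is null, and the two triangles contribute equally because the
    tensor square is symmetric.\<close>
  have sq: "(extension g x)\<^sup>2 = 2 * fourier_along pair_measure pair_sum F x" for x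
  proof -
    define A where "A t = a t * fchar x (z t)" for t
    have A: "integrable lborel A" unfolding A_def by (rule integrable_times_fchar[OF inta]) simp
    then have [measurable]: "A \<in> borel_measurable borel" by auto
    let ?AA = "\<lambda>p. A (fst p) * A (snd p)"
    have AA: "integrable (lborel \<Otimes>\<^sub>M lborel) ?AA"
      using integrable_times_pair(1)[OF P A A] by (simp add: split_beta')
    let ?L = "{p :: real \<times> real. fst p < snd p}" and ?G = "{p :: real \<times> real. snd p < fst p}"
    have L [measurable]: "?L \<in> sets (borel \<Otimes>\<^sub>M borel)" and G [measurable]: "?G \<in> sets (borel \<Otimes>\<^sub>M borel)"
    proof -
      have "{p \<in> space (borel \<Otimes>\<^sub>M borel). fst p < (snd p :: real)} \<in> sets (borel \<Otimes>\<^sub>M borel)" by measurable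
      then show "?L \<in> sets (borel \<Otimes>\<^sub>M borel)" by (simp add: space_pair_measure)
      have "{p \<in> space (borel \<Otimes>\<^sub>M borel). snd p < (fst p :: real)} \<in> sets (borel \<Otimes>\<^sub>M borel)" by measurable
      then show "?G \<in> sets (borel \<Otimes>\<^sub>M borel)" by (simp add: space_pair_measure)
    qed
    have iL: "integrable (lborel \<Otimes>\<^sub>M lborel) (\<lambda>p. indicator ?L p *\<^sub>R ?AA p)"
     and iG: "integrable (lborel \<Otimes>\<^sub>M lborel) (\<lambda>p. indicator ?G p *\<^sub>R ?AA p)"
      by (rule integrable_mult_indicator[OF _ AA], simp)+
    have "(extension g x)\<^sup>2 = (LINT p|(lborel \<Otimes>\<^sub>M lborel). ?AA p)"
    proof -
      have "extension g x = (LINT t|lborel. A t)" by (simp only: extension_def A_def a_def)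
      then show ?thesis by (simp only: integrable_times_pair(2)[OF P A A] power2_eq_square)
    qed
    also have "\<dots> = (LINT p|(lborel \<Otimes>\<^sub>M lborel). indicator ?L p *\<^sub>R ?AA p + indicator ?G p *\<^sub>R ?AA p)"
    proof (rule integral_cong_AE)
      show "AE p in lborel \<Otimes>\<^sub>M lborel. ?AA p = indicator ?L p *\<^sub>R ?AA p + indicator ?G p *\<^sub>R ?AA p"
        using lborel_AE_neq by eventually_elim (auto simp: indicator_def)
    qed measurable
    also have "\<dots> = (LINT p|(lborel \<Otimes>\<^sub>M lborel). indicator ?L p *\<^sub>R ?AA p) + (LINT p|(lborel \<Otimes>\<^sub>M lborel). indicator ?G p *\<^sub>R ?AA p)"
      by (rule Bochner_Integration.integral_add[OF iL iG])
    also have "(LINT p|(lborel \<Otimes>\<^sub>M lborel). indicator ?G p *\<^sub>R ?AA p) = (LINT p|(lborel \<Otimes>\<^sub>M lborel). indicator ?L p *\<^sub>R ?AA p)"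
    proof -
      have "(LINT p|(lborel \<Otimes>\<^sub>M lborel). indicator ?L p *\<^sub>R ?AA p) = (LINT (s, t)|(lborel \<Otimes>\<^sub>M lborel). indicator ?L (t, s) *\<^sub>R ?AA (t, s))"
        by (rule lborel_pair.integral_product_swap[symmetric]) (use iL in auto)
      also have "\<dots> = (LINT p|(lborel \<Otimes>\<^sub>M lborel). indicator ?G p *\<^sub>R ?AA p)"
        by (intro Bochner_Integration.integral_cong refl) (auto simp: indicator_def)
      finally show ?thesis ..
    qed
    also have "(LINT p|(lborel \<Otimes>\<^sub>M lborel). indicator ?L p *\<^sub>R ?AA p) = fourier_along pair_measure pair_sum F x"
    proof -
      have "fourier_along pair_measure pair_sum F x = (LINT p|(lborel \<Otimes>\<^sub>M lborel). (jac p * indicator offdiag p) *\<^sub>R (F p * fchar x (pair_sum p)))"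
        unfolding fourier_along_def pair_measure_def
      proof (rule integral_density)
        show "AE p in lborel \<Otimes>\<^sub>M lborel. 0 \<le> jac p * indicator offdiag p"
          using jac_bounds(2) by (intro AE_I2) (auto simp: indicator_def intro: less_imp_le)
      qed measurable
      also have "\<dots> = (LINT p|(lborel \<Otimes>\<^sub>M lborel). indicator ?L p *\<^sub>R ?AA p)"
      proof (intro Bochner_Integration.integral_cong refl)
        fix p :: "real \<times> real"
        show "(jac p * indicator offdiag p) *\<^sub>R (F p * fchar x (pair_sum p)) = indicator ?L p *\<^sub>R ?AA p"
        proof (cases "p \<in> offdiag")
          case True
          then have "jac p \<noteq> 0" "fst p < snd p" using jac_bounds(2)[of p] by (auto simp: offdiag_def)
          then show ?thesis using True
            by (simp add: F_def A_def pair_sum_def fchar_add scaleR_conv_of_real)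
        next
          case False
          then have "fst p < snd p \<Longrightarrow> ?AA p = 0" by (auto simp: offdiag_def A_def a_def)
          then show ?thesis using False by (auto simp: indicator_def)
        qed
      qed
      finally show ?thesis ..
    qed
    finally show ?thesis by simp
  qed
  let ?r' = "r / (r - 1)"
  have "norm (extension g x) powr (2 * ?r') = 2 powr ?r' * norm (fourier_along pair_measure pair_sum F x) powr ?r'" for x
  proof -
    have "norm (extension g x) powr (2 * ?r') = (norm (extension g x) powr 2) powr ?r'" by (simp only: powr_powr)
    also have "norm (extension g x) powr 2 = norm ((extension g x)\<^sup>2)" by (simp add: norm_power powr_numeral)
    finally show ?thesis unfolding sq by (simp add: norm_mult powr_mult)
  qed
  then have "(\<integral>\<^sup>+x. ennreal (norm (extension g x) powr (2 * ?r')) \<partial>lborel) = (\<integral>\<^sup>+x. ennreal (2 powr ?r') * ennreal (norm (fourier_along pair_measure pair_sum F x) powr ?r') \<partial>lborel)"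
    by (simp add: ennreal_mult')
  also have "\<dots> = ennreal (2 powr ?r') * (\<integral>\<^sup>+x. ennreal (norm (fourier_along pair_measure pair_sum F x) powr ?r') \<partial>lborel)"
    by (rule nn_integral_cmult) measurable
  also have "\<dots> \<le> ennreal (2 powr ?r') * ennreal (4 * ?r' / (?r' - 2) * (2 * B) powr (?r' - 2) * B)"
    by (intro mult_left_mono HY) simp
  also have "\<dots> = ennreal (extension_const r)"
    unfolding extension_const_def Let_def B_def by (rule ennreal_mult'[symmetric]) simp
  finally show ?thesis .
qed

end

lemma extension_const_nonneg:
  assumes "1 < r" "r < 2"
  shows "0 \<le> extension_const r"
proof -
  have "2 < r / (r - 1)" using assms by (simp add: field_simps)
  then show ?thesis using assms unfolding extension_const_def Let_def
    by (intro mult_nonneg_nonneg divide_nonneg_nonneg add_nonneg_nonneg powr_ge_zero) auto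
qed

section \<open>From extension to restriction by duality\<close>

definition fourier2 :: "(real^2 \<Rightarrow> complex) \<Rightarrow> real^2 \<Rightarrow> complex" where
  "fourier2 f \<xi> = (LINT x|lborel. f x * fchar x \<xi>)"

lemma borel_measurable_fourier2 [measurable]:
  assumes [measurable]: "f \<in> borel_measurable borel"
  shows "fourier2 f \<in> borel_measurable borel"
  unfolding fourier2_def by measurable

lemma norm_fourier2_le: "norm (fourier2 f \<xi>) \<le> (LINT x|lborel. norm (f x))"
proof -
  have "norm (fourier2 f \<xi>) \<le> (LINT x|lborel. norm (f x * fchar x \<xi>))"
    unfolding fourier2_def by (rule integral_norm_bound)
  then show ?thesis by (simp add: norm_mult)
qed

context convex_arc
begin

text \<open>Duality: \<open>\<bar>u\<bar>\<^sup>q\<close> is tested against the extremizer \<open>g\<close> of Hoelder's inequality for \<open>u\<close>.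
  Since the data are normalized, Young's inequality replaces Hoelder's in the dual pairing.\<close>

theorem restriction_estimate:
  assumes r: "1 < r" "r < 2" and f: "integrable lborel f"
    and fp: "(\<integral>\<^sup>+x. ennreal (norm (f x) powr (2 * r / (r + 1))) \<partial>lborel) \<le> 1"
  defines "q \<equiv> 2 * r / (3 * (r - 1))"
  shows "(\<integral>\<^sup>+t. ennreal (norm (fourier2 f (z t)) powr q * \<kappa> t powr (1/3)) * indicator D t \<partial>lborel)
    \<le> ennreal ((1 + extension_const r) powr q)"
proof -
  have [measurable]: "f \<in> borel_measurable borel" using f by auto
  define u where "u t = fourier2 f (z t)" for t
  have [measurable]: "u \<in> borel_measurable borel" unfolding u_def by measurable
  define N where "N = (LINT x|lborel. norm (f x))"
  have uN: "norm (u t) \<le> N" for t unfolding u_def N_def by (rule norm_fourier2_le)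
  have q1: "1 < q" using r unfolding q_def by (simp add: field_simps)
  \<comment> \<open>The exponent conjugate to q: 3 * (r - 1) / (2 * r) + (3 - r) / (2 * r) =
    1.\<close>
  define q' where "q' = 2 * r / (3 - r)"
  have q'0: "0 < q'" using r by (simp add: q'_def)
  have qq': "(q - 1) * q' = q" "1 - 1 / q' = 1 / q"
    using r by (simp_all add: q_def q'_def divide_simps)
  let ?w = "\<lambda>t. \<kappa> t powr (1/3)"
  let ?I = "\<integral>\<^sup>+t. ennreal (norm (u t) powr q * ?w t) * indicator D t \<partial>lborel"
  \<comment> \<open>An a priori bound that depends on f and on the arc. It serves only to make the
    integral a real number A by which one can divide.\<close>
  have "?I \<le> (\<integral>\<^sup>+t. ennreal (N powr q) * (ennreal (?w t) * indicator D t) \<partial>lborel)"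
  proof (rule nn_integral_mono)
    fix t
    have "norm (u t) powr q * ?w t \<le> N powr q * ?w t"
      using uN q1 by (intro mult_right_mono powr_mono2) auto
    then have "ennreal (norm (u t) powr q * ?w t) \<le> ennreal (N powr q) * ennreal (?w t)"
      by (simp add: ennreal_mult'[symmetric] ennreal_leI)
    then show "ennreal (norm (u t) powr q * ?w t) * indicator D t \<le> ennreal (N powr q) * (ennreal (?w t) * indicator D t)"
      by (auto simp: indicator_def)
  qed
  also have "\<dots> = ennreal (N powr q) * (\<integral>\<^sup>+t. ennreal (?w t) * indicator D t \<partial>lborel)"
    by (rule nn_integral_cmult) measurable
  also have "\<dots> < \<infinity>" using affine_arclength_finite by (simp add: ennreal_mult_less_top)
  finally obtain A where A: "?I = ennreal A" "0 \<le> A" by (cases ?I rule: ennreal_cases) auto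
  show ?thesis
  proof (cases "A = 0")
    case True
    then show ?thesis using A by (simp add: u_def)
  next
    case False
    then have A0: "0 < A" using A by simp
    \<comment> \<open>This factor gives g unit norm in L^q' for affine arclength, while the pairing
      of g with u becomes b * A, that is A powr (1 / q).\<close>
    define b where "b = A powr (- 1 / q')"
    have b0: "0 \<le> b" by (simp add: b_def)
    define g where "g t = cnj (u t) * of_real (norm (u t) powr (q - 2) * b)" for t
    have [measurable]: "g \<in> borel_measurable borel"
    proof -
      have [measurable]: "(\<lambda>t. cnj (u t)) \<in> borel_measurable borel"
        using borel_measurable_continuous_onI[OF continuous_on_cnj[OF continuous_on_id]] by (rule measurable_compose[rotated]) simp
      show ?thesis unfolding g_def by measurable
    qed
    have norm_g: "norm (g t) = norm (u t) powr (q - 1) * b" for t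
      using powr_mult_base[of "norm (u t)" "q - 2"] b0 by (simp add: g_def norm_mult abs_mult)
    have "(\<integral>\<^sup>+t. ennreal (norm (g t) powr q' * ?w t) * indicator D t \<partial>lborel)
        = (\<integral>\<^sup>+t. ennreal (1 / A) * (ennreal (norm (u t) powr q * ?w t) * indicator D t) \<partial>lborel)"
    proof (rule nn_integral_cong)
      fix t
      have "b powr q' = 1 / A"
        unfolding b_def powr_powr using q'0 A0 by (simp add: powr_minus_divide)
      then have "norm (g t) powr q' = 1 / A * norm (u t) powr q"
        unfolding norm_g using b0 qq'(1) by (simp add: powr_mult powr_powr)
      then have "ennreal (norm (g t) powr q' * ?w t) = ennreal (1 / A) * ennreal (norm (u t) powr q * ?w t)"
        using A0 by (simp add: ennreal_mult'[symmetric])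
      then show "ennreal (norm (g t) powr q' * ?w t) * indicator D t = ennreal (1 / A) * (ennreal (norm (u t) powr q * ?w t) * indicator D t)"
        by (simp only: mult.assoc)
    qed
    also have "\<dots> = ennreal (1 / A) * ?I" by (rule nn_integral_cmult) measurable
    also have "\<dots> = 1" unfolding A(1) using A0 by (simp add: ennreal_mult'[symmetric])
    finally have norm1: "(\<integral>\<^sup>+t. ennreal (norm (g t) powr q' * ?w t) * indicator D t \<partial>lborel) \<le> 1" by simp
    define a where "a t = indicator D t *\<^sub>R (g t * of_real (?w t))" for t
    have [measurable]: "a \<in> borel_measurable borel" unfolding a_def by measurable
    have inta: "integrable lborel a"
    proof (rule integrableI_bounded)
      have "(\<integral>\<^sup>+t. ennreal (norm (a t)) \<partial>lborel) \<le> (\<integral>\<^sup>+t. ennreal (N powr (q - 1) * b) * (ennreal (?w t) * indicator D t) \<partial>lborel)"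
      proof (rule nn_integral_mono)
        fix t
        have "norm (g t) * ?w t \<le> N powr (q - 1) * b * ?w t"
          unfolding norm_g using uN q1 b0 by (intro mult_right_mono powr_mono2) auto
        then show "ennreal (norm (a t)) \<le> ennreal (N powr (q - 1) * b) * (ennreal (?w t) * indicator D t)"
          using b0 by (auto simp: a_def indicator_def norm_mult ennreal_mult'[symmetric] intro!: ennreal_leI)
      qed
      also have "\<dots> = ennreal (N powr (q - 1) * b) * (\<integral>\<^sup>+t. ennreal (?w t) * indicator D t \<partial>lborel)"
        by (rule nn_integral_cmult) measurable
      also have "\<dots> < \<infinity>" using affine_arclength_finite by (simp add: ennreal_mult_less_top)
      finally show "(\<integral>\<^sup>+t. ennreal (norm (a t)) \<partial>lborel) < \<infinity>" .
    qed measurable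
    have ext: "(\<integral>\<^sup>+x. ennreal (norm (extension g x) powr (2 * (r / (r - 1)))) \<partial>lborel) \<le> ennreal (extension_const r)"
    proof (rule extension_estimate[OF r])
      show "integrable lborel (\<lambda>t. indicator D t *\<^sub>R (g t * of_real (?w t)))"
        using inta by (simp add: a_def[abs_def])
      show "(\<integral>\<^sup>+t. ennreal (norm (g t) powr (2 * r / (3 - r)) * ?w t) * indicator D t \<partial>lborel) \<le> 1"
        using norm1 by (simp only: q'_def)
    qed measurable
    let ?R = "\<lambda>t. norm (u t) powr q * ?w t * indicator D t"
    have au: "a t * u t = of_real (b * ?R t)" for t
    proof -
      have "g t * u t = of_real (b * (norm (u t) powr (q - 2) * (norm (u t))\<^sup>2))"
        by (simp only: g_def of_real_mult complex_norm_square mult_ac)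
      also have "norm (u t) powr (q - 2) * (norm (u t))\<^sup>2 = norm (u t) powr q"
      proof (cases "u t = 0")
        case False
        then have "norm (u t) powr (q - 2 + 2) = norm (u t) powr (q - 2) * (norm (u t))\<^sup>2"
          by (subst powr_add) (simp add: powr_numeral)
        then show ?thesis by simp
      qed simp
      finally have gu: "g t * u t = of_real (b * norm (u t) powr q)" .
      have "a t * u t = indicator D t *\<^sub>R ((g t * u t) * of_real (?w t))" by (simp add: a_def mult_ac)
      also have "\<dots> = of_real (b * ?R t)" unfolding gu by (simp add: indicator_def)
      finally show ?thesis .
    qed
    have "(LINT t|lborel. ?R t) = enn2real (\<integral>\<^sup>+t. ennreal (?R t) \<partial>lborel)"
      by (rule integral_eq_nn_integral) auto
    also have "(\<integral>\<^sup>+t. ennreal (?R t) \<partial>lborel) = ?I"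
      by (intro nn_integral_cong) (auto simp: indicator_def)
    finally have R: "(LINT t|lborel. ?R t) = A" using A by simp
    have "(LINT t|lborel. a t * u t) = of_real (b * A)"
      unfolding au integral_complex_of_real using R by simp
    also have "b * A = A powr (1 / q)"
    proof -
      have "b * A = A powr (- 1 / q') * A powr 1" using A0 by (simp add: b_def)
      also have "\<dots> = A powr (- 1 / q' + 1)" by (simp only: powr_add)
      also have "- 1 / q' + 1 = 1 / q" using qq'(2) by simp
      finally show ?thesis .
    qed
    finally have "A powr (1 / q) = norm (LINT t|lborel. a t * u t)" by simp
    also have "(LINT t|lborel. a t * u t) = (LINT t|lborel. LINT x|lborel. a t * (f x * fchar x (z t)))"
      unfolding u_def fourier2_def by simp
    also have "\<dots> = (LINT x|lborel. LINT t|lborel. a t * (f x * fchar x (z t)))"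
    proof (rule lborel_pair.Fubini_integral[symmetric])
      have "integrable (lborel \<Otimes>\<^sub>M lborel) (\<lambda>(t, x). a t * f x)"
        by (rule integrable_times_pair(1)[OF lborel_pair.pair_sigma_finite_axioms inta f])
      then show "integrable (lborel \<Otimes>\<^sub>M lborel) (\<lambda>(t, x). a t * (f x * fchar x (z t)))"
        by (rule Bochner_Integration.integrable_bound) (auto simp: norm_mult split_beta')
    qed
    also have "\<dots> = (LINT x|lborel. f x * extension g x)"
    proof (intro Bochner_Integration.integral_cong refl)
      fix x
      have "(LINT t|lborel. a t * (f x * fchar x (z t))) = (LINT t|lborel. f x * (a t * fchar x (z t)))"
        by (simp only: mult_ac)
      also have "\<dots> = f x * (LINT t|lborel. a t * fchar x (z t))" by (rule integral_mult_right_zero)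
      finally show "(LINT t|lborel. a t * (f x * fchar x (z t))) = f x * extension g x"
        by (simp only: extension_def a_def)
    qed
    finally have eq: "A powr (1 / q) = norm (LINT x|lborel. f x * extension g x)" .
    have mE [measurable]: "extension g \<in> borel_measurable borel"
      unfolding extension_def by measurable
    have "ennreal (A powr (1 / q)) \<le> (\<integral>\<^sup>+x. ennreal (norm (f x * extension g x)) \<partial>lborel)"
      unfolding eq
      by (cases "integrable lborel (\<lambda>x. f x * extension g x)")
         (auto intro!: integral_norm_bound_ennreal simp: not_integrable_integral_eq)
    also have "\<dots> \<le> (\<integral>\<^sup>+x. ennreal (norm (f x) powr (2 * r / (r + 1))) + ennreal (norm (extension g x) powr (2 * (r / (r - 1)))) \<partial>lborel)"
    proof (rule nn_integral_mono)
      fix x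
      \<comment> \<open>The exponents of f and of the extension are conjugate: (r + 1) / (2 * r) +
        (r - 1) / (2 * r) = 1. Young's denominators exceed 1 and are then dropped.\<close>
      have p: "1 < 2 * r / (r + 1)" "1 < 2 * (r / (r - 1))" "1 / (2 * r / (r + 1)) + 1 / (2 * (r / (r - 1))) = 1"
        using r by (simp_all add: field_simps)
      have "norm (f x) * norm (extension g x) \<le> norm (f x) powr (2 * r / (r + 1)) / (2 * r / (r + 1)) + norm (extension g x) powr (2 * (r / (r - 1))) / (2 * (r / (r - 1)))"
        by (rule Youngs_inequality[OF p]) auto
      also have "\<dots> \<le> norm (f x) powr (2 * r / (r + 1)) / 1 + norm (extension g x) powr (2 * (r / (r - 1))) / 1"
        using p by (intro add_mono divide_left_mono) auto
      finally have "ennreal (norm (f x * extension g x)) \<le> ennreal (norm (f x) powr (2 * r / (r + 1)) + norm (extension g x) powr (2 * (r / (r - 1))))"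
        by (intro ennreal_leI) (simp add: norm_mult)
      then show "ennreal (norm (f x * extension g x)) \<le> ennreal (norm (f x) powr (2 * r / (r + 1))) + ennreal (norm (extension g x) powr (2 * (r / (r - 1))))"
        by (simp only: ennreal_plus powr_ge_zero)
    qed
    also have "\<dots> = (\<integral>\<^sup>+x. ennreal (norm (f x) powr (2 * r / (r + 1))) \<partial>lborel) + (\<integral>\<^sup>+x. ennreal (norm (extension g x) powr (2 * (r / (r - 1)))) \<partial>lborel)"
      by (rule nn_integral_add) measurable
    also have "\<dots> \<le> 1 + ennreal (extension_const r)" by (intro add_mono fp ext)
    also have "\<dots> = ennreal (1 + extension_const r)" using extension_const_nonneg[OF r] by (simp add: ennreal_plus)
    finally have "ennreal (A powr (1 / q)) \<le> ennreal (1 + extension_const r)" .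
    then have "A powr (1 / q) \<le> 1 + extension_const r"
      using extension_const_nonneg[OF r] by (subst (asm) ennreal_le_iff) auto
    then have "(A powr (1 / q)) powr q \<le> (1 + extension_const r) powr q"
      using q1 by (intro powr_mono2) auto
    then have "A \<le> (1 + extension_const r) powr q" using q1 A0 by (simp add: powr_powr)
    then show ?thesis using A by (simp add: u_def ennreal_leI)
  qed
qed

end

section \<open>Lengths of curves\<close>

lemma curve_length_upper:
  assumes "mono s" "range s \<subseteq> {a..b}"
  shows "ennreal (\<Sum>i<n. dist (z (s i)) (z (s (Suc i)))) \<le> curve_length z a b"
  unfolding curve_length_def by (rule SUP_upper2[of "(n, s)"]) (use assms in auto)

lemma curve_length_least:
  assumes "\<And>n s. mono s \<Longrightarrow> range s \<subseteq> {a..b} \<Longrightarrow> ennreal (\<Sum>i<n. dist (z (s i)) (z (s (Suc i)))) \<le> X"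
  shows "curve_length z a b \<le> X"
  unfolding curve_length_def by (rule SUP_least) (use assms in auto)

lemma chord_le_curve_length:
  assumes "a \<le> b"
  shows "ennreal (dist (z a) (z b)) \<le> curve_length z a b"
proof -
  let ?s = "\<lambda>i::nat. if i = 0 then a else b"
  have "mono ?s" "range ?s \<subseteq> {a..b}" using assms by (auto simp: mono_def)
  from curve_length_upper[OF this, where n = 1 and z = z] show ?thesis by simp
qed

text \<open>Monotone partitions are carried forward by W and back by a choice of preimages. W may be
  constant on intervals, and \<gamma> sees only its values.\<close>

lemma curve_length_reparam:
  assumes mono: "\<And>x y. a \<le> x \<Longrightarrow> x \<le> y \<Longrightarrow> y \<le> b \<Longrightarrow> W x \<le> W y"
    and im: "W ` {a..b} = {W a..W b}" and z: "\<And>t. t \<in> {a..b} \<Longrightarrow> z t = \<gamma> (W t)"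
  shows "curve_length z a b = curve_length \<gamma> (W a) (W b)"
proof (rule antisym)
  show "curve_length z a b \<le> curve_length \<gamma> (W a) (W b)"
  proof (rule curve_length_least)
    fix n and s :: "nat \<Rightarrow> real" assume s: "mono s" "range s \<subseteq> {a..b}"
    have "(\<Sum>i<n. dist (z (s i)) (z (s (Suc i)))) = (\<Sum>i<n. dist (\<gamma> ((W \<circ> s) i)) (\<gamma> ((W \<circ> s) (Suc i))))"
    proof (intro sum.cong refl)
      fix i
      have "s i \<in> {a..b}" "s (Suc i) \<in> {a..b}" using s(2) by blast+
      then show "dist (z (s i)) (z (s (Suc i))) = dist (\<gamma> ((W \<circ> s) i)) (\<gamma> ((W \<circ> s) (Suc i)))"
        using z by simp
    qed
    moreover have "mono (W \<circ> s)"
    proof (rule monoI)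
      fix i j :: nat assume "i \<le> j"
      moreover have "a \<le> s i" "s j \<le> b" using s by (auto simp: image_subset_iff)
      ultimately show "(W \<circ> s) i \<le> (W \<circ> s) j" using mono s(1) by (simp add: monoD)
    qed
    moreover have "range (W \<circ> s) \<subseteq> {W a..W b}" using s im by (auto simp: image_subset_iff)
    ultimately show "ennreal (\<Sum>i<n. dist (z (s i)) (z (s (Suc i)))) \<le> curve_length \<gamma> (W a) (W b)"
      using curve_length_upper[of "W \<circ> s" "W a" "W b" \<gamma> n] by simp
  qed
  show "curve_length \<gamma> (W a) (W b) \<le> curve_length z a b"
  proof (rule curve_length_least)
    fix n and s :: "nat \<Rightarrow> real" assume s: "mono s" "range s \<subseteq> {W a..W b}"
    \<comment> \<open>\<open>inv_into\<close> returns the same preimage for equal values, so v is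
      monotone even where s is constant.\<close>
    define v where "v i = inv_into {a..b} W (s i)" for i
    have sW: "s i \<in> W ` {a..b}" for i unfolding im using s(2) by blast
    have v: "v i \<in> {a..b}" "W (v i) = s i" for i
      unfolding v_def using inv_into_into[OF sW] f_inv_into_f[OF sW] by auto
    have mv: "mono v"
    proof (rule monoI)
      fix i j :: nat assume "i \<le> j"
      then consider "s i = s j" | "s i < s j" using monoD[OF s(1), of i j] by fastforce
      then show "v i \<le> v j"
      proof cases
        case 2
        show ?thesis
        proof (rule ccontr)
          assume "\<not> v i \<le> v j"
          then have "W (v j) \<le> W (v i)" using v(1)[of i] v(1)[of j] by (intro mono) auto
          then show False using 2 v(2) by simp
        qed
      qed (simp add: v_def)
    qed
    have "range v \<subseteq> {a..b}" using v(1) by auto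
    from curve_length_upper[OF mv this, where n = n and z = z]
    show "ennreal (\<Sum>i<n. dist (\<gamma> (s i)) (\<gamma> (s (Suc i)))) \<le> curve_length z a b"
      by (simp only: z[OF v(1)] v(2))
  qed
qed

lemma curve_length_add:
  fixes z :: "real \<Rightarrow> 'a::metric_space"
  assumes ab: "a \<le> b" "b \<le> c"
  shows "curve_length z a c = curve_length z a b + curve_length z b c"
proof (rule antisym)
  show "curve_length z a c \<le> curve_length z a b + curve_length z b c"
  proof (rule curve_length_least)
    fix n and s :: "nat \<Rightarrow> real" assume s: "mono s" "range s \<subseteq> {a..c}"
    \<comment> \<open>Clamping at b splits the partition in two and inserts b into the only step
      that can cross it; there the triangle inequality applies.\<close>
    let ?s1 = "\<lambda>i. min (s i) b" and ?s2 = "\<lambda>i. max (s i) b"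
    have sr: "a \<le> s i" "s i \<le> c" for i using s(2) by (auto simp: image_subset_iff)
    have 1: "mono ?s1" "range ?s1 \<subseteq> {a..b}" and 2: "mono ?s2" "range ?s2 \<subseteq> {b..c}"
      using ab sr by (auto intro!: monoI min.mono max.mono monoD[OF s(1)] simp: min_le_iff_disj le_max_iff_disj)
    have "dist (z (s i)) (z (s (Suc i))) \<le> dist (z (?s1 i)) (z (?s1 (Suc i))) + dist (z (?s2 i)) (z (?s2 (Suc i)))" for i
      using monoD[OF s(1), of i "Suc i"] dist_triangle[of "z (s i)" "z (s (Suc i))" "z b"]
      by (cases "s i \<le> b"; cases "s (Suc i) \<le> b") (auto simp: min_def max_def)
    then have "(\<Sum>i<n. dist (z (s i)) (z (s (Suc i)))) \<le> (\<Sum>i<n. dist (z (?s1 i)) (z (?s1 (Suc i)))) + (\<Sum>i<n. dist (z (?s2 i)) (z (?s2 (Suc i))))"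
      unfolding sum.distrib[symmetric] by (intro sum_mono)
    then have "ennreal (\<Sum>i<n. dist (z (s i)) (z (s (Suc i)))) \<le> ennreal (\<Sum>i<n. dist (z (?s1 i)) (z (?s1 (Suc i)))) + ennreal (\<Sum>i<n. dist (z (?s2 i)) (z (?s2 (Suc i))))"
      by (subst ennreal_plus[symmetric]) (auto intro!: sum_nonneg ennreal_leI)
    also have "\<dots> \<le> curve_length z a b + curve_length z b c"
      by (intro add_mono curve_length_upper 1 2)
    finally show "ennreal (\<Sum>i<n. dist (z (s i)) (z (s (Suc i)))) \<le> curve_length z a b + curve_length z b c" .
  qed
next
  let ?P = "\<lambda>a b. {(n :: nat, s :: nat \<Rightarrow> real). mono s \<and> range s \<subseteq> {a..b}}"
  let ?l = "\<lambda>(n, s). ennreal (\<Sum>i<n. dist (z (s i)) (z (s (Suc i))))"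
  have ne: "?P a b \<noteq> {}" if "a \<le> b" for a b
  proof -
    have "(0, \<lambda>_. a) \<in> ?P a b" using that by (auto simp: mono_def)
    then show ?thesis by blast
  qed
  have key: "?l p + ?l p' \<le> curve_length z a c" if "p \<in> ?P a b" "p' \<in> ?P b c" for p p'
  proof -
    obtain n s m s' where p: "p = (n, s)" "p' = (m, s')" by (cases p, cases p')
    have s: "mono s" "\<And>i. a \<le> s i \<and> s i \<le> b" and s': "mono s'" "\<And>i. b \<le> s' i \<and> s' i \<le> c"
      using that by (auto simp: p image_subset_iff)
    \<comment> \<open>The concatenation has one more step than the two partitions together, from s n
      to s' 0; it adds a nonnegative term.\<close>
    define t where "t i = (if i \<le> n then s i else s' (i - Suc n))" for i
    have "mono t"
    proof (rule monoI)
      fix i j :: nat assume ij: "i \<le> j"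
      consider "j \<le> n" | "i \<le> n" "n < j" | "n < i" by linarith
      then show "t i \<le> t j"
      proof cases
        case 2
        then show ?thesis using s(2)[of i] s'(2)[of "j - Suc n"] by (simp add: t_def)
      qed (use ij s(1) s'(1) in \<open>auto simp: t_def monoD diff_le_mono\<close>)
    qed
    moreover have "range t \<subseteq> {a..c}"
    proof safe
      fix i show "t i \<in> {a..c}" using s(2)[of i] s'(2)[of "i - Suc n"] ab by (auto simp: t_def)
    qed
    ultimately have le: "ennreal (\<Sum>i<Suc n + m. dist (z (t i)) (z (t (Suc i)))) \<le> curve_length z a c"
      by (rule curve_length_upper)
    have "(\<Sum>i<n. dist (z (s i)) (z (s (Suc i)))) + (\<Sum>i<m. dist (z (s' i)) (z (s' (Suc i))))
       \<le> (\<Sum>i<Suc n + m. dist (z (t i)) (z (t (Suc i))))"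
    proof -
      have "(\<Sum>i<Suc n + m. dist (z (t i)) (z (t (Suc i)))) =
         (\<Sum>i<Suc n. dist (z (t i)) (z (t (Suc i)))) + (\<Sum>i<m. dist (z (t (Suc n + i))) (z (t (Suc (Suc n + i)))))"
        by (induction m) (auto simp: add.assoc)
      also have "(\<Sum>i<m. dist (z (t (Suc n + i))) (z (t (Suc (Suc n + i))))) = (\<Sum>i<m. dist (z (s' i)) (z (s' (Suc i))))"
        by (intro sum.cong refl) (auto simp: t_def)
      also have "(\<Sum>i<Suc n. dist (z (t i)) (z (t (Suc i)))) = (\<Sum>i<n. dist (z (s i)) (z (s (Suc i)))) + dist (z (t n)) (z (t (Suc n)))"
        by (auto simp: t_def)
      finally show ?thesis by simp
    qed
    then have "ennreal ((\<Sum>i<n. dist (z (s i)) (z (s (Suc i)))) + (\<Sum>i<m. dist (z (s' i)) (z (s' (Suc i))))) \<le> curve_length z a c"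
      using le by (meson ennreal_leI order_trans)
    then show ?thesis by (simp add: p ennreal_plus sum_nonneg)
  qed
  have "curve_length z a b + curve_length z b c = (SUP p\<in>?P a b. ?l p + curve_length z b c)"
    unfolding curve_length_def[of z a b] by (rule ennreal_SUP_add_left[OF ne[OF ab(1)], symmetric])
  also have "\<dots> \<le> curve_length z a c"
  proof (rule SUP_least)
    fix p assume p: "p \<in> ?P a b"
    have "?l p + curve_length z b c = (SUP p'\<in>?P b c. ?l p + ?l p')"
      unfolding curve_length_def[of z b c] by (rule ennreal_SUP_add_right[OF ne[OF ab(2)]])
    also have "\<dots> \<le> curve_length z a c" by (rule SUP_least) (rule key[OF p])
    finally show "?l p + curve_length z b c \<le> curve_length z a c" .
  qed
  finally show "curve_length z a b + curve_length z b c \<le> curve_length z a c" .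
qed

lemma curve_length_Lipschitz:
  assumes lip: "\<And>x y. a \<le> x \<Longrightarrow> x \<le> y \<Longrightarrow> y \<le> b \<Longrightarrow> dist (z x) (z y) \<le> K * (y - x)" and K: "0 \<le> K"
  shows "curve_length z a b \<le> ennreal (K * (b - a))"
proof (rule curve_length_least)
  fix n and s :: "nat \<Rightarrow> real" assume s: "mono s" "range s \<subseteq> {a..b}"
  have sr: "a \<le> s i" "s i \<le> b" for i using s(2) by (auto simp: image_subset_iff)
  have "(\<Sum>i<n. dist (z (s i)) (z (s (Suc i)))) \<le> (\<Sum>i<n. K * (s (Suc i) - s i))"
    using sr monoD[OF s(1)] by (intro sum_mono lip) auto
  also have "\<dots> = K * (s n - s 0)" by (simp add: sum_distrib_left[symmetric] sum_lessThan_telescope)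
  also have "\<dots> \<le> K * (b - a)" using sr[of n] sr[of 0] K by (intro mult_left_mono) auto
  finally show "ennreal (\<Sum>i<n. dist (z (s i)) (z (s (Suc i)))) \<le> ennreal (K * (b - a))" by (rule ennreal_leI)
qed

section \<open>Boundary of a planar convex body\<close>

lemma dir_periodic [simp]: "dir (a + 2 * pi) = dir a"
  by (simp add: dir_def)

lemma cross2_simps:
  "cross2 (a + b) v = cross2 a v + cross2 b v" "cross2 (a - b) v = cross2 a v - cross2 b v"
  "cross2 v (a + b) = cross2 v a + cross2 v b" "cross2 v (a - b) = cross2 v a - cross2 v b"
  "cross2 (r *\<^sub>R a) v = r * cross2 a v" "cross2 v (r *\<^sub>R a) = r * cross2 v a"
  unfolding cross2_def vector_add_component vector_minus_component vector_scaleR_component real_scaleR_def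
  by (simp_all add: distrib_left distrib_right left_diff_distrib right_diff_distrib)

lemma unit_vector_dir:
  fixes v :: "real^2"
  assumes "norm v = 1" "0 \<le> cross2 (dir a) v"
  obtains t where "0 \<le> t" "t \<le> pi" "v = dir (a + t)"
proof -
  have v1: "v $ 1 * v $ 1 + v $ 2 * v $ 2 = 1" using assms(1) norm_real2_sq[of v] by (simp add: power2_eq_square)
  have sc: "sin a * sin a = 1 - cos a * cos a" using sin_cos_squared_add[of a] by (simp add: power2_eq_square)
  have "(dir a \<bullet> v)\<^sup>2 + (cross2 (dir a) v)\<^sup>2 = ((cos a)\<^sup>2 + (sin a)\<^sup>2) * (v $ 1 * v $ 1 + v $ 2 * v $ 2)"
    unfolding inner_real2 cross2_def dir_nth by algebra
  also have "\<dots> = 1" unfolding v1 by simp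
  finally obtain t where t: "0 \<le> t" "t \<le> pi" "dir a \<bullet> v = cos t" "cross2 (dir a) v = sin t"
    using sincos_total_pi[OF assms(2), of "dir a \<bullet> v"] by auto
  have "cos a * cos t - sin a * sin t = ((cos a)\<^sup>2 + (sin a)\<^sup>2) * v $ 1"
    "sin a * cos t + cos a * sin t = ((cos a)\<^sup>2 + (sin a)\<^sup>2) * v $ 2"
    unfolding t(3,4)[symmetric] inner_real2 cross2_def dir_nth by algebra+
  then have "v = dir (a + t)"
    by (simp add: vec_eq_iff forall_2 cos_add sin_add)
  then show ?thesis using t that by blast
qed

lemma vector_polar:
  fixes v :: "real^2"
  assumes "v \<noteq> 0"
  obtains t where "a \<le> t" "t < a + 2 * pi" "v = norm v *\<^sub>R dir t"
proof -
  let ?v = "v /\<^sub>R norm v"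
  have nv: "norm ?v = 1" "norm (- ?v) = 1" using assms by simp_all
  have scale: "v = norm v *\<^sub>R dir t" if "?v = dir t" for t
    using that assms by (metis divideR_right norm_eq_zero)
  show ?thesis
  proof (cases "0 \<le> cross2 (dir a) ?v")
    case True
    then obtain t where t: "0 \<le> t" "t \<le> pi" "?v = dir (a + t)" using unit_vector_dir[OF nv(1)] by metis
    then show ?thesis using that[of "a + t"] scale pi_gt_zero by simp
  next
    case False
    then have "0 \<le> cross2 (dir a) (- ?v)" by (simp add: cross2_def)
    then obtain t where t: "0 \<le> t" "t \<le> pi" "- ?v = dir (a + t)" using unit_vector_dir[OF nv(2)] by metis
    have "dir (a + t + pi) = - dir (a + t)" by (simp add: vec_eq_iff forall_2)
    then have v: "?v = dir (a + t + pi)" using t(3) by (metis minus_minus)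
    show ?thesis
    proof (cases "t = pi")
      case True
      then have "?v = dir a" using v dir_periodic[of a] by (simp add: add.assoc)
      then show ?thesis using that[of a] scale pi_gt_zero by simp
    next
      case False
      then show ?thesis using that[of "a + t + pi"] scale[OF v] t by simp
    qed
  qed
qed

lemma dir_eq_iff: "dir a = dir b \<longleftrightarrow> (\<exists>n::int. a = b + 2 * pi * n)"
  unfolding vec_eq_iff forall_2 dir_nth using sin_cos_eq_iff[of a b] by blast

lemma dir_Lipschitz: "norm (dir a - dir b) \<le> \<bar>a - b\<bar>"
proof -
  have "(dir has_derivative (\<lambda>h. h *\<^sub>R dir (x + pi / 2))) (at x)" for x
    unfolding dir_def vector2_eq has_vector_derivative_def[symmetric]
    by (auto intro!: derivative_eq_intros simp: sin_add cos_add has_real_derivative_iff_has_vector_derivative[symmetric])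
  moreover have "onorm (\<lambda>h. h *\<^sub>R dir (x + pi / 2)) \<le> 1" for x
    by (rule onorm_le) simp
  ultimately show ?thesis
    using differentiable_bound[of UNIV dir "\<lambda>x h. h *\<^sub>R dir (x + pi / 2)" 1 b a]
    by (auto intro: has_derivative_at_withinI simp: norm_minus_commute abs_minus_commute)
qed

text \<open>The first sign puts the angle of d into [a, a + \<pi>]; since the sector is narrower
  than \<pi>, the second sign rules out the part beyond b.\<close>

lemma dir_direction_between:
  assumes d: "d \<noteq> 0" and ab: "a < b" "b < a + pi"
    and cr: "0 \<le> cross2 (dir a) d" "0 \<le> cross2 d (dir b)"
  obtains t where "a \<le> t" "t \<le> b" "d = norm d *\<^sub>R dir t"
proof -
  obtain t where t: "a \<le> t" "t < a + 2 * pi" "d = norm d *\<^sub>R dir t" using vector_polar[OF d] by blast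
  have "0 \<le> norm d * sin (t - a)" using cr(1) t(3) by (metis cross2_simps(6) cross2_dir)
  then have s1: "0 \<le> sin (t - a)" using d by (simp add: zero_le_mult_iff)
  have "0 \<le> norm d * sin (b - t)" using cr(2) t(3) by (metis cross2_simps(5) cross2_dir)
  then have s2: "0 \<le> sin (b - t)" using d by (simp add: zero_le_mult_iff)
  have tp: "t - a \<le> pi"
  proof (rule ccontr)
    assume "\<not> t - a \<le> pi"
    then have "sin (t - a) < 0" using t by (intro sin_lt_zero) auto
    then show False using s1 by simp
  qed
  have "t \<le> b"
  proof (rule ccontr)
    assume "\<not> t \<le> b"
    then have "0 < sin (t - b)" using tp ab by (intro sin_gt_zero) auto
    then show False using s2 sin_minus[of "t - b"] by simp
  qed
  then show ?thesis using that t by blast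
qed

section \<open>Polar coordinates around an interior point\<close>

locale convex_body =
  fixes K :: "(real^2) set" and c :: "real^2"
  assumes K_open: "open K" and K_convex: "convex K" and K_bounded: "bounded K" and c_in: "c \<in> K"
begin

lemma interior_K [simp]: "interior K = K"
  using K_open by (rule interior_open)

lemma frontier_not_in: "p \<in> frontier K \<Longrightarrow> p \<notin> K"
  by (simp add: frontier_def)

definition rad :: "real \<Rightarrow> real" where
  "rad \<alpha> = (SOME d. 0 < d \<and> c + d *\<^sub>R dir \<alpha> \<in> frontier K \<and> (\<forall>e. 0 \<le> e \<and> e < d \<longrightarrow> c + e *\<^sub>R dir \<alpha> \<in> K))"

definition bdry :: "real \<Rightarrow> real^2" where
  "bdry \<alpha> = c + rad \<alpha> *\<^sub>R dir \<alpha>"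

lemma rad: "0 < rad \<alpha>" "bdry \<alpha> \<in> frontier K" "\<And>e. 0 \<le> e \<Longrightarrow> e < rad \<alpha> \<Longrightarrow> c + e *\<^sub>R dir \<alpha> \<in> K"
proof -
  have "dir \<alpha> \<noteq> 0" using norm_dir[of \<alpha>] by (metis norm_zero zero_neq_one)
  then obtain d where "0 < d" "c + d *\<^sub>R dir \<alpha> \<in> frontier K" "\<And>e. 0 \<le> e \<Longrightarrow> e < d \<Longrightarrow> c + e *\<^sub>R dir \<alpha> \<in> K"
    using ray_to_frontier[OF K_bounded, of c "dir \<alpha>"] c_in by auto
  then have "\<exists>d. 0 < d \<and> c + d *\<^sub>R dir \<alpha> \<in> frontier K \<and> (\<forall>e. 0 \<le> e \<and> e < d \<longrightarrow> c + e *\<^sub>R dir \<alpha> \<in> K)" by blast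
  from someI_ex[OF this] show "0 < rad \<alpha>" "bdry \<alpha> \<in> frontier K" "\<And>e. 0 \<le> e \<Longrightarrow> e < rad \<alpha> \<Longrightarrow> c + e *\<^sub>R dir \<alpha> \<in> K"
    unfolding rad_def[symmetric] bdry_def by auto
qed

lemma rad_unique:
  assumes "0 \<le> d" "c + d *\<^sub>R dir \<alpha> \<in> frontier K"
  shows "d = rad \<alpha>"
proof (rule ccontr)
  assume "d \<noteq> rad \<alpha>"
  then consider "d < rad \<alpha>" | "rad \<alpha> < d" by linarith
  then show False
  proof cases
    case 1
    then show False using rad(3)[OF assms(1)] assms(2) frontier_not_in by blast
  next
    case 2
    \<comment> \<open>Beyond a boundary point on the same ray lies no other:
      \<open>bdry \<alpha>\<close> would be strictly between the interior point c and a point of the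
      closure, hence interior.\<close>
    have d: "0 < d" using 2 rad(1)[of \<alpha>] by simp
    have "c + d *\<^sub>R dir \<alpha> \<in> closure K" using assms(2) by (simp add: frontier_def)
    moreover have "0 < 1 - rad \<alpha> / d" "1 - rad \<alpha> / d \<le> 1" using 2 d rad(1)[of \<alpha>] by (auto simp: field_simps)
    ultimately have "(c + d *\<^sub>R dir \<alpha>) - (1 - rad \<alpha> / d) *\<^sub>R ((c + d *\<^sub>R dir \<alpha>) - c) \<in> K"
      using mem_interior_closure_convex_shrink[OF K_convex, of c "c + d *\<^sub>R dir \<alpha>" "1 - rad \<alpha> / d"] c_in by simp
    moreover have "(c + d *\<^sub>R dir \<alpha>) - (1 - rad \<alpha> / d) *\<^sub>R ((c + d *\<^sub>R dir \<alpha>) - c) = bdry \<alpha>"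
      using d by (simp add: bdry_def algebra_simps)
    ultimately show False using rad(2) frontier_not_in by metis
  qed
qed

lemma rad_cong: "dir \<alpha> = dir \<beta> \<Longrightarrow> rad \<alpha> = rad \<beta>"
  by (simp add: rad_def)

lemma bdry_eq_iff: "bdry \<alpha> = bdry \<beta> \<longleftrightarrow> dir \<alpha> = dir \<beta>"
proof
  assume "bdry \<alpha> = bdry \<beta>"
  then have eq: "rad \<alpha> *\<^sub>R dir \<alpha> = rad \<beta> *\<^sub>R dir \<beta>" by (simp add: bdry_def)
  then have "norm (rad \<alpha> *\<^sub>R dir \<alpha>) = norm (rad \<beta> *\<^sub>R dir \<beta>)" by simp
  then have "rad \<alpha> = rad \<beta>" using rad(1)[of \<alpha>] rad(1)[of \<beta>] by simp
  then show "dir \<alpha> = dir \<beta>" using eq rad(1)[of \<beta>] by simp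
next
  assume "dir \<alpha> = dir \<beta>"
  then show "bdry \<alpha> = bdry \<beta>" using rad_cong[of \<alpha> \<beta>] unfolding bdry_def by metis
qed

lemma bdry_periodic [simp]: "bdry (\<alpha> + 2 * pi) = bdry \<alpha>"
  by (simp add: bdry_eq_iff)

lemma bdry_inj:
  assumes "\<alpha> < \<beta>" "\<beta> < \<alpha> + 2 * pi"
  shows "bdry \<alpha> \<noteq> bdry \<beta>"
proof
  assume "bdry \<alpha> = bdry \<beta>"
  then have "dir \<beta> = dir \<alpha>" by (simp add: bdry_eq_iff)
  then obtain n :: int where n: "\<beta> = \<alpha> + 2 * pi * n" unfolding dir_eq_iff by blast
  then have "0 < 2 * pi * n" "2 * pi * n < 2 * pi * 1" using assms by auto
  then have "0 < real_of_int n" "real_of_int n < 1" using pi_gt_zero by (simp_all add: zero_less_mult_iff)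
  then have "0 < n" "n < 1" by linarith+
  then show False by simp
qed

lemma bdry_surj:
  assumes "p \<in> frontier K"
  obtains \<alpha> where "a \<le> \<alpha>" "\<alpha> < a + 2 * pi" "p = bdry \<alpha>"
proof -
  have "p - c \<noteq> 0" using assms frontier_not_in c_in by auto
  then obtain t where t: "a \<le> t" "t < a + 2 * pi" "p - c = norm (p - c) *\<^sub>R dir t" using vector_polar by blast
  then have "p = c + norm (p - c) *\<^sub>R dir t" by (simp add: algebra_simps)
  then have "p = bdry t" using rad_unique[of "norm (p - c)" t] assms by (simp add: bdry_def)
  then show ?thesis using that t by blast
qed

definition inradius :: real where
  "inradius = (SOME r. 0 < r \<and> cball c r \<subseteq> K)"

lemma inradius: "0 < inradius" "cball c inradius \<subseteq> K"
proof -
  have "\<exists>r. 0 < r \<and> cball c r \<subseteq> K" using K_open c_in unfolding open_contains_cball by blast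
  from someI_ex[OF this] show "0 < inradius" "cball c inradius \<subseteq> K" unfolding inradius_def[symmetric] by auto
qed

text \<open>A supporting line normalized to n \<bullet> (w - c) = 1, so that n is a point of the
  polar dual body. The ball of radius \<open>inradius\<close> around c inside K bounds its
  norm.\<close>

lemma support_normal:
  obtains n where "n \<bullet> (bdry \<alpha> - c) = 1" "\<And>w. w \<in> closure K \<Longrightarrow> n \<bullet> (w - c) \<le> 1" "norm n \<le> 1 / inradius"
proof -
  have "bdry \<alpha> \<in> closure K" using rad(2) by (simp add: frontier_def)
  moreover have "bdry \<alpha> \<notin> rel_interior (closure K)"
  proof -
    have "interior (closure K) \<noteq> {}" using K_convex c_in by (simp add: convex_interior_closure) auto
    then have "rel_interior (closure K) = K" by (simp add: interior_rel_interior[symmetric] rel_interior_interior convex_interior_closure K_convex rel_interior_nonempty_interior)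
    then show ?thesis using rad(2) frontier_not_in by metis
  qed
  ultimately obtain a where a: "a \<noteq> 0" "\<And>y. y \<in> closure K \<Longrightarrow> a \<bullet> bdry \<alpha> \<le> a \<bullet> y"
    using supporting_hyperplane_rel_boundary[OF convex_closure[OF K_convex]] by metis
  let ?w = "c - (inradius / norm a) *\<^sub>R a"
  have "?w \<in> cball c inradius" using a inradius by (simp add: dist_norm)
  then have "?w \<in> closure K" using inradius closure_subset by blast
  then have "a \<bullet> bdry \<alpha> \<le> a \<bullet> c - inradius / norm a * (a \<bullet> a)" using a(2)[of ?w] by (simp add: inner_diff_right)
  also have "inradius / norm a * (a \<bullet> a) = inradius * norm a" using a(1) by (simp add: dot_square_norm power2_eq_square)
  finally have h: "inradius * norm a \<le> a \<bullet> (c - bdry \<alpha>)" by (simp add: inner_diff_right)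
  define H where "H = a \<bullet> (c - bdry \<alpha>)"
  have "0 < inradius * norm a" using a(1) inradius(1) by simp
  then have H: "0 < H" "inradius * norm a \<le> H" using h unfolding H_def by linarith+
  define n where "n = (- 1 / H) *\<^sub>R a"
  have "n \<bullet> (bdry \<alpha> - c) = 1"
  proof -
    have "a \<bullet> (bdry \<alpha> - c) = - H" by (simp add: H_def inner_diff_right)
    then show ?thesis using H by (simp add: n_def)
  qed
  moreover have "n \<bullet> (w - c) \<le> 1" if "w \<in> closure K" for w
  proof -
    have "a \<bullet> (c - w) \<le> H" using a(2)[OF that] by (simp add: H_def inner_diff_right)
    moreover have "n \<bullet> (w - c) = a \<bullet> (c - w) / H" using H by (simp add: n_def inner_diff_right field_simps)
    ultimately show ?thesis using H by simp
  qed
  moreover have "norm n \<le> 1 / inradius" using H inradius by (simp add: n_def field_simps)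
  ultimately show ?thesis using that by blast
qed

definition circumradius :: real where
  "circumradius = (SOME R. 0 < R \<and> (\<forall>w\<in>closure K. norm (w - c) \<le> R))"

lemma circumradius: "0 < circumradius" "\<And>w. w \<in> closure K \<Longrightarrow> norm (w - c) \<le> circumradius"
proof -
  have "bounded (closure K)" using K_bounded by (rule bounded_closure)
  then obtain R where R: "\<forall>w\<in>closure K. dist c w \<le> R" unfolding bounded_any_center[of _ c] by blast
  have "0 < max R 1 \<and> (\<forall>w\<in>closure K. norm (w - c) \<le> max R 1)"
    using R by (auto simp: dist_norm norm_minus_commute le_max_iff_disj)
  then have "\<exists>R. 0 < R \<and> (\<forall>w\<in>closure K. norm (w - c) \<le> R)" by blast
  from someI_ex[OF this] show "0 < circumradius" "\<And>w. w \<in> closure K \<Longrightarrow> norm (w - c) \<le> circumradius"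
    unfolding circumradius_def[symmetric] by auto
qed

lemma rad_le: "rad \<alpha> \<le> circumradius"
  using circumradius(2)[of "bdry \<alpha>"] rad(1,2)[of \<alpha>] by (simp add: frontier_def bdry_def)

text \<open>On unit vectors 1 / rad is the gauge of K. The supporting functional at \<alpha> bounds
  it from below everywhere and attains it at \<alpha>, which gives a one-sided Lipschitz bound with
  the norm of n.\<close>

lemma inverse_rad_Lipschitz: "1 / rad \<alpha> - 1 / rad \<beta> \<le> \<bar>\<alpha> - \<beta>\<bar> / inradius"
proof -
  obtain n where n: "n \<bullet> (bdry \<alpha> - c) = 1" "\<And>w. w \<in> closure K \<Longrightarrow> n \<bullet> (w - c) \<le> 1" "norm n \<le> 1 / inradius"
    using support_normal by blast
  have "n \<bullet> (bdry \<beta> - c) \<le> 1" using n(2) rad(2)[of \<beta>] by (simp add: frontier_def)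
  then have "n \<bullet> dir \<beta> \<le> 1 / rad \<beta>" using rad(1)[of \<beta>] by (simp add: bdry_def field_simps)
  moreover have "n \<bullet> dir \<alpha> = 1 / rad \<alpha>" using n(1) rad(1)[of \<alpha>] by (simp add: bdry_def field_simps)
  ultimately have "1 / rad \<alpha> - 1 / rad \<beta> \<le> n \<bullet> (dir \<alpha> - dir \<beta>)" by (simp add: inner_diff_right)
  also have "\<dots> \<le> norm n * norm (dir \<alpha> - dir \<beta>)" by (rule norm_cauchy_schwarz)
  also have "\<dots> \<le> (1 / inradius) * \<bar>\<alpha> - \<beta>\<bar>" using n(3) dir_Lipschitz inradius(1) by (intro mult_mono) auto
  finally show ?thesis by simp
qed

text \<open>The first summand is the Lipschitz constant of \<open>rad\<close>, obtained from that of
  its reciprocal; the second accounts for the rotation of \<open>dir\<close> at distance at most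
  \<open>circumradius\<close>.\<close>

definition bdry_lip :: real where
  "bdry_lip = circumradius * circumradius / inradius + circumradius"

lemma bdry_lip_pos: "0 < bdry_lip"
  using circumradius(1) inradius(1) by (simp add: bdry_lip_def add_pos_pos)

lemma bdry_Lipschitz: "norm (bdry \<alpha> - bdry \<beta>) \<le> bdry_lip * \<bar>\<alpha> - \<beta>\<bar>"
proof -
  have le: "rad \<beta> - rad \<alpha> \<le> circumradius * circumradius / inradius * \<bar>\<alpha> - \<beta>\<bar>" for \<alpha> \<beta>
  proof -
    have "rad \<beta> - rad \<alpha> = rad \<alpha> * rad \<beta> * (1 / rad \<alpha> - 1 / rad \<beta>)"
      using rad(1)[of \<alpha>] rad(1)[of \<beta>] by (simp add: field_simps)
    also have "\<dots> \<le> rad \<alpha> * rad \<beta> * (\<bar>\<alpha> - \<beta>\<bar> / inradius)"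
      using rad(1)[of \<alpha>] rad(1)[of \<beta>] inverse_rad_Lipschitz by (intro mult_left_mono) auto
    also have "\<dots> \<le> circumradius * circumradius * (\<bar>\<alpha> - \<beta>\<bar> / inradius)"
      using rad_le rad(1)[of \<alpha>] rad(1)[of \<beta>] inradius(1) circumradius(1) by (intro mult_right_mono mult_mono) auto
    finally show ?thesis by simp
  qed
  have r: "\<bar>rad \<alpha> - rad \<beta>\<bar> \<le> circumradius * circumradius / inradius * \<bar>\<alpha> - \<beta>\<bar>"
    using le[of \<alpha> \<beta>] le[of \<beta> \<alpha>] by (simp add: abs_minus_commute abs_le_iff)
  have "bdry \<alpha> - bdry \<beta> = (rad \<alpha> - rad \<beta>) *\<^sub>R dir \<alpha> + rad \<beta> *\<^sub>R (dir \<alpha> - dir \<beta>)"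
    by (simp add: bdry_def algebra_simps)
  then have "norm (bdry \<alpha> - bdry \<beta>) \<le> \<bar>rad \<alpha> - rad \<beta>\<bar> + rad \<beta> * norm (dir \<alpha> - dir \<beta>)"
    using rad(1)[of \<beta>] norm_triangle_ineq[of "(rad \<alpha> - rad \<beta>) *\<^sub>R dir \<alpha>" "rad \<beta> *\<^sub>R (dir \<alpha> - dir \<beta>)"] by simp
  also have "\<dots> \<le> circumradius * circumradius / inradius * \<bar>\<alpha> - \<beta>\<bar> + circumradius * \<bar>\<alpha> - \<beta>\<bar>"
    using r rad_le[of \<beta>] rad(1)[of \<beta>] dir_Lipschitz[of \<alpha> \<beta>] circumradius(1) by (intro add_mono mult_mono) auto
  also have "\<dots> = bdry_lip * \<bar>\<alpha> - \<beta>\<bar>" by (simp only: bdry_lip_def distrib_right)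
  finally show ?thesis .
qed

lemma continuous_on_bdry: "continuous_on S bdry"
proof (rule continuous_on_subset[OF lipschitz_on_continuous_on])
  show "bdry_lip-lipschitz_on UNIV bdry"
    by (rule lipschitz_onI) (use bdry_Lipschitz bdry_lip_pos in \<open>auto simp: dist_norm\<close>)
qed simp

text \<open>The body lies to the left of the line through the boundary point in direction t: t is
  the angle of a counterclockwise tangent.\<close>

definition supports_at :: "real \<Rightarrow> real \<Rightarrow> bool" where
  "supports_at \<alpha> t \<longleftrightarrow> (\<forall>w\<in>closure K. 0 \<le> cross2 (dir t) (w - bdry \<alpha>))"

text \<open>The support inequality is tested at the point of the inscribed ball nearest to the line,
  whose distance from c is \<open>inradius\<close>. The product is thus at least
  \<open>inradius\<close>.\<close>

lemma cross2_support_pos: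
  assumes "supports_at \<alpha> t"
  shows "0 < rad \<alpha> * sin (t - \<alpha>)"
proof -
  let ?w = "c - inradius *\<^sub>R dir (t + pi / 2)"
  have "?w \<in> cball c inradius" using inradius by (simp add: dist_norm)
  then have "?w \<in> closure K" using inradius closure_subset by blast
  then have "0 \<le> cross2 (dir t) (?w - bdry \<alpha>)" using assms by (simp add: supports_at_def)
  also have "?w - bdry \<alpha> = - (inradius *\<^sub>R dir (t + pi / 2) + rad \<alpha> *\<^sub>R dir \<alpha>)" by (simp add: bdry_def)
  also have "cross2 (dir t) (- (inradius *\<^sub>R dir (t + pi / 2) + rad \<alpha> *\<^sub>R dir \<alpha>)) = - inradius + rad \<alpha> * sin (t - \<alpha>)"
  proof -
    have "cross2 v (- u) = - cross2 v u" for v u by (simp add: cross2_def)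
    moreover have "sin (\<alpha> - t) = - sin (t - \<alpha>)" using sin_minus[of "t - \<alpha>"] by simp
    ultimately show ?thesis by (simp add: cross2_simps cross2_dir)
  qed
  finally show ?thesis using inradius(1) by simp
qed

text \<open>The outer normal, rotated by a quarter turn. As it pairs positively with the radial
  direction, the tangent angle lies strictly between \<alpha> and \<alpha> + \<pi>.\<close>

lemma supports_at_exists: "\<exists>t. \<alpha> < t \<and> t < \<alpha> + pi \<and> supports_at \<alpha> t"
proof -
  obtain n where n: "n \<bullet> (bdry \<alpha> - c) = 1" "\<And>w. w \<in> closure K \<Longrightarrow> n \<bullet> (w - c) \<le> 1"
    using support_normal by metis
  have n0: "n \<noteq> 0" using n(1) by auto
  define v :: "real^2" where "v = (1 / norm n) *\<^sub>R vector [- (n $ 2), n $ 1]"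
  have cr: "cross2 v u = - (n \<bullet> u) / norm n" for u
    by (simp add: v_def cross2_def inner_real2 divide_simps)
  have "norm (vector [- (n $ 2), n $ 1] :: real^2) = norm n"
    by (rule power2_eq_imp_eq) (simp_all add: norm_real2_sq)
  then have v1: "norm v = 1" using n0 by (simp add: v_def)
  have "n \<bullet> dir \<alpha> * rad \<alpha> = 1" using n(1) by (simp add: bdry_def mult.commute)
  then have npos: "0 < n \<bullet> dir \<alpha>" using rad(1)[of \<alpha>] by (metis zero_less_mult_pos2 zero_less_one)
  have swap: "cross2 (dir \<alpha>) v = - cross2 v (dir \<alpha>)" by (simp add: cross2_def)
  have pos: "0 < cross2 (dir \<alpha>) v" unfolding swap cr using npos n0 by simp
  obtain t where t: "0 \<le> t" "t \<le> pi" "v = dir (\<alpha> + t)" using unit_vector_dir[OF v1, of \<alpha>] pos by auto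
  have "0 < sin t" using pos by (simp add: t(3) cross2_dir)
  then have "t \<noteq> 0" "t \<noteq> pi" by auto
  moreover have "supports_at \<alpha> (\<alpha> + t)"
    unfolding supports_at_def t(3)[symmetric]
  proof
    fix w assume "w \<in> closure K"
    have "n \<bullet> (w - bdry \<alpha>) = n \<bullet> (w - c) - n \<bullet> (bdry \<alpha> - c)" by (simp add: inner_diff_right)
    then have "n \<bullet> (w - bdry \<alpha>) \<le> 0" using n(1) n(2)[OF \<open>w \<in> closure K\<close>] by simp
    then show "0 \<le> cross2 v (w - bdry \<alpha>)" unfolding cr by (simp add: divide_nonpos_nonneg)
  qed
  ultimately show ?thesis using t by (intro exI[of _ "\<alpha> + t"]) auto
qed

text \<open>Each boundary point satisfies the support inequality of the other. If t < s, multiplying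
  the two inequalities compares the products of sines, whose difference is sin (t - s) * sin
  (\<beta> - \<alpha>) and would be negative.\<close>

lemma supports_at_mono:
  assumes ab: "\<alpha> < \<beta>" and s: "\<alpha> < s" "s < \<alpha> + pi" "supports_at \<alpha> s" and t: "\<beta> < t" "t < \<beta> + pi" "supports_at \<beta> t"
  shows "s \<le> t"
proof (rule ccontr)
  assume "\<not> s \<le> t"
  then have ts: "t < s" by simp
  have cl: "bdry \<alpha> \<in> closure K" "bdry \<beta> \<in> closure K" using rad(2) by (auto simp: frontier_def)
  have "0 \<le> cross2 (dir s) (bdry \<beta> - bdry \<alpha>)" using s(3) cl by (simp add: supports_at_def)
  then have 1: "rad \<beta> * sin (s - \<beta>) \<le> rad \<alpha> * sin (s - \<alpha>)"
    using sin_minus[of "s - \<beta>"] sin_minus[of "s - \<alpha>"] by (simp add: bdry_def cross2_simps cross2_dir)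
  have "0 \<le> cross2 (dir t) (bdry \<alpha> - bdry \<beta>)" using t(3) cl by (simp add: supports_at_def)
  then have 2: "rad \<alpha> * sin (t - \<alpha>) \<le> rad \<beta> * sin (t - \<beta>)"
    using sin_minus[of "t - \<beta>"] sin_minus[of "t - \<alpha>"] by (simp add: bdry_def cross2_simps cross2_dir)
  have pos: "0 \<le> sin (s - \<beta>)" "0 \<le> sin (t - \<alpha>)" using ab s t ts by (auto intro!: sin_ge_zero)
  have "(rad \<beta> * sin (s - \<beta>)) * (rad \<alpha> * sin (t - \<alpha>)) \<le> (rad \<alpha> * sin (s - \<alpha>)) * (rad \<beta> * sin (t - \<beta>))"
  proof (rule mult_mono[OF 1 2])
    have "0 \<le> rad \<beta> * sin (s - \<beta>)" using pos(1) rad(1)[of \<beta>] by simp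
    then show "0 \<le> rad \<alpha> * sin (s - \<alpha>)" using 1 by (rule order_trans)
    show "0 \<le> rad \<alpha> * sin (t - \<alpha>)" using pos(2) rad(1)[of \<alpha>] by simp
  qed
  then have "(rad \<alpha> * rad \<beta>) * (sin (s - \<beta>) * sin (t - \<alpha>)) \<le> (rad \<alpha> * rad \<beta>) * (sin (s - \<alpha>) * sin (t - \<beta>))"
    by (simp only: mult_ac)
  then have "sin (s - \<beta>) * sin (t - \<alpha>) \<le> sin (s - \<alpha>) * sin (t - \<beta>)"
    using rad(1)[of \<alpha>] rad(1)[of \<beta>] by (simp add: mult_le_cancel_left_pos)
  moreover have "sin (s - \<alpha>) * sin (t - \<beta>) - sin (s - \<beta>) * sin (t - \<alpha>) = sin (t - s) * sin (\<beta> - \<alpha>)"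
  proof -
    have "sin (s - \<alpha>) * sin (t - \<beta>) - sin (s - \<beta>) * sin (t - \<alpha>) =
       (cos (s - \<alpha> - (t - \<beta>)) - cos (s - \<alpha> + (t - \<beta>)) - (cos (s - \<beta> - (t - \<alpha>)) - cos (s - \<beta> + (t - \<alpha>)))) / 2"
      by (simp only: sin_times_sin diff_divide_distrib)
    also have "\<dots> = (cos (t - s - (\<beta> - \<alpha>)) - cos (t - s + (\<beta> - \<alpha>))) / 2"
    proof -
      have "cos (s - \<alpha> - (t - \<beta>)) = cos (t - s - (\<beta> - \<alpha>))" using cos_minus[of "t - s - (\<beta> - \<alpha>)"] by (simp add: algebra_simps)
      moreover have "cos (s - \<beta> - (t - \<alpha>)) = cos (t - s + (\<beta> - \<alpha>))" using cos_minus[of "t - s + (\<beta> - \<alpha>)"] by (simp add: algebra_simps)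
      moreover have "cos (s - \<alpha> + (t - \<beta>)) = cos (s - \<beta> + (t - \<alpha>))" by (rule arg_cong) simp
      ultimately show ?thesis by simp
    qed
    also have "\<dots> = sin (t - s) * sin (\<beta> - \<alpha>)" by (simp add: sin_times_sin)
    finally show ?thesis .
  qed
  moreover have "0 < sin (s - t) * sin (\<beta> - \<alpha>)"
    using ab s t ts by (intro mult_pos_pos sin_gt_zero) auto
  ultimately show False using sin_minus[of "s - t"] by simp
qed

text \<open>\<open>tan_pre\<close> chooses a supporting direction at each boundary point arbitrarily; \<open>tan_angle\<close> is
  its right-continuous version, the angle of the right derivative.\<close>

definition tan_pre :: "real \<Rightarrow> real" where
  "tan_pre \<alpha> = (SOME t. \<alpha> < t \<and> t < \<alpha> + pi \<and> supports_at \<alpha> t)"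

lemma tan_pre: "\<alpha> < tan_pre \<alpha>" "tan_pre \<alpha> < \<alpha> + pi" "supports_at \<alpha> (tan_pre \<alpha>)"
  using someI_ex[OF supports_at_exists[of \<alpha>]] unfolding tan_pre_def by auto

lemma tan_pre_mono: "\<alpha> \<le> \<beta> \<Longrightarrow> tan_pre \<alpha> \<le> tan_pre \<beta>"
  using supports_at_mono[OF _ tan_pre tan_pre] by (cases "\<alpha> = \<beta>") auto

definition tan_angle :: "real \<Rightarrow> real" where
  "tan_angle \<alpha> = Inf (tan_pre ` {\<alpha><..})"

lemma tan_angle_le: "\<alpha> < \<beta> \<Longrightarrow> tan_angle \<alpha> \<le> tan_pre \<beta>"
  unfolding tan_angle_def by (intro cInf_lower bdd_belowI2[of _ "tan_pre \<alpha>"] tan_pre_mono) auto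

lemma tan_angle_ge: "(\<And>\<beta>. \<alpha> < \<beta> \<Longrightarrow> x \<le> tan_pre \<beta>) \<Longrightarrow> x \<le> tan_angle \<alpha>"
  unfolding tan_angle_def by (intro cInf_greatest) auto

lemma tan_pre_le_angle: "tan_pre \<alpha> \<le> tan_angle \<alpha>"
  by (intro tan_angle_ge tan_pre_mono) simp

lemma tan_angle_mono: "mono tan_angle"
proof (rule monoI)
  fix \<alpha> \<beta> :: real assume "\<alpha> \<le> \<beta>"
  show "tan_angle \<alpha> \<le> tan_angle \<beta>"
    by (rule tan_angle_ge, rule tan_angle_le) (use \<open>\<alpha> \<le> \<beta>\<close> in auto)
qed

lemma tan_angle_bounds: "\<alpha> < tan_angle \<alpha>" "tan_angle \<alpha> \<le> \<alpha> + pi"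
proof -
  show "\<alpha> < tan_angle \<alpha>" using tan_pre(1) tan_pre_le_angle by (rule less_le_trans)
  show "tan_angle \<alpha> \<le> \<alpha> + pi"
  proof (rule field_le_epsilon)
    fix e :: real assume "0 < e"
    then show "tan_angle \<alpha> \<le> \<alpha> + pi + e"
      using tan_angle_le[of \<alpha> "\<alpha> + e"] tan_pre(2)[of "\<alpha> + e"] by simp
  qed
qed

lemma tan_angle_approx:
  assumes "0 < e"
  obtains \<beta> where "\<alpha> < \<beta>" "tan_pre \<beta> < tan_angle \<alpha> + e"
  using tan_angle_ge[of \<alpha> "tan_angle \<alpha> + e"] assms by (metis add_le_same_cancel1 linorder_not_le)

lemma tan_pre_tendsto: "(tan_pre \<longlongrightarrow> tan_angle \<alpha>) (at_right \<alpha>)"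
proof (rule order_tendstoI)
  fix y assume "y < tan_angle \<alpha>"
  then show "eventually (\<lambda>x. y < tan_pre x) (at_right \<alpha>)"
    using tan_angle_le by (auto simp: eventually_at_right_field intro!: exI[of _ "\<alpha> + 1"] intro: less_le_trans)
next
  fix y assume "tan_angle \<alpha> < y"
  then obtain \<beta> where b: "\<alpha> < \<beta>" "tan_pre \<beta> < tan_angle \<alpha> + (y - tan_angle \<alpha>)"
    using tan_angle_approx[of "y - tan_angle \<alpha>" \<alpha>] by auto
  then show "eventually (\<lambda>x. tan_pre x < y) (at_right \<alpha>)"
    unfolding eventually_at_right_field
  proof (intro exI[of _ \<beta>] conjI allI impI)
    fix x assume "\<alpha> < x" "x < \<beta>"
    then have "tan_pre x \<le> tan_pre \<beta>" by (intro tan_pre_mono) simp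
    then show "tan_pre x < y" using b by simp
  qed simp_all
qed

lemma tan_angle_right_continuous: "(tan_angle \<longlongrightarrow> tan_angle \<alpha>) (at_right \<alpha>)"
proof (rule tendsto_sandwich)
  have ev: "eventually (\<lambda>x. \<alpha> < x) (at_right \<alpha>)" by (simp add: eventually_at_right_less)
  show "eventually (\<lambda>x. tan_angle \<alpha> \<le> tan_angle x) (at_right \<alpha>)"
    using ev by eventually_elim (auto intro: monoD[OF tan_angle_mono])
  show "eventually (\<lambda>x. tan_angle x \<le> tan_pre (\<alpha> + 2 * (x - \<alpha>))) (at_right \<alpha>)"
    using ev by eventually_elim (auto intro!: tan_angle_le)
  show "((\<lambda>x. tan_angle \<alpha>) \<longlongrightarrow> tan_angle \<alpha>) (at_right \<alpha>)" by simp
  have "filterlim (\<lambda>x. \<alpha> + 2 * (x - \<alpha>)) (at_right \<alpha>) (at_right \<alpha>)"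
    unfolding filterlim_at
    by (auto intro!: tendsto_eq_intros eventually_mono[OF ev])
  then show "((\<lambda>x. tan_pre (\<alpha> + 2 * (x - \<alpha>))) \<longlongrightarrow> tan_angle \<alpha>) (at_right \<alpha>)"
    by (rule filterlim_compose[OF tan_pre_tendsto])
qed

text \<open>The support inequalities of the chosen directions pass to the limit from the right,
  since boundary point and direction both converge.\<close>

lemma supports_at_tan_angle: "supports_at \<alpha> (tan_angle \<alpha>)"
  unfolding supports_at_def
proof
  fix w assume w: "w \<in> closure K"
  have b: "(bdry \<longlongrightarrow> bdry \<alpha>) (at_right \<alpha>)"
    using continuous_on_bdry[of UNIV] by (auto simp: continuous_on_def intro: tendsto_within_subset)
  have "((\<lambda>x. cross2 (dir (tan_pre x)) (w - bdry x)) \<longlongrightarrow> cross2 (dir (tan_angle \<alpha>)) (w - bdry \<alpha>)) (at_right \<alpha>)"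
    unfolding cross2_def dir_nth by (intro tendsto_intros tan_pre_tendsto tendsto_vec_nth b)
  then show "0 \<le> cross2 (dir (tan_angle \<alpha>)) (w - bdry \<alpha>)"
    by (rule tendsto_lowerbound) (use tan_pre(3) w in \<open>auto simp: supports_at_def\<close>)
qed

text \<open>The chord lies to the left of the tangent at its start and, reversed, to the left of the
  tangent at its end; this confines its direction to the sector between the two.\<close>

lemma bdry_chord:
  assumes ab: "\<alpha> < \<beta>" and small: "tan_angle \<beta> - tan_angle \<alpha> < pi"
  obtains \<rho> \<phi> where "0 < \<rho>" "tan_angle \<alpha> \<le> \<phi>" "\<phi> \<le> tan_angle \<beta>" "bdry \<beta> - bdry \<alpha> = \<rho> *\<^sub>R dir \<phi>"
proof -
  let ?d = "bdry \<beta> - bdry \<alpha>"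
  have "\<beta> < \<alpha> + 2 * pi" using small tan_angle_bounds[of \<alpha>] tan_angle_bounds[of \<beta>] by simp
  then have d0: "?d \<noteq> 0" using bdry_inj[OF ab] by simp
  have cl: "bdry \<alpha> \<in> closure K" "bdry \<beta> \<in> closure K" using rad(2) by (auto simp: frontier_def)
  have 1: "0 \<le> cross2 (dir (tan_angle \<alpha>)) ?d"
    using supports_at_tan_angle[of \<alpha>] cl by (simp add: supports_at_def)
  have "0 \<le> cross2 (dir (tan_angle \<beta>)) (bdry \<alpha> - bdry \<beta>)"
    using supports_at_tan_angle[of \<beta>] cl by (simp add: supports_at_def)
  then have 2: "0 \<le> cross2 ?d (dir (tan_angle \<beta>))" by (simp add: cross2_def algebra_simps)
  have le: "tan_angle \<alpha> \<le> tan_angle \<beta>" using ab by (intro monoD[OF tan_angle_mono]) simp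
  show ?thesis
  proof (cases "tan_angle \<alpha> = tan_angle \<beta>")
    case False
    then obtain t where "tan_angle \<alpha> \<le> t" "t \<le> tan_angle \<beta>" "?d = norm ?d *\<^sub>R dir t"
      using dir_direction_between[OF d0 _ _ 1 2] le small by auto
    then show ?thesis using that[of "norm ?d" t] d0 by simp
  next
    case True
    \<comment> \<open>Both ends lie on a common edge, so the chord is parallel to it. The backward
      direction is excluded because from c the boundary turns counterclockwise: the product with the
      radial vector at \<alpha> would have the wrong sign.\<close>
    let ?t = "tan_angle \<alpha>"
    obtain \<psi> where \<psi>: "?t \<le> \<psi>" "\<psi> < ?t + 2 * pi" "?d = norm ?d *\<^sub>R dir \<psi>" using vector_polar[OF d0] by blast
    have "cross2 (dir ?t) ?d = 0"
      using 1 2 True by (simp add: cross2_def algebra_simps)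
    then have "norm ?d * sin (\<psi> - ?t) = 0" using \<psi>(3) by (metis cross2_simps(6) cross2_dir)
    then have s: "sin (\<psi> - ?t) = 0" using d0 by simp
    have "\<psi> = ?t"
    proof (rule ccontr)
      assume "\<psi> \<noteq> ?t"
      then have gt: "0 < \<psi> - ?t" using \<psi> by simp
      have "\<psi> - ?t = pi"
      proof (rule ccontr)
        assume "\<psi> - ?t \<noteq> pi"
        then have "sin (\<psi> - ?t) \<noteq> 0"
          using gt \<psi>(2) sin_gt_zero[of "\<psi> - ?t"] sin_lt_zero[of "\<psi> - ?t"] by (cases "\<psi> - ?t < pi") auto
        then show False using s by simp
      qed
      then have psi: "\<psi> = ?t + pi" by simp
      have "dir (?t + pi) = - dir ?t" by (simp add: vec_eq_iff forall_2)
      then have d: "?d = - (norm ?d *\<^sub>R dir ?t)" using \<psi>(3) unfolding psi by (metis scaleR_minus_right)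
      have "cross2 (rad \<alpha> *\<^sub>R dir \<alpha>) ?d = rad \<alpha> * rad \<beta> * sin (\<beta> - \<alpha>)"
      proof -
        have "?d = rad \<beta> *\<^sub>R dir \<beta> - rad \<alpha> *\<^sub>R dir \<alpha>" by (simp add: bdry_def)
        then show ?thesis by (simp only: cross2_simps cross2_dir) simp
      qed
      moreover have "\<beta> < \<alpha> + pi" using tan_angle_bounds(1)[of \<beta>] tan_angle_bounds(2)[of \<alpha>] True by simp
      then have "0 < rad \<alpha> * rad \<beta> * sin (\<beta> - \<alpha>)"
        using ab rad(1)[of \<alpha>] rad(1)[of \<beta>] sin_gt_zero[of "\<beta> - \<alpha>"] by simp
      moreover have "cross2 (rad \<alpha> *\<^sub>R dir \<alpha>) ?d = - (norm ?d * (rad \<alpha> * sin (?t - \<alpha>)))"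
      proof -
        have "cross2 u (- v) = - cross2 u v" for u v by (simp add: cross2_def)
        then have "cross2 (rad \<alpha> *\<^sub>R dir \<alpha>) (- (norm ?d *\<^sub>R dir ?t)) = - (norm ?d * (rad \<alpha> * sin (?t - \<alpha>)))"
          by (simp only: cross2_simps cross2_dir)
        then show ?thesis using d by metis
      qed
      moreover have "0 < norm ?d * (rad \<alpha> * sin (?t - \<alpha>))"
        using cross2_support_pos[OF supports_at_tan_angle[of \<alpha>]] d0 by simp
      ultimately show False by linarith
    qed
    then show ?thesis using that[of "norm ?d" \<psi>] \<psi>(3) True d0 by simp
  qed
qed

end

section \<open>Arclength along the boundary\<close>

lemma curve_length_degenerate: "b \<le> a \<Longrightarrow> curve_length z a b = 0"
proof -
  assume ba: "b \<le> a"
  have "curve_length z a b \<le> 0"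
  proof (rule curve_length_least)
    fix n and s :: "nat \<Rightarrow> real" assume "mono s" and r: "range s \<subseteq> {a..b}"
    have "s i = a" for i using r ba by (auto simp: image_subset_iff) (metis order_antisym order_trans)
    then show "ennreal (\<Sum>i<n. dist (z (s i)) (z (s (Suc i)))) \<le> 0" by simp
  qed
  then show ?thesis by simp
qed

lemma norm_to_complex [simp]: "norm (to_complex v) = norm v"
  by (rule power2_eq_imp_eq) (simp_all add: to_complex_def norm_real2_sq cmod_power2)

lemma bounded_linear_to_complex: "bounded_linear to_complex"
  by (rule bounded_linear_intro[where K = 1]) (simp_all add: to_complex_def complex_eq_iff norm_to_complex[unfolded to_complex_def])

lemma to_complex_eq_iff [simp]: "to_complex v = to_complex w \<longleftrightarrow> v = w"
  by (auto simp: to_complex_def vec_eq_iff forall_2)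

lemma to_complex_polar: "to_complex (p + r *\<^sub>R dir a) = to_complex p + of_real r * exp (\<i> * of_real a)"
  by (simp add: to_complex_def complex_eq_iff exp_eq_polar Re_exp Im_exp)

context convex_body
begin

lemma curve_length_bdry_finite: "curve_length bdry a b < \<infinity>"
proof (cases "a \<le> b")
  case True
  have "curve_length bdry a b \<le> ennreal (bdry_lip * (b - a))"
  proof (rule curve_length_Lipschitz)
    fix x y :: real assume "x \<le> y"
    then show "dist (bdry x) (bdry y) \<le> bdry_lip * (y - x)" using bdry_Lipschitz[of x y] by (simp add: dist_norm)
  qed (use bdry_lip_pos in simp)
  then show ?thesis by (metis ennreal_less_top infinity_ennreal_def order_le_less_trans)
qed (simp add: curve_length_degenerate)

text \<open>Signed length from angle 0: for either sign of \<alpha> one of the two terms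
  vanishes.\<close>

definition arclen :: "real \<Rightarrow> real" where
  "arclen \<alpha> = enn2real (curve_length bdry 0 \<alpha>) - enn2real (curve_length bdry \<alpha> 0)"

lemma arclen_diff:
  assumes "\<alpha> \<le> \<beta>"
  shows "curve_length bdry \<alpha> \<beta> = ennreal (arclen \<beta> - arclen \<alpha>)" "0 \<le> arclen \<beta> - arclen \<alpha>"
proof -
  have add: "enn2real (curve_length bdry a c) = enn2real (curve_length bdry a b) + enn2real (curve_length bdry b c)"
    if "a \<le> b" "b \<le> c" for a b c
    using curve_length_add[OF that, of bdry] curve_length_bdry_finite by (simp add: enn2real_plus)
  consider "0 \<le> \<alpha>" | "\<alpha> \<le> 0" "0 \<le> \<beta>" | "\<beta> \<le> 0" by linarith
  then have "arclen \<beta> - arclen \<alpha> = enn2real (curve_length bdry \<alpha> \<beta>)"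
  proof cases
    case 1
    then show ?thesis using add[OF 1 assms] assms by (simp add: arclen_def curve_length_degenerate)
  next
    case 2
    then show ?thesis using add[of \<alpha> 0 \<beta>] by (simp add: arclen_def curve_length_degenerate)
  next
    case 3
    then show ?thesis using add[OF assms 3] assms by (simp add: arclen_def curve_length_degenerate)
  qed
  then show "curve_length bdry \<alpha> \<beta> = ennreal (arclen \<beta> - arclen \<alpha>)" "0 \<le> arclen \<beta> - arclen \<alpha>"
    using curve_length_bdry_finite[of \<alpha> \<beta>] by simp_all
qed

lemma arclen_0 [simp]: "arclen 0 = 0"
  by (simp add: arclen_def)

lemma arclen_Lipschitz: "\<bar>arclen \<alpha> - arclen \<beta>\<bar> \<le> bdry_lip * \<bar>\<alpha> - \<beta>\<bar>"
proof -
  have *: "\<bar>arclen \<alpha> - arclen \<beta>\<bar> \<le> bdry_lip * \<bar>\<alpha> - \<beta>\<bar>" if "\<alpha> \<le> \<beta>" for \<alpha> \<beta>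
  proof -
    have "ennreal (arclen \<beta> - arclen \<alpha>) \<le> ennreal (bdry_lip * (\<beta> - \<alpha>))"
      unfolding arclen_diff(1)[OF that, symmetric]
    proof (rule curve_length_Lipschitz)
      fix x y :: real assume "x \<le> y"
      then show "dist (bdry x) (bdry y) \<le> bdry_lip * (y - x)" using bdry_Lipschitz[of x y] by (simp add: dist_norm)
    qed (use bdry_lip_pos in simp)
    then show ?thesis using arclen_diff(2)[OF that] bdry_lip_pos that by (subst (asm) ennreal_le_iff) auto
  qed
  show ?thesis using *[of \<alpha> \<beta>] *[of \<beta> \<alpha>] by (cases "\<alpha> \<le> \<beta>") (auto simp: abs_minus_commute)
qed

lemma continuous_on_arclen: "continuous_on S arclen"
proof (rule continuous_on_subset[OF lipschitz_on_continuous_on])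
  show "bdry_lip-lipschitz_on UNIV arclen"
    by (rule lipschitz_onI) (use arclen_Lipschitz bdry_lip_pos in \<open>auto simp: dist_real_def\<close>)
qed simp

lemma strict_mono_arclen: "strict_mono arclen"
proof (rule strict_monoI)
  fix x y :: real assume xy: "x < y"
  \<comment> \<open>A full turn returns to the same point, so the chord is taken to a point less
    than 2\<pi> away.\<close>
  define m where "m = min y (x + 1)"
  have m: "x < m" "m \<le> y" "m < x + 2 * pi" using xy pi_gt3 by (auto simp: m_def min_def)
  have "0 < dist (bdry x) (bdry m)" using bdry_inj[of x m] m by simp
  also have "ennreal (dist (bdry x) (bdry m)) \<le> ennreal (arclen m - arclen x)"
    unfolding arclen_diff(1)[OF less_imp_le[OF m(1)], symmetric] by (rule chord_le_curve_length) (use m in simp)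
  then have "dist (bdry x) (bdry m) \<le> arclen m - arclen x" using arclen_diff(2)[of x m] m(1) by (subst (asm) ennreal_le_iff) auto
  finally show "arclen x < arclen y" using arclen_diff(2)[OF m(2)] by simp
qed

definition perimeter :: real where
  "perimeter = arclen (2 * pi)"

lemma perimeter_pos: "0 < perimeter"
  using strict_monoD[OF strict_mono_arclen, of 0 "2 * pi"] by (simp add: perimeter_def)

lemma arclen_periodic: "arclen (\<alpha> + 2 * pi) = arclen \<alpha> + perimeter"
proof -
  have shift: "curve_length bdry a b = curve_length bdry (a + 2 * pi) (b + 2 * pi)" for a b
    by (rule curve_length_reparam) auto
  have "arclen (b + 2 * pi) - arclen (a + 2 * pi) = arclen b - arclen a" if "a \<le> b" for a b
    using shift[of a b] arclen_diff[OF that] arclen_diff[of "a + 2 * pi" "b + 2 * pi"] that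
    by (metis add_le_cancel_right ennreal_inj)
  from this[of 0 \<alpha>] this[of \<alpha> 0] show ?thesis by (cases "0 \<le> \<alpha>") (auto simp: perimeter_def)
qed

lemma surj_arclen: "surj arclen"
proof -
  have up: "arclen (\<alpha> + 2 * pi * real n) = arclen \<alpha> + real n * perimeter" for \<alpha> and n :: nat
  proof (induction n)
    case (Suc n)
    have "arclen (\<alpha> + 2 * pi * real (Suc n)) = arclen (\<alpha> + 2 * pi * real n + 2 * pi)" by (simp add: algebra_simps)
    then show ?case using Suc arclen_periodic[of "\<alpha> + 2 * pi * real n"] by (simp add: algebra_simps)
  qed simp
  have "\<exists>x. arclen x = y" for y
  proof -
    obtain n :: nat where n: "\<bar>y\<bar> / perimeter < real n" using reals_Archimedean2 by blast
    then have n': "\<bar>y\<bar> < real n * perimeter" using perimeter_pos by (simp add: field_simps)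
    have "arclen (- (2 * pi * real n)) \<le> y" "y \<le> arclen (2 * pi * real n)"
      using n' up[of 0 n] up[of "- (2 * pi * real n)" n] by auto
    moreover have "- (2 * pi * real n) \<le> 2 * pi * real n" by simp
    ultimately show ?thesis using IVT'[OF _ _ _ continuous_on_arclen] by blast
  qed
  then show ?thesis by (metis surjI)
qed

definition angle_at :: "real \<Rightarrow> real" where
  "angle_at = inv arclen"

lemma arclen_angle_at [simp]: "arclen (angle_at t) = t"
  unfolding angle_at_def by (rule surj_f_inv_f[OF surj_arclen])

lemma angle_at_arclen [simp]: "angle_at (arclen \<alpha>) = \<alpha>"
  unfolding angle_at_def by (rule inv_f_f[OF strict_mono_imp_inj_on[OF strict_mono_arclen]])

lemma strict_mono_angle_at: "strict_mono angle_at"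
  by (rule strict_monoI) (metis arclen_angle_at strict_mono_arclen strict_mono_less)

lemma angle_at_image: "a \<le> b \<Longrightarrow> angle_at ` {a..b} = {angle_at a..angle_at b}"
proof -
  have "t \<in> angle_at ` {a..b}" if "angle_at a \<le> t" "t \<le> angle_at b" for t
  proof (rule image_eqI)
    show "t = angle_at (arclen t)" by simp
    show "arclen t \<in> {a..b}" using that by (metis arclen_angle_at atLeastAtMost_iff strict_mono_arclen strict_mono_less_eq)
  qed
  then show ?thesis by (auto simp: strict_mono_less_eq[OF strict_mono_angle_at])
qed

lemma continuous_on_angle_at: "continuous_on S angle_at"
proof -
  have "range angle_at = UNIV" by (metis angle_at_arclen surjI)
  then have "continuous_on UNIV angle_at"
    by (intro continuous_onI_mono) (auto simp: strict_mono_less_eq[OF strict_mono_angle_at])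
  then show ?thesis by (rule continuous_on_subset) simp
qed

lemma angle_at_periodic: "angle_at (t + perimeter) = angle_at t + 2 * pi"
  by (metis angle_at_arclen arclen_angle_at arclen_periodic)

lemma inside_frontier: "inside (frontier K) = K"
  using inside_frontier_eq_interior[OF K_bounded K_convex] by simp

text \<open>About c the logarithm of the curve is explicit: log of the radius plus i times the
  angle, which gains 2\<pi>. The other points of K follow because K is connected and misses the
  curve.\<close>

lemma winding_number_polar:
  assumes \<alpha>: "continuous_on {0..1} \<alpha>" "\<alpha> 1 = \<alpha> 0 + 2 * pi" and w: "w \<in> K"
  shows "winding_number (\<lambda>s. to_complex (bdry (\<alpha> s))) (to_complex w) = 1"
proof -
  define g where "g s = to_complex (bdry (\<alpha> s))" for s
  have "continuous_on {0..1} (\<lambda>s. bdry (\<alpha> s))" by (rule continuous_on_compose2[OF continuous_on_bdry[of UNIV] \<alpha>(1)]) simp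
  then have g: "path g" unfolding path_def g_def by (intro bounded_linear.continuous_on[OF bounded_linear_to_complex])
  have loop: "pathfinish g = pathstart g"
    by (simp add: pathfinish_def pathstart_def g_def \<alpha>(2))
  define q where "q s = of_real (ln (norm (bdry (\<alpha> s) - c))) + \<i> * of_real (\<alpha> s)" for s
  have rad_eq: "norm (bdry \<beta> - c) = rad \<beta>" for \<beta> using rad(1)[of \<beta>] by (simp add: bdry_def)
  have q: "path q"
    unfolding path_def q_def
    by (intro continuous_intros continuous_on_compose2[OF continuous_on_bdry[of UNIV] \<alpha>(1)] \<alpha>(1)) (auto simp: rad_eq rad(1) less_imp_neq[OF rad(1)] intro!: less_imp_neq[OF rad(1), symmetric])
  have gq: "g s - to_complex c = (exp \<circ> q) s" for s
    using rad(1)[of "\<alpha> s"] by (simp add: g_def bdry_def to_complex_polar q_def rad_eq[unfolded bdry_def] exp_add exp_of_real)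
  have "winding_number g (to_complex c) = winding_number (exp \<circ> q) 0"
    unfolding winding_number_offset[of g] gq by (simp add: comp_def)
  also have "\<dots> = 1"
    unfolding winding_number_compose_exp[OF q]
    by (simp add: pathfinish_def pathstart_def q_def \<alpha>(2) distrib_left)
  finally have wc: "winding_number g (to_complex c) = 1" .
  have "winding_number g constant_on (to_complex ` K)"
  proof (rule winding_number_constant[OF g loop])
    show "connected (to_complex ` K)"
      by (intro connected_continuous_image bounded_linear.continuous_on[OF bounded_linear_to_complex] continuous_on_id convex_connected K_convex)
    show "to_complex ` K \<inter> path_image g = {}"
      using rad(2) frontier_not_in by (auto simp: path_image_def g_def)
  qed
  then show ?thesis using wc w c_in by (auto simp: constant_on_def g_def[abs_def])
qed

theorem ccw_arclength_param_exists: "ccw_arclength_param (frontier K) perimeter (\<lambda>t. bdry (angle_at t))"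
  unfolding ccw_arclength_param_def
proof (intro conjI allI impI ballI)
  show "0 < perimeter" by (rule perimeter_pos)
  show "continuous_on UNIV (\<lambda>t. bdry (angle_at t))"
    by (rule continuous_on_compose2[OF continuous_on_bdry[of UNIV] continuous_on_angle_at]) simp
  show "bdry (angle_at (t + perimeter)) = bdry (angle_at t)" for t by (simp add: angle_at_periodic)
  have a0: "angle_at 0 = 0" using angle_at_arclen[of 0] by simp
  have aL: "angle_at perimeter = 2 * pi" using angle_at_periodic[of 0] a0 by simp
  show "bij_betw (\<lambda>t. bdry (angle_at t)) {0..<perimeter} (frontier K)"
  proof (rule bij_betwI')
    fix x y assume xy: "x \<in> {0..<perimeter}" "y \<in> {0..<perimeter}"
    have lt: "bdry (angle_at x) \<noteq> bdry (angle_at y)" if "x < y" "x \<in> {0..<perimeter}" "y \<in> {0..<perimeter}" for x y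
    proof (rule bdry_inj)
      show "angle_at x < angle_at y" using that by (simp add: strict_mono_less[OF strict_mono_angle_at])
      have "angle_at y < 2 * pi" unfolding aL[symmetric] using that by (simp add: strict_mono_less[OF strict_mono_angle_at])
      moreover have "0 \<le> angle_at x" using a0 that strict_mono_less_eq[OF strict_mono_angle_at, of 0 x] by simp
      ultimately show "angle_at y < angle_at x + 2 * pi" by simp
    qed
    show "bdry (angle_at x) = bdry (angle_at y) \<longleftrightarrow> x = y"
      using lt[of x y] lt[of y x] xy by (metis linorder_neqE_linordered_idom)
    show "bdry (angle_at x) \<in> frontier K" by (rule rad(2))
  next
    fix p assume "p \<in> frontier K"
    then obtain \<alpha> where \<alpha>: "0 \<le> \<alpha>" "\<alpha> < 0 + 2 * pi" "p = bdry \<alpha>" by (rule bdry_surj)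
    have "0 \<le> arclen \<alpha>" "arclen \<alpha> < perimeter"
      using \<alpha> strict_mono_less_eq[OF strict_mono_arclen, of 0 \<alpha>] strict_mono_less[OF strict_mono_arclen, of \<alpha> "2 * pi"]
      by (auto simp: perimeter_def)
    then show "\<exists>x\<in>{0..<perimeter}. p = bdry (angle_at x)"
      using \<alpha>(3) by (intro bexI[of _ "arclen \<alpha>"]) auto
  qed
  fix a b :: real assume ab: "0 \<le> a \<and> a \<le> b \<and> b \<le> perimeter"
  have le: "angle_at a \<le> angle_at b" using ab by (simp add: strict_mono_less_eq[OF strict_mono_angle_at])
  have "curve_length (\<lambda>t. bdry (angle_at t)) a b = curve_length bdry (angle_at a) (angle_at b)"
    using ab by (intro curve_length_reparam) (auto simp: strict_mono_less_eq[OF strict_mono_angle_at] angle_at_image)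
  then show "curve_length (\<lambda>t. bdry (angle_at t)) a b = ennreal (b - a)"
    using arclen_diff(1)[OF le] by simp
next
  fix w assume "w \<in> inside (frontier K)"
  then have "w \<in> K" by (simp add: inside_frontier)
  moreover have "continuous_on {0..1} (\<lambda>s. angle_at (perimeter * s))"
    by (intro continuous_on_compose2[OF continuous_on_angle_at[of UNIV]] continuous_intros) simp
  ultimately show "winding_number (\<lambda>s. to_complex (bdry (angle_at (perimeter * s)))) (to_complex w) = 1"
    using angle_at_periodic[of 0] by (intro winding_number_polar) auto
qed

text \<open>The measure is defined through an arbitrary choice of parametrization, so every
  admissible z must be understood. The angle is the imaginary part of a continuous logarithm of z -
  c, and it is monotone because a continuous injective real function on an interval is.\<close>

theorem ccw_arclength_param_angle:
  assumes p: "ccw_arclength_param (frontier K) L z"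
  obtains A where "continuous_on UNIV A" "mono A" "\<And>s t. 0 \<le> s \<Longrightarrow> s < t \<Longrightarrow> t \<le> L \<Longrightarrow> A s < A t"
    "A L = A 0 + 2 * pi" "\<And>t. 0 \<le> t \<Longrightarrow> t \<le> L \<Longrightarrow> z t = bdry (A t)"
proof -
  have L: "0 < L" and zc: "continuous_on UNIV z" and per: "\<And>t. z (t + L) = z t" and bij: "bij_betw z {0..<L} (frontier K)"
    and wind: "\<And>w. w \<in> K \<Longrightarrow> winding_number (\<lambda>s. to_complex (z (L * s))) (to_complex w) = 1"
    using p unfolding ccw_arclength_param_def inside_frontier by auto
  have zin: "z t \<in> frontier K" if "0 \<le> t" "t \<le> L" for t
  proof (cases "t = L")
    case True
    then show ?thesis using per[of 0] bij L by (auto simp: bij_betw_def)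
  qed (use that bij in \<open>auto simp: bij_betw_def\<close>)
  define g where "g s = to_complex (z (L * s))" for s
  have "continuous_on {0..1} (\<lambda>s. z (L * s))" by (intro continuous_on_compose2[OF zc] continuous_intros) simp
  then have g: "path g" unfolding path_def g_def by (intro bounded_linear.continuous_on[OF bounded_linear_to_complex])
  have cg: "to_complex c \<notin> path_image g"
  proof
    assume "to_complex c \<in> path_image g"
    then obtain s where "0 \<le> s" "s \<le> 1" "c = z (L * s)" by (auto simp: path_image_def g_def)
    then have "c \<in> frontier K" using zin[of "L * s"] L by (simp add: mult_le_cancel_left1)
    then show False using c_in frontier_not_in by blast
  qed
  obtain q where q: "path q" "pathfinish q - pathstart q = 2 * of_real pi * \<i> * winding_number g (to_complex c)"
    "\<And>t. t \<in> {0..1} \<Longrightarrow> g t = to_complex c + exp (q t)"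
    using winding_number_as_continuous_log[OF g cg] by blast
  have q1: "q 1 - q 0 = 2 * of_real pi * \<i>"
    using q(2) wind[OF c_in] by (simp add: pathfinish_def pathstart_def g_def[abs_def])
  define A0 where "A0 t = Im (q (t / L))" for t
  have contA0: "continuous_on {0..L} A0"
    unfolding A0_def
    by (intro continuous_intros continuous_on_compose2[OF q(1)[unfolded path_def]]) (use L in auto)
  have A0L: "A0 L = A0 0 + 2 * pi" using arg_cong[OF q1, of Im] L by (simp add: A0_def)
  have zA0: "z t = bdry (A0 t)" if "0 \<le> t" "t \<le> L" for t
  proof -
    have "to_complex (z t) = to_complex c + exp (q (t / L))"
      using q(3)[of "t / L"] that L by (simp add: g_def)
    also have "exp (q (t / L)) = of_real (exp (Re (q (t / L)))) * exp (\<i> * of_real (A0 t))"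
      unfolding A0_def exp_of_real[symmetric] exp_add[symmetric] by (simp add: complex_eq[symmetric])
    finally have zt: "z t = c + exp (Re (q (t / L))) *\<^sub>R dir (A0 t)"
      unfolding to_complex_polar[symmetric] by simp
    then have "exp (Re (q (t / L))) = rad (A0 t)"
      using zin[OF that] by (intro rad_unique) auto
    then show ?thesis using zt by (simp add: bdry_def)
  qed
  have inj: "inj_on A0 {0..<L}"
  proof (rule inj_onI)
    fix x y assume xy: "x \<in> {0..<L}" "y \<in> {0..<L}" "A0 x = A0 y"
    then have "z x = z y" using zA0[of x] zA0[of y] by simp
    then show "x = y" using bij xy by (auto simp: bij_betw_def inj_on_def)
  qed
  have cl: "closure {0..<L} = {0..L}" using L by simp
  have "continuous_on {0..<L} A0" by (rule continuous_on_subset[OF contA0]) auto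
  then have "strict_mono_on {0..<L} A0 \<or> strict_antimono_on {0..<L} A0"
    using injective_eq_monotone_map[of "{0..<L}" A0] inj by auto
  \<comment> \<open>Here the orientation enters: winding number 1 makes the angle gain 2\<pi>, which
    a decreasing function cannot do.\<close>
  moreover have "\<not> strict_antimono_on {0..<L} A0"
  proof
    assume "strict_antimono_on {0..<L} A0"
    then have "A0 t \<le> A0 0" if "t \<in> {0..<L}" for t
      using that monotone_onD[OF \<open>strict_antimono_on {0..<L} A0\<close>, of 0 t] by (cases "t = 0") auto
    then have "A0 L \<le> A0 0"
      using continuous_le_on_closure[of "{0..<L}" A0 L "A0 0"] contA0 L by (simp add: cl)
    then show False using A0L pi_gt_zero by simp
  qed
  ultimately have sm: "strict_mono_on {0..<L} A0" by blast
  have A0_less: "A0 s < A0 t" if st: "0 \<le> s" "s < t" "t \<le> L" for s t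
  proof (cases "t = L")
    case True
    define m where "m = (s + L) / 2"
    have m: "s < m" "m < L" using st True by (auto simp: m_def)
    have "A0 m \<le> A0 x" if "x \<in> {m..<L}" for x
      using that m st strict_mono_onD[OF sm, of m x] by (cases "m = x") auto
    then have "A0 m \<le> A0 L"
      using continuous_ge_on_closure[of "{m..<L}" A0 L "A0 m"] continuous_on_subset[OF contA0, of "{m..L}"] m st by simp
    then show ?thesis using strict_mono_onD[OF sm, of s m] m st True by simp
  qed (use st strict_mono_onD[OF sm, of s t] in auto)
  \<comment> \<open>Clamping extends the angle to a continuous monotone function on the whole line;
    z is described by it on [0, L].\<close>
  define A where "A t = A0 (max 0 (min L t))" for t
  have eq: "A t = A0 t" if "0 \<le> t" "t \<le> L" for t using that by (simp add: A_def)
  show ?thesis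
  proof (rule that[of A])
    show "continuous_on UNIV A" unfolding A_def
      by (intro continuous_on_compose2[OF contA0] continuous_intros) (use L in auto)
    show "mono A"
    proof (rule monoI)
      fix x y :: real assume "x \<le> y"
      then have "0 \<le> max 0 (min L x)" "max 0 (min L x) \<le> max 0 (min L y)" "max 0 (min L y) \<le> L"
        using L by (auto simp: max_def min_def)
      then show "A x \<le> A y" unfolding A_def using A0_less by (metis order_le_less order_refl)
    qed
    show "A s < A t" if "0 \<le> s" "s < t" "t \<le> L" for s t using A0_less[OF that] eq that by simp
    show "A L = A 0 + 2 * pi" using A0L eq L by simp
    show "z t = bdry (A t)" if "0 \<le> t" "t \<le> L" for t using zA0 eq that by simp
  qed
qed

end

lemma one_minus_cos_le:
  fixes x :: real
  shows "1 - cos x \<le> \<bar>x\<bar>"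
  using component_le_norm_cart[of "dir x - dir 0" 1] dir_Lipschitz[of x 0] by simp

section \<open>Arclength parametrizations and affine arclength\<close>

text \<open>A choice of parametrization with its lifted angle A. All that follows concerns z = bdry
  \<circ> A on [0, L].\<close>

locale convex_param = convex_body +
  fixes L :: real and z :: "real \<Rightarrow> real^2" and A :: "real \<Rightarrow> real"
  assumes L_pos: "0 < L" and z_continuous: "continuous_on UNIV z"
    and z_bij: "bij_betw z {0..<L} (frontier K)"
    and z_length: "\<And>a b. 0 \<le> a \<Longrightarrow> a \<le> b \<Longrightarrow> b \<le> L \<Longrightarrow> curve_length z a b = ennreal (b - a)"
    and A_continuous: "continuous_on UNIV A" and A_mono: "mono A"
    and A_less: "\<And>s t. 0 \<le> s \<Longrightarrow> s < t \<Longrightarrow> t \<le> L \<Longrightarrow> A s < A t"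
    and A_L: "A L = A 0 + 2 * pi" and z_eq: "\<And>t. 0 \<le> t \<Longrightarrow> t \<le> L \<Longrightarrow> z t = bdry (A t)"

lemma (in convex_body) convex_param_exists:
  assumes "ccw_arclength_param (frontier K) L z"
  obtains A where "convex_param K c L z A"
proof -
  obtain A where A: "continuous_on UNIV A" "mono A" "\<And>s t. 0 \<le> s \<Longrightarrow> s < t \<Longrightarrow> t \<le> L \<Longrightarrow> A s < A t"
    "A L = A 0 + 2 * pi" "\<And>t. 0 \<le> t \<Longrightarrow> t \<le> L \<Longrightarrow> z t = bdry (A t)"
    using ccw_arclength_param_angle[OF assms] by blast
  have "convex_param K c L z A"
    by unfold_locales (use A assms in \<open>auto simp: ccw_arclength_param_def\<close>)
  then show ?thesis by (rule that)
qed

section \<open>Tangent angle and derivatives of the parametrization\<close>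

context convex_param
begin

definition \<theta> :: "real \<Rightarrow> real" where
  "\<theta> t = tan_angle (A t)"

lemma \<theta>_mono: "mono \<theta>"
  unfolding \<theta>_def by (intro monoI monoD[OF tan_angle_mono] monoD[OF A_mono])

lemma \<theta>_measurable [measurable]: "\<theta> \<in> borel_measurable borel"
  by (rule borel_measurable_mono[OF \<theta>_mono])

lemma z_measurable [measurable]: "z \<in> borel_measurable borel"
  by (rule borel_measurable_continuous_onI[OF z_continuous])

text \<open>A gains 2\<pi> and the tangent runs ahead of the radial angle by at most \<pi>, so
  \<theta> stays within 3\<pi> < 10 of A 0. This is the origin of the ten arcs.\<close>

lemma \<theta>_range: "0 \<le> t \<Longrightarrow> t \<le> L \<Longrightarrow> A 0 \<le> \<theta> t \<and> \<theta> t < A 0 + 10"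
  using tan_angle_bounds[of "A t"] monoD[OF A_mono, of 0 t] monoD[OF A_mono, of t L] A_L pi_less_4 pi_approx
  by (auto simp: \<theta>_def)

lemma chord:
  assumes "0 \<le> s" "s < t" "t \<le> L" "\<theta> t - \<theta> s < pi"
  obtains \<rho> \<phi> where "0 < \<rho>" "\<theta> s \<le> \<phi>" "\<phi> \<le> \<theta> t" "z t - z s = \<rho> *\<^sub>R dir \<phi>"
  using bdry_chord[OF A_less[OF assms(1-3)] assms(4)[unfolded \<theta>_def]] z_eq[of s] z_eq[of t] assms
  unfolding \<theta>_def by auto

lemma dist_le: "0 \<le> s \<Longrightarrow> s \<le> t \<Longrightarrow> t \<le> L \<Longrightarrow> dist (z s) (z t) \<le> t - s"
  using chord_le_curve_length[of s t z] z_length[of s t] by simp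

text \<open>Every side of an inscribed polygon makes an angle of at most \<theta> t - \<theta> s
  with the chord. Its projection loses at most the factor \<open>cos \<Delta>\<close>, and the
  projections add up to no more than the chord.\<close>

lemma dist_ge:
  assumes st: "0 \<le> s" "s < t" "t \<le> L" and small: "\<theta> t - \<theta> s < pi / 2"
  shows "(t - s) * cos (\<theta> t - \<theta> s) \<le> dist (z s) (z t)"
proof -
  define \<Delta> where "\<Delta> = \<theta> t - \<theta> s"
  have d: "0 \<le> \<Delta>" "\<Delta> < pi / 2" using monoD[OF \<theta>_mono, of s t] st small by (auto simp: \<Delta>_def)
  have cpos: "0 < cos \<Delta>" using d by (intro cos_gt_zero_pi) auto
  obtain \<rho> \<phi> where \<rho>: "0 < \<rho>" "\<theta> s \<le> \<phi>" "\<phi> \<le> \<theta> t" "z t - z s = \<rho> *\<^sub>R dir \<phi>"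
    using chord[OF st] small pi_gt_zero by auto
  have proj: "dist (z x) (z y) * cos \<Delta> \<le> (z y - z x) \<bullet> dir \<phi>" if xy: "s \<le> x" "x \<le> y" "y \<le> t" for x y
  proof (cases "x = y")
    case False
    have mono: "\<theta> s \<le> \<theta> x" "\<theta> y \<le> \<theta> t" using xy by (auto intro: monoD[OF \<theta>_mono])
    obtain r \<psi> where r: "0 < r" "\<theta> x \<le> \<psi>" "\<psi> \<le> \<theta> y" "z y - z x = r *\<^sub>R dir \<psi>"
      using chord[of x y] xy False st mono small pi_gt_zero by auto
    have "cos \<Delta> \<le> cos \<bar>\<phi> - \<psi>\<bar>"
      using \<rho> r mono d by (intro cos_monotone_0_pi_le) (auto simp: \<Delta>_def)
    moreover have "dist (z x) (z y) = r" using r by (simp add: dist_norm norm_minus_commute[of "z x"])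
    ultimately show ?thesis using r by (simp add: inner_dir)
  qed simp
  have "curve_length z s t \<le> ennreal (\<rho> / cos \<Delta>)"
  proof (rule curve_length_least)
    fix n and p :: "nat \<Rightarrow> real" assume p: "mono p" "range p \<subseteq> {s..t}"
    have pr: "s \<le> p i" "p i \<le> t" for i using p(2) by (auto simp: image_subset_iff)
    have "(\<Sum>i<n. dist (z (p i)) (z (p (Suc i)))) * cos \<Delta> \<le> (\<Sum>i<n. (z (p (Suc i)) - z (p i)) \<bullet> dir \<phi>)"
      unfolding sum_distrib_right by (intro sum_mono proj pr monoD[OF p(1)]) simp
    also have "\<dots> = (z (p n) - z (p 0)) \<bullet> dir \<phi>"
      unfolding inner_sum_left[symmetric] sum_lessThan_telescope[of "\<lambda>i. z (p i)" n] ..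
    also have "\<dots> \<le> (z (p n) - z (p 0)) \<bullet> dir \<phi> + (z (p 0) - z s) \<bullet> dir \<phi> + (z t - z (p n)) \<bullet> dir \<phi>"
    proof -
      have "0 \<le> (z (p 0) - z s) \<bullet> dir \<phi>" "0 \<le> (z t - z (p n)) \<bullet> dir \<phi>"
        using order_trans[OF mult_nonneg_nonneg[OF zero_le_dist less_imp_le[OF cpos]] proj] pr by auto
      then show ?thesis by simp
    qed
    also have "\<dots> = (z t - z s) \<bullet> dir \<phi>" by (simp add: inner_diff_left)
    also have "\<dots> = \<rho>" using \<rho> by (simp add: inner_dir)
    finally show "ennreal (\<Sum>i<n. dist (z (p i)) (z (p (Suc i)))) \<le> ennreal (\<rho> / cos \<Delta>)"
      using cpos by (intro ennreal_leI) (simp add: field_simps)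
  qed
  then have "t - s \<le> \<rho> / cos \<Delta>"
    using z_length[of s t] st \<rho> cpos by (subst (asm) z_length) (auto simp: ennreal_le_iff)
  moreover have "dist (z s) (z t) = \<rho>" using \<rho> by (simp add: dist_norm norm_minus_commute[of "z s"])
  ultimately show ?thesis using cpos by (simp add: \<Delta>_def field_simps)
qed

text \<open>The error has two sources, the length and the direction of the chord, and each
  contributes at most (\<theta> t - \<theta> s) * (t - s). Continuity of \<theta> then yields
  derivatives of z.\<close>

lemma chord_direction:
  assumes st: "0 \<le> s" "s < t" "t \<le> L" and small: "\<theta> t - \<theta> s < pi / 2" and \<psi>: "\<theta> s \<le> \<psi>" "\<psi> \<le> \<theta> t"
  shows "norm (z t - z s - (t - s) *\<^sub>R dir \<psi>) \<le> 2 * (\<theta> t - \<theta> s) * (t - s)"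
proof -
  obtain \<rho> \<phi> where \<rho>: "0 < \<rho>" "\<theta> s \<le> \<phi>" "\<phi> \<le> \<theta> t" "z t - z s = \<rho> *\<^sub>R dir \<phi>"
    using chord[OF st] small pi_gt_zero by auto
  have dist: "dist (z s) (z t) = \<rho>" using \<rho> by (simp add: dist_norm norm_minus_commute[of "z s"])
  have "(t - s) - \<rho> \<le> (t - s) * (1 - cos (\<theta> t - \<theta> s))"
    using dist_ge[OF st small] dist by (simp add: algebra_simps)
  also have "\<dots> \<le> (t - s) * (\<theta> t - \<theta> s)"
    using one_minus_cos_le[of "\<theta> t - \<theta> s"] \<psi> st by (intro mult_left_mono) auto
  finally have 1: "\<bar>\<rho> - (t - s)\<bar> \<le> (t - s) * (\<theta> t - \<theta> s)"
    using dist_le[of s t] st dist by simp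
  have 2: "(t - s) * norm (dir \<phi> - dir \<psi>) \<le> (t - s) * (\<theta> t - \<theta> s)"
    using dir_Lipschitz[of \<phi> \<psi>] \<psi> \<rho> st by (intro mult_left_mono) auto
  have "z t - z s - (t - s) *\<^sub>R dir \<psi> = (\<rho> - (t - s)) *\<^sub>R dir \<phi> + (t - s) *\<^sub>R (dir \<phi> - dir \<psi>)"
    by (simp add: \<rho> algebra_simps)
  then have "norm (z t - z s - (t - s) *\<^sub>R dir \<psi>) \<le> \<bar>\<rho> - (t - s)\<bar> + (t - s) * norm (dir \<phi> - dir \<psi>)"
    using norm_triangle_ineq[of "(\<rho> - (t - s)) *\<^sub>R dir \<phi>" "(t - s) *\<^sub>R (dir \<phi> - dir \<psi>)"] st by simp
  then show ?thesis using 1 2 by (simp add: algebra_simps)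
qed

lemma \<theta>_right_continuous:
  assumes "0 \<le> t" "t < L"
  shows "(\<theta> \<longlongrightarrow> \<theta> t) (at_right t)"
proof -
  have "(A \<longlongrightarrow> A t) (at_right t)"
    using A_continuous by (auto simp: continuous_on_def intro: tendsto_within_subset)
  moreover have "eventually (\<lambda>s. A t < A s) (at_right t)"
    unfolding eventually_at_right_field using assms A_less[of t] by (intro exI[of _ L]) auto
  ultimately have "filterlim A (at_right (A t)) (at_right t)"
    unfolding filterlim_at by (auto elim: eventually_mono)
  then show ?thesis unfolding \<theta>_def[abs_def] by (rule filterlim_compose[OF tan_angle_right_continuous])
qed

lemma z_right_derivative:
  assumes t: "0 \<le> t" "t < L"
  shows "(z has_vector_derivative dir (\<theta> t)) (at_right t)"
  unfolding has_vector_derivative_def has_derivative_within_alt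
proof (intro conjI allI impI)
  show "bounded_linear (\<lambda>h. h *\<^sub>R dir (\<theta> t))" by (rule bounded_linear_scaleR_left)
  fix e :: real assume e: "0 < e"
  have "eventually (\<lambda>s. \<theta> s < \<theta> t + min (e / 2) 1) (at_right t)"
    using e by (intro order_tendstoD[OF \<theta>_right_continuous[OF t]]) simp
  then obtain b where b: "b > t" "\<And>s. t < s \<Longrightarrow> s < b \<Longrightarrow> \<theta> s < \<theta> t + min (e / 2) 1"
    unfolding eventually_at_right_field by blast
  show "\<exists>d>0. \<forall>y\<in>{t<..}. norm (y - t) < d \<longrightarrow> norm (z y - z t - (y - t) *\<^sub>R dir (\<theta> t)) \<le> e * norm (y - t)"
  proof (intro exI[of _ "min (b - t) (L - t)"] conjI ballI impI)
    fix y assume y: "y \<in> {t<..}" "norm (y - t) < min (b - t) (L - t)"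
    then have lt: "\<theta> y < \<theta> t + min (e / 2) 1" by (intro b) auto
    have "norm (z y - z t - (y - t) *\<^sub>R dir (\<theta> t)) \<le> 2 * (\<theta> y - \<theta> t) * (y - t)"
      using y t lt pi_gt3 monoD[OF \<theta>_mono, of t y] by (intro chord_direction) auto
    also have "\<dots> \<le> e * (y - t)" using y lt by (intro mult_right_mono) auto
    finally show "norm (z y - z t - (y - t) *\<^sub>R dir (\<theta> t)) \<le> e * norm (y - t)" using y by simp
  qed (use b t in auto)
qed

lemma z_derivative:
  assumes t: "0 < t" "t < L" and cont: "isCont \<theta> t"
  shows "(z has_vector_derivative dir (\<theta> t)) (at t)"
  unfolding has_vector_derivative_def has_derivative_within_alt
proof (intro conjI allI impI)
  show "bounded_linear (\<lambda>h. h *\<^sub>R dir (\<theta> t))" by (rule bounded_linear_scaleR_left)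
  fix e :: real assume e: "0 < e"
  then obtain d where d: "d > 0" "\<And>y. dist y t < d \<Longrightarrow> dist (\<theta> y) (\<theta> t) < min (e / 2) 1"
    using cont unfolding continuous_at_eps_delta by (metis half_gt_zero min_less_iff_conj zero_less_one)
  show "\<exists>d>0. \<forall>y\<in>UNIV. norm (y - t) < d \<longrightarrow> norm (z y - z t - (y - t) *\<^sub>R dir (\<theta> t)) \<le> e * norm (y - t)"
  proof (intro exI[of _ "min d (min t (L - t))"] conjI ballI impI)
    fix y assume y: "norm (y - t) < min d (min t (L - t))"
    then have lt: "\<bar>\<theta> y - \<theta> t\<bar> < min (e / 2) 1" using d(2)[of y] by (simp add: dist_real_def)
    consider "y = t" | "t < y" | "y < t" by linarith
    then show "norm (z y - z t - (y - t) *\<^sub>R dir (\<theta> t)) \<le> e * norm (y - t)"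
    proof cases
      case 2
      then have "norm (z y - z t - (y - t) *\<^sub>R dir (\<theta> t)) \<le> 2 * (\<theta> y - \<theta> t) * (y - t)"
        using y t lt pi_gt3 monoD[OF \<theta>_mono, of t y] by (intro chord_direction) auto
      also have "\<dots> \<le> e * (y - t)" using 2 lt abs_le_D1[OF less_imp_le, of "\<theta> y - \<theta> t" "e / 2"] by (intro mult_right_mono) auto
      finally show ?thesis using 2 by simp
    next
      case 3
      have "norm (z y - z t - (y - t) *\<^sub>R dir (\<theta> t)) = norm (z t - z y - (t - y) *\<^sub>R dir (\<theta> t))"
        by (subst norm_minus_cancel[symmetric]) (simp add: algebra_simps)
      also have "\<dots> \<le> 2 * (\<theta> t - \<theta> y) * (t - y)"
        using y t lt 3 pi_gt3 monoD[OF \<theta>_mono, of y t] by (intro chord_direction) auto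
      also have "\<dots> \<le> e * (t - y)" using 3 lt abs_le_D2[OF less_imp_le, of "\<theta> y - \<theta> t" "e / 2"] by (intro mult_right_mono) auto
      finally show ?thesis using 3 by simp
    qed simp
  qed (use d t in auto)
qed

lemma curve_deriv_z: "0 \<le> t \<Longrightarrow> t < L \<Longrightarrow> curve_deriv z t = dir (\<theta> t)"
  unfolding curve_deriv_def by (intro vector_derivative_within z_right_derivative) simp_all

lemma dir_has_vector_derivative: "(dir has_vector_derivative dir (x + pi / 2)) (at x)"
  unfolding dir_def vector2_eq
  by (auto intro!: derivative_eq_intros simp: sin_add cos_add has_real_derivative_iff_has_vector_derivative[symmetric])

lemma curve_deriv2_z:
  assumes t: "0 < t" "t < L" and k: "(\<theta> has_real_derivative k) (at t)"
  shows "curve_deriv2 z t = k *\<^sub>R dir (\<theta> t + pi / 2)"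
proof -
  have "((dir \<circ> \<theta>) has_vector_derivative k *\<^sub>R dir (\<theta> t + pi / 2)) (at t)"
    by (rule vector_diff_chain_at[OF k[unfolded has_real_derivative_iff_has_vector_derivative] dir_has_vector_derivative])
  then have "(curve_deriv z has_vector_derivative k *\<^sub>R dir (\<theta> t + pi / 2)) (at t)"
    by (rule has_vector_derivative_transform_within_open[of _ _ _ "{0<..<L}"]) (use t in \<open>auto simp: curve_deriv_z\<close>)
  then show ?thesis unfolding curve_deriv2_def by (rule vector_derivative_at)
qed

lemma det_curve_derivs:
  assumes t: "0 < t" "t < L" and k: "(\<theta> has_real_derivative k) (at t)"
  shows "det (transpose (vector [curve_deriv z t, curve_deriv2 z t] :: real^2^2)) = k"
proof -
  have "det (vector [a, b] :: real^2^2) = cross2 a b" for a b :: "real^2"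
    by (simp add: det_2 cross2_def)
  then show ?thesis using t by (simp add: det_transpose curve_deriv_z curve_deriv2_z[OF t k] cross2_simps cross2_dir)
qed

text \<open>A limit along the sequence 1 / (n + 1) defines a Borel function on the whole line that
  agrees with \<theta>' wherever the latter exists.\<close>

definition \<kappa> :: "real \<Rightarrow> real" where
  "\<kappa> t = lim (\<lambda>n. (\<theta> (t + 1 / real (Suc n)) - \<theta> t) * real (Suc n))"

lemma \<kappa>_measurable [measurable]: "\<kappa> \<in> borel_measurable borel"
  unfolding \<kappa>_def by measurable

lemma \<kappa>_eq:
  assumes k: "(\<theta> has_real_derivative k) (at t)"
  shows "\<kappa> t = k"
proof -
  have "((\<lambda>h. (\<theta> (t + h) - \<theta> t) / h) \<longlongrightarrow> k) (at 0)" using k by (simp add: DERIV_def)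
  moreover have "filterlim (\<lambda>n. 1 / real (Suc n)) (at 0) sequentially"
    unfolding filterlim_at using LIMSEQ_inverse_real_of_nat by (auto simp: inverse_eq_divide)
  ultimately have "((\<lambda>n. (\<theta> (t + 1 / real (Suc n)) - \<theta> t) / (1 / real (Suc n))) \<longlongrightarrow> k) sequentially"
    by (rule filterlim_compose)
  then show ?thesis unfolding \<kappa>_def by (intro limI) simp
qed

text \<open>A Borel null set containing the points of non-differentiability, chosen once so that the
  sets built from it are Borel.\<close>

definition singular :: "real set" where
  "singular = (SOME N. N \<in> null_sets lborel \<and> (\<forall>t. t \<notin> N \<longrightarrow> \<theta> differentiable (at t)))"

lemma singular: "singular \<in> null_sets lborel" "t \<notin> singular \<Longrightarrow> (\<theta> has_real_derivative \<kappa> t) (at t)"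
proof -
  have "\<exists>N. N \<in> null_sets lborel \<and> (\<forall>t. t \<notin> N \<longrightarrow> \<theta> differentiable (at t))"
    using mono_AE_differentiable[OF \<theta>_mono] by blast
  from someI_ex[OF this] have *: "singular \<in> null_sets lborel" "\<And>t. t \<notin> singular \<Longrightarrow> \<theta> differentiable (at t)"
    unfolding singular_def[symmetric] by auto
  show "singular \<in> null_sets lborel" by (rule *)
  assume "t \<notin> singular"
  then obtain k where "(\<theta> has_real_derivative k) (at t)" using *(2) by (auto simp: real_differentiable_def)
  then show "(\<theta> has_real_derivative \<kappa> t) (at t)" using \<kappa>_eq by simp
qed

lemma singular_measurable [measurable]: "singular \<in> sets borel"
  using singular(1) by auto

definition curved :: "real set" where
  "curved = {t \<in> {0<..<L} - singular. 0 < \<kappa> t}"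

lemma curved_measurable [measurable]: "curved \<in> sets borel"
proof -
  have "curved = {t \<in> space borel. t \<in> {0<..<L} - singular \<and> 0 < \<kappa> t}" by (auto simp: curved_def)
  also have "\<dots> \<in> sets borel" by measurable
  finally show ?thesis .
qed

text \<open>A Borel representative of the density of affine arclength. It is set to 0 off the
  interval, at singular parameters and where the curvature is not positive.\<close>

definition speed :: "real \<Rightarrow> real" where
  "speed t = \<kappa> t powr (1 / 3) * indicator curved t"

lemma speed_measurable [measurable]: "speed \<in> borel_measurable borel"
  unfolding speed_def by measurable

lemma root_det_eq_speed:
  assumes t: "0 < t" "t < L" "t \<notin> singular"
  shows "root 3 (det (transpose (vector [curve_deriv z t, curve_deriv2 z t] :: real^2^2))) = speed t"
proof -
  have k: "(\<theta> has_real_derivative \<kappa> t) (at t)" by (rule singular(2)[OF t(3)])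
  have "0 \<le> \<kappa> t"
  proof (rule ccontr)
    assume "\<not> 0 \<le> \<kappa> t"
    then obtain d where d: "0 < d" "\<And>h. 0 < h \<Longrightarrow> h < d \<Longrightarrow> \<theta> (t + h) < \<theta> t"
      using DERIV_neg_dec_right[OF k] by auto
    have "\<theta> (t + d / 2) < \<theta> t" using d(1) by (intro d(2)) auto
    then show False using d(1) monoD[OF \<theta>_mono, of t "t + d / 2"] by simp
  qed
  then show ?thesis
    unfolding det_curve_derivs[OF t(1,2) k]
    using t by (cases "\<kappa> t = 0") (auto simp: speed_def curved_def root_powr_inverse)
qed

lemma AE_density_eq_speed:
  "AE t in lborel. ennreal (root 3 (det (transpose (vector [curve_deriv z t, curve_deriv2 z t] :: real^2^2)))) * indicator {0..<L} t
     = ennreal (speed t)"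
proof -
  have "AE t in lborel. t \<notin> singular" using AE_not_in[OF singular(1)] .
  moreover have "AE t in lborel. t \<noteq> (0 :: real)" by (rule AE_lborel_singleton)
  ultimately show ?thesis
  proof eventually_elim
    case (elim t)
    then show ?case
      using root_det_eq_speed[of t] by (cases "0 < t \<and> t < L") (auto simp: speed_def curved_def indicator_def)
  qed
qed

lemma emeasure_affine_arclength_on_interval:
  assumes B: "B \<in> sets borel"
  shows "emeasure (affine_arclength_on_interval L z) (B \<inter> {0..<L}) = (\<integral>\<^sup>+t. ennreal (speed t) * indicator B t \<partial>lborel)"
proof -
  let ?h = "\<lambda>t. ennreal (root 3 (det (transpose (vector [curve_deriv z t, curve_deriv2 z t] :: real^2^2))))"
  have AE': "AE t in lebesgue_on {0..<L}. ?h t = ennreal (speed t)"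
  proof (subst AE_restrict_space_iff)
    show "AE t in lebesgue. t \<in> {0..<L} \<longrightarrow> ?h t = ennreal (speed t)"
      using AE_completion[OF AE_density_eq_speed] by eventually_elim auto
  qed simp
  \<comment> \<open>The determinant expression is not known to be measurable at this point.
    Unfolding \<open>density\<close> reduces the equality to integrals, for which agreement almost
    everywhere is enough.\<close>
  have "affine_arclength_on_interval L z = density (lebesgue_on {0..<L}) (\<lambda>t. ennreal (speed t))"
    unfolding affine_arclength_on_interval_def density_def
    by (intro arg_cong[where f = "measure_of _ _"] ext nn_integral_cong_AE eventually_mono[OF AE']) auto
  moreover have "(\<lambda>t. ennreal (speed t)) \<in> borel_measurable (lebesgue_on {0..<L})"
    by (intro measurable_restrict_space1 measurable_completion) measurable
  moreover have "B \<inter> {0..<L} \<in> sets (lebesgue_on {0..<L})" using B by (auto simp: sets_restrict_space)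
  ultimately have "emeasure (affine_arclength_on_interval L z) (B \<inter> {0..<L}) = (\<integral>\<^sup>+t. ennreal (speed t) * indicator (B \<inter> {0..<L}) t \<partial>lebesgue_on {0..<L})"
    by (simp add: emeasure_density)
  also have "\<dots> = (\<integral>\<^sup>+t. ennreal (speed t) * indicator (B \<inter> {0..<L}) t * indicator {0..<L} t \<partial>lborel)"
    by (simp add: nn_integral_restrict_space nn_integral_completion)
  also have "\<dots> = (\<integral>\<^sup>+t. ennreal (speed t) * indicator B t \<partial>lborel)"
    by (intro nn_integral_cong) (auto simp: speed_def curved_def indicator_def)
  finally show ?thesis .
qed

definition arclength_measure :: "(real^2) measure" where
  "arclength_measure = distr (affine_arclength_on_interval L z) (restrict_space borel (frontier K)) z"

lemma sets_arclength_measure: "sets arclength_measure = sets (restrict_space borel (frontier K))"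
  by (simp add: arclength_measure_def)

lemma z_in_frontier: "0 \<le> t \<Longrightarrow> t < L \<Longrightarrow> z t \<in> frontier K"
  using z_bij by (auto simp: bij_betw_def)

lemma emeasure_arclength_measure:
  assumes E: "E \<in> sets borel" "E \<subseteq> frontier K"
  shows "emeasure arclength_measure E = (\<integral>\<^sup>+t. ennreal (speed t) * indicator E (z t) \<partial>lborel)"
proof -
  have sp: "space (affine_arclength_on_interval L z) = {0..<L}"
    by (simp add: affine_arclength_on_interval_def space_restrict_space)
  have m: "z \<in> measurable (affine_arclength_on_interval L z) (restrict_space borel (frontier K))"
  proof (rule measurable_restrict_space2)
    show "z \<in> space (affine_arclength_on_interval L z) \<rightarrow> frontier K"
      using z_in_frontier by (auto simp: sp)
    have "z \<in> borel_measurable lebesgue" by (rule measurable_completion) simp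
    then show "z \<in> borel_measurable (affine_arclength_on_interval L z)"
      unfolding affine_arclength_on_interval_def by (simp add: measurable_restrict_space1)
  qed
  have "E \<in> sets (restrict_space borel (frontier K))" using E by (auto simp: sets_restrict_space)
  then have "emeasure arclength_measure E = emeasure (affine_arclength_on_interval L z) (z -` E \<inter> {0..<L})"
    unfolding arclength_measure_def by (simp add: emeasure_distr[OF m] sp)
  also have "\<dots> = (\<integral>\<^sup>+t. ennreal (speed t) * indicator (z -` E) t \<partial>lborel)"
    using measurable_sets_borel[OF z_measurable E(1)] by (rule emeasure_affine_arclength_on_interval)
  finally show ?thesis by (simp add: indicator_def)
qed

text \<open>Replaces the Lebesgue measurable source by a Borel one. Off [0, L) the map is set to z
  0, so that it takes values in the curve everywhere.\<close>

lemma arclength_measure_eq: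
  "arclength_measure = distr (density lborel (\<lambda>t. ennreal (speed t) * indicator {0..<L} t)) (restrict_space borel (frontier K)) (\<lambda>t. if t \<in> {0..<L} then z t else z 0)"
  (is "_ = distr ?M _ ?z")
proof (rule measure_eqI)
  fix E assume "E \<in> sets arclength_measure"
  then have E: "E \<in> sets (restrict_space borel (frontier K))" by (simp add: arclength_measure_def)
  then obtain B where B: "B \<in> sets borel" "E = frontier K \<inter> B" by (auto simp: sets_restrict_space)
  have E': "E \<in> sets borel" "E \<subseteq> frontier K" using B by (auto simp: frontier_closed borel_closed)
  have zm [measurable]: "?z \<in> borel_measurable borel" by measurable
  have m: "?z \<in> measurable ?M (restrict_space borel (frontier K))"
    using z_in_frontier L_pos by (intro measurable_restrict_space2) auto
  have "emeasure (distr ?M (restrict_space borel (frontier K)) ?z) E = emeasure ?M (?z -` E)"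
    using E by (subst emeasure_distr[OF m]) auto
  also have "\<dots> = (\<integral>\<^sup>+t. ennreal (speed t) * indicator {0..<L} t * indicator (?z -` E) t \<partial>lborel)"
    using measurable_sets_borel[OF zm E'(1)] by (subst emeasure_density) auto
  also have "\<dots> = (\<integral>\<^sup>+t. ennreal (speed t) * indicator E (z t) \<partial>lborel)"
    by (intro nn_integral_cong) (auto simp: indicator_def speed_def curved_def)
  finally show "emeasure arclength_measure E = emeasure (distr ?M (restrict_space borel (frontier K)) ?z) E"
    by (simp add: emeasure_arclength_measure[OF E'])
qed (simp add: arclength_measure_def)

lemma nn_integral_arclength_measure:
  assumes [measurable]: "g \<in> borel_measurable borel"
  shows "(\<integral>\<^sup>+x. g x \<partial>arclength_measure) = (\<integral>\<^sup>+t. ennreal (speed t) * g (z t) \<partial>lborel)"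
proof -
  let ?z = "\<lambda>t. if t \<in> {0..<L} then z t else z 0"
  have m: "?z \<in> measurable (density lborel (\<lambda>t. ennreal (speed t) * indicator {0..<L} t)) (restrict_space borel (frontier K))"
    using z_in_frontier L_pos by (intro measurable_restrict_space2) auto
  have "(\<integral>\<^sup>+x. g x \<partial>arclength_measure) = (\<integral>\<^sup>+t. ennreal (speed t) * indicator {0..<L} t * g (?z t) \<partial>lborel)"
    unfolding arclength_measure_eq
    by (subst nn_integral_distr[OF m]) (auto simp: nn_integral_density measurable_restrict_space1)
  also have "\<dots> = (\<integral>\<^sup>+t. ennreal (speed t) * g (z t) \<partial>lborel)"
    by (intro nn_integral_cong) (auto simp: indicator_def speed_def curved_def)
  finally show ?thesis .
qed

lemma convex_arc_piece:
  "convex_arc z \<theta> \<kappa> {t \<in> curved. a \<le> \<theta> t \<and> \<theta> t \<le> a + 1} a"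
proof
  have "{t \<in> curved. a \<le> \<theta> t \<and> \<theta> t \<le> a + 1} = {t \<in> space borel. t \<in> curved \<and> a \<le> \<theta> t \<and> \<theta> t \<le> a + 1}" by auto
  also have "\<dots> \<in> sets borel" by measurable
  finally show "{t \<in> curved. a \<le> \<theta> t \<and> \<theta> t \<le> a + 1} \<in> sets borel" .
  show "bounded {t \<in> curved. a \<le> \<theta> t \<and> \<theta> t \<le> a + 1}"
    by (rule bounded_subset[OF bounded_closed_interval[of 0 L]]) (auto simp: curved_def)
  fix t assume t: "t \<in> {t \<in> curved. a \<le> \<theta> t \<and> \<theta> t \<le> a + 1}"
  then have t': "0 < t" "t < L" "t \<notin> singular" by (auto simp: curved_def)
  show d: "(\<theta> has_real_derivative \<kappa> t) (at t)" using singular(2) t' by blast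
  show "(z has_vector_derivative dir (\<theta> t)) (at t)"
    using t' d by (intro z_derivative DERIV_isCont) auto
  show "0 < \<kappa> t" "a \<le> \<theta> t \<and> \<theta> t \<le> a + 1" using t by (auto simp: curved_def)
  fix s assume s: "s \<in> {t \<in> curved. a \<le> \<theta> t \<and> \<theta> t \<le> a + 1}" "s < t"
  have "\<theta> t - \<theta> s < pi" using s t pi_gt3 by auto
  then show "\<exists>\<rho> \<phi>. 0 < \<rho> \<and> \<theta> s \<le> \<phi> \<and> \<phi> \<le> \<theta> t \<and> z t - z s = \<rho> *\<^sub>R dir \<phi>"
    using chord[of s t] s t' by (metis (mono_tags, lifting) curved_def greaterThanLessThan_iff less_imp_le mem_Collect_eq Diff_iff)
qed (simp_all add: \<theta>_mono)

theorem restriction_arclength_measure: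
  assumes r: "1 < r" "r < 2" and f: "integrable lborel f"
    and fp: "(\<integral>\<^sup>+x. ennreal (norm (f x) powr (2 * r / (r + 1))) \<partial>lborel) \<le> 1"
  defines "q \<equiv> 2 * r / (3 * (r - 1))"
  shows "(\<integral>\<^sup>+x. ennreal (norm (fourier2 f x) powr q) \<partial>arclength_measure) \<le> ennreal (10 * (1 + extension_const r) powr q)"
proof -
  have [measurable]: "f \<in> borel_measurable borel" using f by auto
  \<comment> \<open>Neighbouring pieces may share parameters with \<theta> t at a common endpoint;
    for an upper bound a cover suffices.\<close>
  define D where "D j = {t \<in> curved. A 0 + real j \<le> \<theta> t \<and> \<theta> t \<le> A 0 + real j + 1}" for j :: nat
  interpret arc: convex_arc z \<theta> \<kappa> "D j" "A 0 + real j" for j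
    unfolding D_def by (rule convex_arc_piece)
  let ?g = "\<lambda>t. ennreal (norm (fourier2 f (z t)) powr q * \<kappa> t powr (1 / 3))"
  have cover: "\<exists>j<10. t \<in> D j" if "t \<in> curved" for t
  proof -
    have r: "A 0 \<le> \<theta> t" "\<theta> t < A 0 + 10" using that \<theta>_range[of t] by (auto simp: curved_def)
    define j where "j = nat \<lfloor>\<theta> t - A 0\<rfloor>"
    have "real j \<le> \<theta> t - A 0" "\<theta> t - A 0 < real j + 1" unfolding j_def using r by linarith+
    then show ?thesis using r that by (intro exI[of _ j]) (auto simp: D_def)
  qed
  have "(\<integral>\<^sup>+x. ennreal (norm (fourier2 f x) powr q) \<partial>arclength_measure) = (\<integral>\<^sup>+t. ennreal (speed t) * ennreal (norm (fourier2 f (z t)) powr q) \<partial>lborel)"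
    by (rule nn_integral_arclength_measure) measurable
  also have "\<dots> \<le> (\<integral>\<^sup>+t. (\<Sum>j<10. ?g t * indicator (D j) t) \<partial>lborel)"
  proof (rule nn_integral_mono)
    fix t
    show "ennreal (speed t) * ennreal (norm (fourier2 f (z t)) powr q) \<le> (\<Sum>j<10. ?g t * indicator (D j) t)"
    proof (cases "t \<in> curved")
      case True
      then obtain j where j: "j < 10" "t \<in> D j" using cover by blast
      have "ennreal (speed t) * ennreal (norm (fourier2 f (z t)) powr q) = ?g t * indicator (D j) t"
        using True j by (simp add: speed_def ennreal_mult' mult.commute)
      also have "\<dots> \<le> (\<Sum>j<10. ?g t * indicator (D j) t)" using j by (intro member_le_sum) auto
      finally show ?thesis .
    qed (simp add: speed_def)
  qed
  also have "\<dots> = (\<Sum>j<10. (\<integral>\<^sup>+t. ?g t * indicator (D j) t \<partial>lborel))"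
    using arc.D(1) by (intro nn_integral_sum) measurable
  also have "\<dots> \<le> (\<Sum>j<(10::nat). ennreal ((1 + extension_const r) powr q))"
    unfolding q_def by (intro sum_mono arc.restriction_estimate[OF r f fp])
  also have "\<dots> = ennreal (10 * (1 + extension_const r) powr q)" by (simp add: ennreal_mult')
  finally show ?thesis .
qed

end

section \<open>Locality of affine arclength\<close>

lemma has_vector_derivative_shift:
  fixes f g :: "real \<Rightarrow> 'a::real_normed_vector"
  assumes e: "0 < e" and eq: "\<And>h. \<bar>h\<bar> < e \<Longrightarrow> g (y + h) = f (x + h)"
    and f: "(f has_vector_derivative v) (at x within (+) x ` S)"
  shows "(g has_vector_derivative v) (at y within (+) y ` S)"
  unfolding has_vector_derivative_def has_derivative_within_alt
proof (intro conjI allI impI)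
  show "bounded_linear (\<lambda>h. h *\<^sub>R v)" by (rule bounded_linear_scaleR_left)
  fix r :: real assume "0 < r"
  then obtain d where d: "0 < d"
    "\<And>t. t \<in> (+) x ` S \<Longrightarrow> norm (t - x) < d \<Longrightarrow> norm (f t - f x - (t - x) *\<^sub>R v) \<le> r * norm (t - x)"
    using f unfolding has_vector_derivative_def has_derivative_within_alt by blast
  show "\<exists>d>0. \<forall>t\<in>(+) y ` S. norm (t - y) < d \<longrightarrow> norm (g t - g y - (t - y) *\<^sub>R v) \<le> r * norm (t - y)"
  proof (intro exI[of _ "min d e"] conjI ballI impI)
    fix t assume "t \<in> (+) y ` S" and t: "norm (t - y) < min d e"
    then obtain s where s: "s \<in> S" "t = y + s" by blast
    have "g t = f (x + s)" "g y = f x" using eq[of s] eq[of 0] s t e by auto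
    then show "norm (g t - g y - (t - y) *\<^sub>R v) \<le> r * norm (t - y)"
      using d(2)[of "x + s"] s t by auto
  qed (use d e in simp)
qed

text \<open>The two functions have the same set of derivatives, so the choice made by
  \<open>vector_derivative\<close> agrees even where there is no derivative.\<close>

lemma vector_derivative_shift:
  fixes f g :: "real \<Rightarrow> 'a::real_normed_vector"
  assumes e: "0 < e" and eq: "\<And>h. \<bar>h\<bar> < e \<Longrightarrow> f (x + h) = g (y + h)"
  shows "vector_derivative f (at x within (+) x ` S) = vector_derivative g (at y within (+) y ` S)"
proof -
  have "(f has_vector_derivative v) (at x within (+) x ` S) \<longleftrightarrow> (g has_vector_derivative v) (at y within (+) y ` S)" for v
    using has_vector_derivative_shift[OF e, of g y f x v S] has_vector_derivative_shift[OF e, of f x g y v S] eq by metis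
  then show ?thesis by (simp add: vector_derivative_def)
qed

lemma curve_deriv_shift:
  assumes e: "0 < e" and eq: "\<And>h. \<bar>h\<bar> < e \<Longrightarrow> z (x + h) = z' (y + h)" and h: "\<bar>h\<bar> < e"
  shows "curve_deriv z (x + h) = curve_deriv z' (y + h)"
proof -
  have img: "(+) t ` {0<..} = {t<..}" for t :: real
    by (auto simp: image_iff intro!: bexI[of _ "x - t" for x])
  have "z (x + h + k) = z' (y + h + k)" if "\<bar>k\<bar> < e - \<bar>h\<bar>" for k
    using eq[of "h + k"] that by (simp add: add.assoc)
  from vector_derivative_shift[where e = "e - \<bar>h\<bar>" and S = "{0<..}" and f = z and g = z' and x = "x + h" and y = "y + h", OF _ this] h show ?thesis
    unfolding curve_deriv_def img by simp
qed

lemma curve_deriv2_shift: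
  assumes e: "0 < e" and eq: "\<And>h. \<bar>h\<bar> < e \<Longrightarrow> z (x + h) = z' (y + h)" and h: "\<bar>h\<bar> < e"
  shows "curve_deriv2 z (x + h) = curve_deriv2 z' (y + h)"
proof -
  have "curve_deriv z (x + h + k) = curve_deriv z' (y + h + k)" if "\<bar>k\<bar> < e - \<bar>h\<bar>" for k
    using curve_deriv_shift[where z = z and z' = z' and x = x and y = y, OF e eq, of "h + k"] that by (simp add: add.assoc)
  from vector_derivative_shift[where e = "e - \<bar>h\<bar>" and S = UNIV and f = "curve_deriv z" and g = "curve_deriv z'" and x = "x + h" and y = "y + h", OF _ this] h show ?thesis
    unfolding curve_deriv2_def by simp
qed

section \<open>Comparison of two parametrizations\<close>

context convex_param
begin

lemma A_image: "0 \<le> a \<Longrightarrow> a \<le> b \<Longrightarrow> b \<le> L \<Longrightarrow> A ` {a..b} = {A a..A b}"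
proof -
  assume ab: "0 \<le> a" "a \<le> b" "b \<le> L"
  have "y \<in> A ` {a..b}" if "A a \<le> y" "y \<le> A b" for y
    using IVT'[OF that ab(2) continuous_on_subset[OF A_continuous]] by auto
  then show ?thesis by (auto intro: monoD[OF A_mono])
qed

text \<open>Both sides are the length of the same piece of the curve, once parametrized by z and
  once by the radial angle.\<close>

lemma arclen_A:
  assumes ab: "0 \<le> a" "a \<le> b" "b \<le> L"
  shows "arclen (A b) - arclen (A a) = b - a"
proof -
  have "curve_length z a b = curve_length bdry (A a) (A b)"
    using ab by (intro curve_length_reparam A_image) (auto intro: monoD[OF A_mono] z_eq)
  moreover have le: "A a \<le> A b" using ab by (intro monoD[OF A_mono])
  ultimately have "ennreal (b - a) = ennreal (arclen (A b) - arclen (A a))"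
    using z_length[OF ab] arclen_diff(1)[OF le] by simp
  then show ?thesis using ab arclen_diff(2)[OF le] by (subst (asm) ennreal_inj) auto
qed

text \<open>The lifted angle is determined up to full turns only; this freedom lets the angles of
  two parametrizations be matched at a common point.\<close>

lemma shift_angle: "convex_param K c L z (\<lambda>t. A t + 2 * pi * of_int n)"
proof
  show "continuous_on UNIV (\<lambda>t. A t + 2 * pi * of_int n)" by (intro continuous_intros A_continuous)
  show "mono (\<lambda>t. A t + 2 * pi * of_int n)" using A_mono by (auto simp: mono_def)
  have "dir (A t + 2 * pi * of_int n) = dir (A t)" for t unfolding dir_eq_iff by blast
  then show "z t = bdry (A t + 2 * pi * of_int n)" if "0 \<le> t" "t \<le> L" for t
    using z_eq[OF that] by (simp add: bdry_eq_iff)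
qed (use L_pos z_continuous z_bij z_length A_less A_L in auto)

lemma emeasure_diff_finite:
  assumes E: "E \<in> sets borel" "E \<subseteq> frontier K" and P: "finite P"
  shows "emeasure arclength_measure (E - P) = emeasure arclength_measure E"
proof -
  have "finite {t \<in> {0..<L}. z t \<in> P}"
    using finite_vimage_IntI[OF P bij_betw_imp_inj_on[OF z_bij]] by (rule finite_subset[rotated]) auto
  then have "{t \<in> {0..<L}. z t \<in> P} \<in> null_sets lborel" by (rule finite_imp_null_set_lborel)
  then have "AE t in lborel. t \<notin> {t \<in> {0..<L}. z t \<in> P}" by (rule AE_not_in)
  then have "AE t in lborel. ennreal (speed t) * indicator (E - P) (z t) = ennreal (speed t) * indicator E (z t)"
    by eventually_elim (auto simp: indicator_def speed_def curved_def)
  moreover have "E - P \<in> sets borel" using E(1) P by (auto intro: finite_imp_closed borel_closed)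
  ultimately show ?thesis
    using E by (subst (1 2) emeasure_arclength_measure) (auto intro: nn_integral_cong_AE)
qed

text \<open>The removed image comes from a compact set, so its complement will be a neighbourhood of
  z t0. The parameters 0 and L share a point, hence t0 must be interior.\<close>

lemma z_not_far:
  assumes t0: "0 < t0" "t0 < L" and e: "0 < e"
  shows "z t0 \<notin> z ` ({0..L} - {t0 - e<..<t0 + e})"
proof
  assume "z t0 \<in> z ` ({0..L} - {t0 - e<..<t0 + e})"
  then obtain t where t: "0 \<le> t" "t \<le> L" "t \<noteq> t0" "z t = z t0" using e by force
  have "bdry (A t) = bdry (A t0)" using t t0 z_eq[of t] z_eq[of t0] by simp
  moreover have "A t < A t0 + 2 * pi" "A t0 < A t + 2 * pi"
    using A_L monoD[OF A_mono, of t L] A_less[of 0 t0] A_less[of t0 L] monoD[OF A_mono, of 0 t] t t0 by auto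
  moreover have "A t < A t0 \<or> A t0 < A t" using A_less[of t t0] A_less[of t0 t] t t0 by (cases "t < t0") auto
  ultimately show False using bdry_inj[of "A t" "A t0"] bdry_inj[of "A t0" "A t"] by auto
qed

lemma emeasure_near:
  assumes F: "F \<in> sets borel" "F \<subseteq> frontier K" "F \<inter> z ` ({0..L} - {t0 - e<..<t0 + e}) = {}"
    and e: "0 < e" "e \<le> t0" "e \<le> L - t0"
  shows "emeasure arclength_measure F =
    (\<integral>\<^sup>+h. ennreal (speed (t0 + h)) * indicator F (z (t0 + h)) * indicator {-e<..<e} h \<partial>lborel)"
proof -
  have [measurable]: "F \<in> sets borel" by fact
  have "emeasure arclength_measure F = (\<integral>\<^sup>+t. ennreal (speed t) * indicator F (z t) * indicator {t0 - e<..<t0 + e} t \<partial>lborel)"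
    unfolding emeasure_arclength_measure[OF F(1,2)]
    by (intro nn_integral_cong) (use F(3) in \<open>force simp: indicator_def speed_def curved_def\<close>)
  also have "\<dots> = (\<integral>\<^sup>+h. ennreal (speed (t0 + 1 * h)) * indicator F (z (t0 + 1 * h)) * indicator {t0 - e<..<t0 + e} (t0 + 1 * h) \<partial>lborel)"
    by (subst nn_integral_real_affine[where c = 1 and t = t0]) (simp_all, measurable)
  also have "\<dots> = (\<integral>\<^sup>+h. ennreal (speed (t0 + h)) * indicator F (z (t0 + h)) * indicator {-e<..<e} h \<partial>lborel)"
    by (intro nn_integral_cong) (auto simp: indicator_def)
  finally show ?thesis .
qed

end

text \<open>Two convex bodies with a common interior point that agree inside \<open>Q\<close>; their boundary
  curves have a common radial parametrization there.\<close>

locale convex_param_pair =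
  P1: convex_param K1 c L1 z1 A1 + P2: convex_param K2 c L2 z2 A2
  for c K1 L1 z1 A1 K2 L2 z2 A2 +
  fixes Q :: "(real^2) set"
  assumes Q_open: "open Q" and agree: "K1 \<inter> Q = K2 \<inter> Q"
begin

lemma frontier_agree: "frontier K1 \<inter> Q = frontier K2 \<inter> Q"
proof -
  have "closure K \<inter> Q = closure (K \<inter> Q) \<inter> Q" for K
    using open_Int_closure_subset[OF Q_open, of K] closure_mono[of "K \<inter> Q" K] by (auto simp: Int_commute)
  then have "closure K1 \<inter> Q = closure K2 \<inter> Q" using agree by metis
  then show ?thesis using agree by (auto simp: frontier_def)
qed

lemma bdry_agree:
  assumes "P1.bdry \<alpha> \<in> Q"
  shows "P2.bdry \<alpha> = P1.bdry \<alpha>"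
proof -
  have "c + P1.rad \<alpha> *\<^sub>R dir \<alpha> \<in> frontier K2"
    using assms P1.rad(2)[of \<alpha>] frontier_agree by (auto simp: P1.bdry_def)
  then have "P1.rad \<alpha> = P2.rad \<alpha>" using P1.rad(1)[of \<alpha>] by (intro P2.rad_unique) auto
  then show ?thesis by (simp add: P1.bdry_def P2.bdry_def)
qed

text \<open>Inside Q the two radial parametrizations coincide, so the arclength increments from the
  common angle \<alpha> coincide as well. Both angles after a parameter step h have increment h,
  hence are equal by strict monotonicity.\<close>

lemma local_shift_aux:
  assumes t1: "0 < t1" "t1 < L1" and t2: "0 < t2" "t2 < L2" and eq: "A1 t1 = A2 t2" and Q: "z1 t1 \<in> Q"
  shows "\<exists>e>0. e \<le> t1 \<and> e \<le> L1 - t1 \<and> e \<le> t2 \<and> e \<le> L2 - t2 \<and> (\<forall>h. \<bar>h\<bar> < e \<longrightarrow> z1 (t1 + h) = z2 (t2 + h))"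
proof -
  define \<alpha> where "\<alpha> = A1 t1"
  have zt: "z1 t1 = P1.bdry \<alpha>" using P1.z_eq[of t1] t1 by (simp add: \<alpha>_def)
  have "open (P1.bdry -` Q)" by (rule open_vimage[OF Q_open P1.continuous_on_bdry])
  then obtain d where d: "0 < d" "ball \<alpha> d \<subseteq> P1.bdry -` Q"
    using Q zt openE[of "P1.bdry -` Q" \<alpha>] by (metis vimageI)
  have near: "P1.bdry \<beta> \<in> Q" if "\<bar>\<beta> - \<alpha>\<bar> < d" for \<beta>
    using d(2) that by (auto simp: dist_real_def abs_minus_commute subset_iff)
  have "isCont A1 t1" "isCont A2 t2"
    using P1.A_continuous P2.A_continuous by (auto simp: continuous_on_eq_continuous_at)
  then obtain e1 e2 where e1: "0 < e1" "\<And>t. \<bar>t - t1\<bar> < e1 \<Longrightarrow> \<bar>A1 t - A1 t1\<bar> < d"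
    and e2: "0 < e2" "\<And>t. \<bar>t - t2\<bar> < e2 \<Longrightarrow> \<bar>A2 t - A2 t2\<bar> < d"
    using d(1) unfolding continuous_at_eps_delta dist_real_def by metis
  have arc: "P1.arclen b - P1.arclen a = P2.arclen b - P2.arclen a"
    if ab: "a \<le> b" "\<bar>a - \<alpha>\<bar> < d" "\<bar>b - \<alpha>\<bar> < d" for a b
  proof -
    have "curve_length P1.bdry a b = curve_length P2.bdry a b"
    proof (rule curve_length_reparam[where W = "\<lambda>x. x"])
      fix t assume "t \<in> {a..b}"
      then have "\<bar>t - \<alpha>\<bar> < d" using ab by auto
      then show "P1.bdry t = P2.bdry t" using bdry_agree near by metis
    qed auto
    then show ?thesis
      using P1.arclen_diff[OF ab(1)] P2.arclen_diff[OF ab(1)] by (metis ennreal_inj)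
  qed
  have step1: "P1.arclen (A1 (t1 + h)) - P1.arclen \<alpha> = h" if "0 \<le> t1 + h" "t1 + h \<le> L1" for h
    using P1.arclen_A[of t1 "t1 + h"] P1.arclen_A[of "t1 + h" t1] that t1 by (cases "0 \<le> h") (auto simp: \<alpha>_def)
  have step2: "P2.arclen (A2 (t2 + h)) - P2.arclen \<alpha> = h" if "0 \<le> t2 + h" "t2 + h \<le> L2" for h
    using P2.arclen_A[of t2 "t2 + h"] P2.arclen_A[of "t2 + h" t2] that t2 by (cases "0 \<le> h") (auto simp: \<alpha>_def eq)
  define e where "e = Min {e1, e2, t1, L1 - t1, t2, L2 - t2}"
  have e: "0 < e" "e \<le> e1" "e \<le> e2" "e \<le> t1" "e \<le> L1 - t1" "e \<le> t2" "e \<le> L2 - t2"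
    using e1 e2 t1 t2 by (auto simp: e_def)
  have "z1 (t1 + h) = z2 (t2 + h)" if h: "\<bar>h\<bar> < e" for h
  proof -
    have x: "\<bar>A1 (t1 + h) - \<alpha>\<bar> < d" using e1(2)[of "t1 + h"] h e by (simp add: \<alpha>_def)
    have "P2.arclen (A1 (t1 + h)) - P2.arclen \<alpha> = P1.arclen (A1 (t1 + h)) - P1.arclen \<alpha>"
      using arc[of \<alpha> "A1 (t1 + h)"] arc[of "A1 (t1 + h)" \<alpha>] x d by (cases "\<alpha> \<le> A1 (t1 + h)") auto
    also have "\<dots> = P2.arclen (A2 (t2 + h)) - P2.arclen \<alpha>"
      using step1[of h] step2[of h] h e by auto
    finally have "A1 (t1 + h) = A2 (t2 + h)"
      using strict_mono_eq[OF P2.strict_mono_arclen] by auto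
    moreover have "P2.bdry (A1 (t1 + h)) = P1.bdry (A1 (t1 + h))" by (rule bdry_agree[OF near[OF x]])
    ultimately show ?thesis using P1.z_eq[of "t1 + h"] P2.z_eq[of "t2 + h"] h e by auto
  qed
  then show ?thesis using e by blast
qed

text \<open>Equal points give angles that differ by a full number of turns, which
  \<open>shift_angle\<close> absorbs.\<close>

lemma local_shift:
  assumes t1: "0 < t1" "t1 < L1" and t2: "0 < t2" "t2 < L2" and eq: "z1 t1 = z2 t2" and Q: "z1 t1 \<in> Q"
  obtains e where "0 < e" "e \<le> t1" "e \<le> L1 - t1" "e \<le> t2" "e \<le> L2 - t2"
    "\<And>h. \<bar>h\<bar> < e \<Longrightarrow> z1 (t1 + h) = z2 (t2 + h)"
proof -
  have "P1.bdry (A1 t1) \<in> Q" using Q P1.z_eq[of t1] t1 by simp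
  then have "P2.bdry (A1 t1) = P2.bdry (A2 t2)"
    using bdry_agree P1.z_eq[of t1] P2.z_eq[of t2] eq t1 t2 by simp
  then obtain n :: int where n: "A1 t1 = A2 t2 + 2 * pi * n" by (auto simp: P2.bdry_eq_iff dir_eq_iff)
  interpret S: convex_param K2 c L2 z2 "\<lambda>t. A2 t + 2 * pi * n" by (rule P2.shift_angle)
  interpret S: convex_param_pair c K1 L1 z1 A1 K2 L2 z2 "\<lambda>t. A2 t + 2 * pi * n" Q
    by unfold_locales (rule Q_open agree)+
  show ?thesis using S.local_shift_aux[OF t1 t2 n Q] that by blast
qed

lemma emeasure_agree_near:
  assumes t1: "0 < t1" "t1 < L1" and t2: "0 < t2" "t2 < L2" and eq: "z1 t1 = z2 t2" and Q: "z1 t1 \<in> Q"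
  shows "\<exists>U. open U \<and> z1 t1 \<in> U \<and> (\<forall>F. F \<in> sets borel \<longrightarrow> F \<subseteq> U \<inter> frontier K1 \<inter> Q \<longrightarrow>
    emeasure P1.arclength_measure F = emeasure P2.arclength_measure F)"
proof -
  obtain e where e: "0 < e" "e \<le> t1" "e \<le> L1 - t1" "e \<le> t2" "e \<le> L2 - t2"
    and zz: "\<And>h. \<bar>h\<bar> < e \<Longrightarrow> z1 (t1 + h) = z2 (t2 + h)"
    using local_shift[OF t1 t2 eq Q] by blast
  \<comment> \<open>The parts of the two curves away from the parameters in question. Both are
    compact, and outside them only parameters within e contribute to the measures.\<close>
  define C1 where "C1 = z1 ` ({0..L1} - {t1 - e<..<t1 + e})"
  define C2 where "C2 = z2 ` ({0..L2} - {t2 - e<..<t2 + e})"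
  have "closed C1" "closed C2" unfolding C1_def C2_def
    by (intro compact_imp_closed compact_continuous_image continuous_on_subset[OF P1.z_continuous]
        continuous_on_subset[OF P2.z_continuous] compact_diff; simp)+
  then have op: "open (- C1 \<inter> - C2)" by (intro open_Int) auto
  have zU: "z1 t1 \<in> - C1 \<inter> - C2"
    using P1.z_not_far[OF t1 e(1)] P2.z_not_far[OF t2 e(1)] eq by (auto simp: C1_def C2_def)
  have "emeasure P1.arclength_measure F = emeasure P2.arclength_measure F"
    if F: "F \<in> sets borel" "F \<subseteq> (- C1 \<inter> - C2) \<inter> frontier K1 \<inter> Q" for F
  proof -
    have F1: "F \<subseteq> frontier K1" "F \<inter> C1 = {}" and F2: "F \<subseteq> frontier K2" "F \<inter> C2 = {}"
      using F(2) frontier_agree by auto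
    have "AE h in lborel. t1 + 1 * h \<notin> P1.singular" "AE h in lborel. t2 + 1 * h \<notin> P2.singular"
      by (rule AE_borel_affine; simp add: AE_not_in P1.singular P2.singular)+
    then have "AE h in lborel. ennreal (P1.speed (t1 + h)) * indicator F (z1 (t1 + h)) * indicator {-e<..<e} h
        = ennreal (P2.speed (t2 + h)) * indicator F (z2 (t2 + h)) * indicator {-e<..<e} h"
    proof eventually_elim
      case (elim h)
      show ?case
      proof (cases "\<bar>h\<bar> < e")
        case True
        have "P1.speed (t1 + h) = P2.speed (t2 + h)"
          using P1.root_det_eq_speed[of "t1 + h"] P2.root_det_eq_speed[of "t2 + h"] elim True e
            curve_deriv_shift[where z = z1 and z' = z2 and x = t1 and y = t2, OF e(1) zz True]
            curve_deriv2_shift[where z = z1 and z' = z2 and x = t1 and y = t2, OF e(1) zz True] by simp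
        then show ?thesis using zz[OF True] by simp
      qed (auto simp: indicator_def abs_less_iff)
    qed
    then show ?thesis
      using P1.emeasure_near[OF F(1) F1(1) _ e(1-3)] P2.emeasure_near[OF F(1) F2(1) _ e(1,4,5)] F1(2) F2(2)
      unfolding C1_def C2_def by (simp cong: nn_integral_cong_AE)
  qed
  then show ?thesis using op zU by blast
qed

text \<open>Local agreement becomes global by a countable subcover made disjoint. The base points z1
  0 and z2 0 are removed first because the local comparison needs interior parameters; they have
  measure 0.\<close>

lemma emeasure_agree:
  assumes E: "E \<in> sets borel" "E \<subseteq> frontier K1 \<inter> Q"
  shows "emeasure P1.arclength_measure E = emeasure P2.arclength_measure E"
proof -
  define E0 where "E0 = E - {z1 0, z2 0}"
  have "{z1 0, z2 0} \<in> sets borel" by (intro borel_closed finite_imp_closed) simp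
  then have E0: "E0 \<in> sets borel" "E0 \<subseteq> frontier K1 \<inter> Q"
    unfolding E0_def using E by blast+
  define \<U> where "\<U> = {U. open U \<and> (\<forall>F. F \<in> sets borel \<longrightarrow> F \<subseteq> U \<inter> frontier K1 \<inter> Q \<longrightarrow>
    emeasure P1.arclength_measure F = emeasure P2.arclength_measure F)}"
  have cover: "E0 \<subseteq> \<Union>\<U>"
  proof
    fix p assume p: "p \<in> E0"
    then have "p \<in> frontier K1" "p \<in> frontier K2" "p \<in> Q" using E0 frontier_agree by auto
    then have "p \<in> z1 ` {0..<L1}" "p \<in> z2 ` {0..<L2}"
      using bij_betw_imp_surj_on[OF P1.z_bij] bij_betw_imp_surj_on[OF P2.z_bij] by simp_all
    then obtain t1 t2 where t: "0 \<le> t1" "t1 < L1" "p = z1 t1" "0 \<le> t2" "t2 < L2" "p = z2 t2" by auto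
    have "t1 \<noteq> 0" "t2 \<noteq> 0" using p t by (auto simp: E0_def)
    then have t': "0 < t1" "0 < t2" "z1 t1 = z2 t2" "z1 t1 \<in> Q" using t \<open>p \<in> Q\<close> by auto
    show "p \<in> \<Union>\<U>"
      using emeasure_agree_near[OF t'(1) t(2) t'(2) t(5) t'(3,4)] unfolding \<U>_def t(3) Union_iff Bex_def mem_Collect_eq by blast
  qed
  obtain \<V> where V: "\<V> \<subseteq> \<U>" "countable \<V>" "\<Union>\<V> = \<Union>\<U>"
    using Lindelof[of \<U>] by (auto simp: \<U>_def)
  have "{} \<in> \<U>" by (auto simp: \<U>_def)
  define B where "B = from_nat_into (insert {} \<V>)"
  have B: "range B = insert {} \<V>" unfolding B_def by (rule range_from_nat_into) (use V in auto)
  have BU: "B i \<in> \<U>" for i using B V(1) \<open>{} \<in> \<U>\<close> by (metis insert_subset range_subsetD)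
  have Bo: "B i \<in> sets borel" for i using BU[of i] by (auto simp: \<U>_def)
  define G where "G i = E0 \<inter> disjointed B i" for i
  have G: "G i \<in> sets borel" "G i \<subseteq> frontier K1 \<inter> Q" "G i \<subseteq> B i" for i
  proof -
    have "range B \<subseteq> sets borel" using Bo by blast
    then have "disjointed B i \<in> sets borel" using sets.range_disjointed_sets by blast
    then show "G i \<in> sets borel" unfolding G_def by (intro sets.Int E0)
    show "G i \<subseteq> frontier K1 \<inter> Q" "G i \<subseteq> B i" using E0(2) disjointed_subset[of B i] by (auto simp: G_def)
  qed
  have "(\<Union>i. G i) = E0 \<inter> \<Union>(range B)" unfolding G_def Int_UN_distrib[symmetric] UN_disjointed_eq ..
  also have "\<dots> = E0" using cover V(3) B by auto
  finally have "(\<Union>i. G i) = E0" .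
  moreover have "disjoint_family G"
    using disjoint_family_disjointed[of B] unfolding G_def disjoint_family_on_def by blast
  moreover have "range G \<subseteq> sets P1.arclength_measure" "range G \<subseteq> sets P2.arclength_measure"
    unfolding P1.sets_arclength_measure P2.sets_arclength_measure sets_restrict_space
    using G(1,2) frontier_agree by blast+
  moreover have "emeasure P1.arclength_measure (G i) = emeasure P2.arclength_measure (G i)" for i
    using BU[of i] G[of i] unfolding \<U>_def mem_Collect_eq by blast
  ultimately have "emeasure P1.arclength_measure E0 = emeasure P2.arclength_measure E0"
    using suminf_emeasure[of G P1.arclength_measure] suminf_emeasure[of G P2.arclength_measure] by simp
  show ?thesis
  proof -
    have "E \<subseteq> frontier K1" "E \<subseteq> frontier K2" using E(2) frontier_agree by auto
    then show ?thesis
      using P1.emeasure_diff_finite[OF E(1), of "{z1 0, z2 0}"] P2.emeasure_diff_finite[OF E(1), of "{z1 0, z2 0}"]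
        \<open>emeasure P1.arclength_measure E0 = emeasure P2.arclength_measure E0\<close> by (simp add: E0_def)
  qed
qed

end

section \<open>Unbounded curves\<close>

text \<open>A simple function below g involves finitely many sets, so its integral is controlled by
  a limit of finite sums, each below the integral of g over N n. The inequality with l is chosen to
  suit \<open>measure_of\<close>, whose value on a set is either the prescribed one or 0.\<close>

lemma nn_integral_le_of_setwise_limit:
  fixes g :: "'a \<Rightarrow> ennreal"
  assumes fin: "\<And>x. g x < \<infinity>"
    and lim: "\<And>E. E \<in> sets M \<Longrightarrow> \<exists>l. emeasure M E \<le> l \<and> (\<lambda>n. emeasure (N n) (E \<inter> B n)) \<longlonglongrightarrow> l"
    and sets: "\<forall>\<^sub>F n in sequentially. \<forall>E\<in>sets M. E \<inter> B n \<in> sets (N n)"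
    and bound: "\<forall>\<^sub>F n in sequentially. (\<integral>\<^sup>+x. g x \<partial>N n) \<le> C"
  shows "(\<integral>\<^sup>+x. g x \<partial>M) \<le> C"
  unfolding nn_integral_def
proof (rule SUP_least, clarify)
  fix s assume s: "simple_function M s" "s \<le> g"
  let ?S = "s ` space M" and ?E = "\<lambda>x. s -` {x} \<inter> space M"
  have E: "?E x \<in> sets M" for x by (rule simple_functionD(2)[OF s(1)])
  have S: "finite ?S" by (rule simple_functionD(1)[OF s(1)])
  obtain l where l: "\<And>x. emeasure M (?E x) \<le> l x" "\<And>x. (\<lambda>n. emeasure (N n) (?E x \<inter> B n)) \<longlonglongrightarrow> l x"
    using lim[OF E] by metis
  have x_fin: "x < \<infinity>" if "x \<in> ?S" for x
    using that le_funD[OF s(2)] fin by (auto intro: le_less_trans)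
  have "integral\<^sup>S M s \<le> (\<Sum>x\<in>?S. x * l x)"
    unfolding simple_integral_def by (intro sum_mono mult_left_mono l) simp
  also have "\<dots> \<le> C"
  proof (rule tendsto_upperbound)
    show "(\<lambda>n. \<Sum>x\<in>?S. x * emeasure (N n) (?E x \<inter> B n)) \<longlonglongrightarrow> (\<Sum>x\<in>?S. x * l x)"
      using x_fin by (intro tendsto_sum ennreal_tendsto_cmult l) auto
    show "\<forall>\<^sub>F n in sequentially. (\<Sum>x\<in>?S. x * emeasure (N n) (?E x \<inter> B n)) \<le> C"
      using sets bound
    proof eventually_elim
      case (elim n)
      then have En: "?E x \<inter> B n \<in> sets (N n)" for x using E by blast
      have "(\<Sum>x\<in>?S. x * emeasure (N n) (?E x \<inter> B n)) = (\<Sum>x\<in>?S. \<integral>\<^sup>+y. x * indicator (?E x \<inter> B n) y \<partial>N n)"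
        by (intro sum.cong refl nn_integral_cmult_indicator[symmetric] En)
      also have "\<dots> = (\<integral>\<^sup>+y. (\<Sum>x\<in>?S. x * indicator (?E x \<inter> B n) y) \<partial>N n)"
        by (intro nn_integral_sum[symmetric] borel_measurable_times_ennreal borel_measurable_const borel_measurable_indicator En)
      also have "\<dots> \<le> (\<integral>\<^sup>+y. g y \<partial>N n)"
      proof (rule nn_integral_mono)
        fix y
        have "(\<Sum>x\<in>?S. x * indicator (?E x \<inter> B n) y) = (\<Sum>x\<in>?S. if x = s y then s y * indicator (space M \<inter> B n) y else 0)"
          by (intro sum.cong refl) (auto simp: indicator_def)
        also have "\<dots> \<le> s y" using S by (simp add: sum.delta indicator_def)
        also have "\<dots> \<le> g y" by (rule le_funD[OF s(2)])
        finally show "(\<Sum>x\<in>?S. x * indicator (?E x \<inter> B n) y) \<le> g y" .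
      qed
      finally show ?case using elim by simp
    qed
  qed simp
  finally show "integral\<^sup>S M s \<le> C" .
qed

lemma (in convex_body) compact_affine_arclength_eq:
  obtains L z A where "convex_param K c L z A"
    "compact_affine_arclength (frontier K) = convex_param.arclength_measure K L z"
proof -
  let ?P = "\<lambda>(L, z). ccw_arclength_param (frontier K) L z"
  obtain L z where Lz: "Eps ?P = (L, z)" by (cases "Eps ?P")
  have "\<exists>p. ?P p" using ccw_arclength_param_exists by auto
  then have "?P (Eps ?P)" by (rule someI_ex)
  then have p: "ccw_arclength_param (frontier K) L z" by (simp add: Lz)
  obtain A where A: "convex_param K c L z A" by (rule convex_param_exists[OF p])
  have "compact_affine_arclength (frontier K) = convex_param.arclength_measure K L z"
    unfolding compact_affine_arclength_def Lz convex_param.arclength_measure_def[OF A] by simp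
  with A show ?thesis by (rule that)
qed

definition square :: "nat \<Rightarrow> (real^2) set" where
  "square N = box (vec (- real N)) (vec (real N))"

lemma open_square: "open (square N)"
  by (simp add: square_def open_box)

lemma square_mono: "M \<le> N \<Longrightarrow> square M \<subseteq> square N"
  unfolding square_def by (intro subset_box_imp) (auto simp: Basis_vec_def inner_axis)

lemma mem_square:
  assumes "norm p < real N"
  shows "p \<in> square N"
proof -
  have "\<bar>p $ i\<bar> < real N" for i using component_le_norm_cart[of p i] assms by linarith
  then have "- real N < p $ i" "p $ i < real N" for i by (auto simp: abs_less_iff minus_less_iff)
  then show ?thesis by (simp add: square_def mem_box_cart)
qed

text \<open>A convex set with nonempty interior has the same closure as its interior. The truncation
  by a closed square can therefore be replaced by an open convex set, as \<open>convex_body\<close>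
  requires.\<close>

lemma truncated_curve_eq:
  assumes K: "open K" "convex K" and ne: "K \<inter> square N \<noteq> {}"
  shows "truncated_curve K N = frontier (K \<inter> square N)"
proof -
  let ?C = "cbox (vec (- real N)) (vec (real N)) :: (real^2) set"
  have int: "interior (K \<inter> ?C) = K \<inter> square N" using K(1) by (simp add: interior_open square_def)
  have "closure (K \<inter> square N) = closure (K \<inter> ?C)"
    using convex_closure_interior[of "K \<inter> ?C"] K(2) ne int by (simp add: convex_Int)
  moreover have "interior (K \<inter> square N) = K \<inter> square N" using K(1) open_square by (simp add: interior_open open_Int)
  ultimately show ?thesis unfolding truncated_curve_def frontier_def int by simp
qed

lemma sets_affine_arclength: "sets (affine_arclength K) = sets (restrict_space borel (frontier K))"
proof (cases "bounded K")
  case True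
  then show ?thesis by (simp add: affine_arclength_def compact_affine_arclength_def split: prod.split)
next
  case False
  have "space (restrict_space borel (frontier K)) = frontier K" by (simp add: space_restrict_space)
  then show ?thesis
    using False sets.sigma_sets_eq[of "restrict_space borel (frontier K)"] sets.space_closed[of "restrict_space borel (frontier K)"]
    by (simp add: affine_arclength_def sets_measure_of)
qed

theorem nn_integral_affine_arclength_le:
  assumes K: "open K" "convex K" "K \<noteq> {}"
    and fin: "\<And>x. g x < \<infinity>"
    and bound: "\<And>K c L z A. convex_param K c L z A \<Longrightarrow> (\<integral>\<^sup>+x. g x \<partial>convex_param.arclength_measure K L z) \<le> C"
  shows "(\<integral>\<^sup>+x. g x \<partial>affine_arclength K) \<le> C"
proof -
  obtain c where c: "c \<in> K" using K(3) by blast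
  show ?thesis
  proof (cases "bounded K")
    case True
    interpret convex_body K c by unfold_locales (use K c True in auto)
    show ?thesis using compact_affine_arclength_eq bound True by (metis affine_arclength_def)
  next
    case False
    define \<nu> where "\<nu> N = compact_affine_arclength (truncated_curve K N)" for N
    \<comment> \<open>All large truncations contain the same c, so their boundaries can be compared
      in polar coordinates around one centre.\<close>
    obtain N0 where N0: "norm c < real N0" using reals_Archimedean2 by blast
    have cN: "c \<in> square N" if "N0 \<le> N" for N using mem_square[of c N] N0 that by simp
    have body: "convex_body (K \<inter> square N) c" if "N0 \<le> N" for N
      by unfold_locales (use K c cN[OF that] in \<open>auto simp: square_def open_Int open_box convex_Int intro: bounded_Int\<close>)
    have ex: "\<exists>L z A. convex_param (K \<inter> square N) c L z A \<and> \<nu> N = convex_param.arclength_measure (K \<inter> square N) L z"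
      if "N0 \<le> N" for N
    proof -
      have "truncated_curve K N = frontier (K \<inter> square N)"
        by (rule truncated_curve_eq) (use K c cN[OF that] in auto)
      then show ?thesis using convex_body.compact_affine_arclength_eq[OF body[OF that]] unfolding \<nu>_def by metis
    qed
    have frontier_sq: "frontier K \<inter> square N \<subseteq> frontier (K \<inter> square N)" for N
    proof -
      have "closure K \<inter> square N \<subseteq> closure (K \<inter> square N)"
        using open_Int_closure_subset[OF open_square, of N K] by (simp add: Int_commute)
      then show ?thesis using K(1) open_square by (auto simp: frontier_def interior_open open_Int)
    qed
    have sets_\<nu>: "E \<inter> square N \<in> sets (\<nu> N)" "E \<inter> square N \<in> sets borel" "E \<inter> square N \<subseteq> frontier (K \<inter> square N)"
      if E: "E \<in> sets (restrict_space borel (frontier K))" and N: "N0 \<le> N" for E N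
    proof -
      obtain B where B: "B \<in> sets borel" "E = frontier K \<inter> B" using E by (auto simp: sets_restrict_space)
      then have "E \<in> sets borel" by (auto intro: borel_closed frontier_closed)
      then show bor: "E \<inter> square N \<in> sets borel" using open_square by auto
      show sub: "E \<inter> square N \<subseteq> frontier (K \<inter> square N)" using frontier_sq[of N] B by auto
      obtain L z A where "convex_param (K \<inter> square N) c L z A" "\<nu> N = convex_param.arclength_measure (K \<inter> square N) L z"
        using ex[OF N] by blast
      then show "E \<inter> square N \<in> sets (\<nu> N)"
        using bor sub by (auto simp: convex_param.sets_arclength_measure sets_restrict_space image_iff)
    qed
    \<comment> \<open>The measures of two truncations agree inside the smaller open square, so
      enlarging the square can only add mass.\<close>
    have incr: "emeasure (\<nu> M) (E \<inter> square M) \<le> emeasure (\<nu> N) (E \<inter> square N)"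
      if E: "E \<in> sets (restrict_space borel (frontier K))" and MN: "N0 \<le> M" "M \<le> N" for E M N
    proof -
      obtain L1 z1 A1 where 1: "convex_param (K \<inter> square M) c L1 z1 A1" "\<nu> M = convex_param.arclength_measure (K \<inter> square M) L1 z1"
        using ex MN by blast
      obtain L2 z2 A2 where 2: "convex_param (K \<inter> square N) c L2 z2 A2" "\<nu> N = convex_param.arclength_measure (K \<inter> square N) L2 z2"
        using ex[of N] MN by auto
      interpret P1: convex_param "K \<inter> square M" c L1 z1 A1 by (rule 1)
      interpret P2: convex_param "K \<inter> square N" c L2 z2 A2 by (rule 2)
      interpret convex_param_pair c "K \<inter> square M" L1 z1 A1 "K \<inter> square N" L2 z2 A2 "square M"
        by unfold_locales (use open_square square_mono[OF MN(2)] in auto)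
      have "emeasure (\<nu> M) (E \<inter> square M) = emeasure (\<nu> N) (E \<inter> square M)"
        unfolding 1(2) 2(2) by (rule emeasure_agree) (use sets_\<nu>[OF E MN(1)] in auto)
      also have "\<dots> \<le> emeasure (\<nu> N) (E \<inter> square N)"
        using sets_\<nu>[OF E, of N] MN square_mono[OF MN(2)] by (intro emeasure_mono) auto
      finally show ?thesis .
    qed
    let ?X = "\<lambda>E N. emeasure (\<nu> N) (E \<inter> square N)"
    have conv: "?X E \<longlonglongrightarrow> lim (?X E)" if "E \<in> sets (restrict_space borel (frontier K))" for E
    proof -
      have "incseq (\<lambda>n. ?X E (n + N0))" by (rule incseq_SucI) (use incr[OF that] in simp)
      then have "(\<lambda>n. ?X E (n + N0)) \<longlonglongrightarrow> (SUP n. ?X E (n + N0))" by (rule LIMSEQ_SUP)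
      then have "?X E \<longlonglongrightarrow> (SUP n. ?X E (n + N0))" by (rule LIMSEQ_offset)
      then show ?thesis by (simp add: limI)
    qed
    have aff: "affine_arclength K = measure_of (frontier K) (sets (restrict_space borel (frontier K))) (\<lambda>E. lim (?X E))"
      using False by (simp add: affine_arclength_def \<nu>_def square_def)
    show ?thesis
    proof (rule nn_integral_le_of_setwise_limit[where N = \<nu> and B = square])
      fix E assume "E \<in> sets (affine_arclength K)"
      then have E: "E \<in> sets (restrict_space borel (frontier K))" by (simp add: sets_affine_arclength)
      \<comment> \<open>Should the limit fail to be a measure, \<open>measure_of\<close> would
        assign 0; the inequality covers both possibilities.\<close>
      have "emeasure (affine_arclength K) E \<le> lim (?X E)" unfolding aff emeasure_measure_of_conv by simp
      then show "\<exists>l. emeasure (affine_arclength K) E \<le> l \<and> ?X E \<longlonglongrightarrow> l" using conv[OF E] by blast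
    next
      show "\<forall>\<^sub>F n in sequentially. \<forall>E\<in>sets (affine_arclength K). E \<inter> square n \<in> sets (\<nu> n)"
        using eventually_ge_at_top[of N0] by eventually_elim (use sets_\<nu>(1) sets_affine_arclength in auto)
      show "\<forall>\<^sub>F n in sequentially. (\<integral>\<^sup>+x. g x \<partial>\<nu> n) \<le> C"
        using eventually_ge_at_top[of N0] by eventually_elim (use ex bound in metis)
    qed (rule fin)
  qed
qed

section \<open>The restriction theorem\<close>

lemma inverse_inverse_ennreal: "inverse (inverse x) = (x :: ennreal)"
proof (cases x)
  case (real r)
  then show ?thesis by (cases "r = 0") (auto simp: inverse_ennreal)
qed simp

lemma fourier_eq_fourier2: "fourier f = fourier2 f"
  by (simp add: fun_eq_iff fourier_def fourier2_def fchar_def)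

lemma schwartz_borel_measurable: "schwartz f \<Longrightarrow> f \<in> borel_measurable borel"
proof -
  assume "schwartz f"
  then have "f differentiable (at x)" for x unfolding schwartz_def by (metis foldr.simps(1) id_apply)
  then have "continuous_on UNIV f" by (simp add: continuous_at_imp_continuous_on differentiable_imp_continuous_within)
  then show ?thesis by (rule borel_measurable_continuous_onI)
qed

text \<open>The unimodular factor does not affect integrability, and the integral of a
  non-integrable function is 0 by convention. This default settles the case of a non-integrable f in
  the estimates below.\<close>

lemma fourier2_not_integrable:
  assumes [measurable]: "f \<in> borel_measurable borel" and "\<not> integrable lborel f"
  shows "fourier2 f \<xi> = 0"
  unfolding fourier2_def
proof (rule not_integrable_integral_eq)
  have "(\<lambda>x. f x * fchar x \<xi>) \<in> borel_measurable lborel" by measurable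
  then have "integrable lborel (\<lambda>x. f x * fchar x \<xi>) \<longleftrightarrow> integrable lborel f"
    using assms(1) by (simp add: integrable_iff_bounded norm_mult)
  then show "\<not> integrable lborel (\<lambda>x. f x * fchar x \<xi>)" using assms by simp
qed

lemma fourier2_scale: "fourier2 (\<lambda>x. of_real a * f x) \<xi> = of_real a * fourier2 f \<xi>"
  unfolding fourier2_def by (simp add: mult.assoc)

lemma Lq_norm_zero: "(\<And>x. g x = 0) \<Longrightarrow> q \<noteq> \<infinity> \<Longrightarrow> Lq_norm q M g = 0"
  by (simp add: Lq_norm_def)

lemma Lq_norm_finite_exponent:
  "0 < p \<Longrightarrow> Lq_norm (ennreal p) M g = (let I = (\<integral>\<^sup>+x. ennreal (norm (g x) powr p) \<partial>M) in
     if I = \<infinity> then \<infinity> else ennreal (enn2real I powr (1 / p)))"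
  by (simp add: Lq_norm_def Let_def)

text \<open>The value of r inverts p = 2 * r / (r + 1). The estimate for normalized data extends by
  homogeneity, which is why \<open>B\<close> appears with the power 1 / q.\<close>

lemma restriction_Lq:
  assumes p: "1 < p" "p < 4 / 3" and K: "open K" "convex K" "K \<noteq> {}" and f: "f \<in> borel_measurable borel"
  defines "r \<equiv> p / (2 - p)" and "q \<equiv> p / (3 * (p - 1))"
  defines "B \<equiv> 10 * (1 + extension_const r) powr q"
  shows "Lq_norm (ennreal q) (affine_arclength K) (fourier2 f) \<le> ennreal (B powr (1 / q)) * Lq_norm (ennreal p) lborel f"
proof -
  note [measurable] = f
  have r: "1 < r" "r < 2" using p by (auto simp: r_def field_simps)
  have pr: "2 * r / (r + 1) = p" "2 * r / (3 * (r - 1)) = q"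
    using p unfolding r_def q_def by (simp_all add: divide_simps)
  have q: "0 < q" using p by (simp add: q_def)
  have B: "0 < B" using extension_const_nonneg[OF r] by (simp add: B_def)
  define J where "J = (\<integral>\<^sup>+x. ennreal (norm (f x) powr p) \<partial>lborel)"
  define I where "I = (\<integral>\<^sup>+x. ennreal (norm (fourier2 f x) powr q) \<partial>affine_arclength K)"
  have unit: "(\<integral>\<^sup>+x. ennreal (norm (fourier2 h x) powr q) \<partial>affine_arclength K) \<le> ennreal B"
    if h: "integrable lborel h" and hp: "(\<integral>\<^sup>+x. ennreal (norm (h x) powr p) \<partial>lborel) \<le> 1" for h
  proof (rule nn_integral_affine_arclength_le[OF K])
    fix K c L z A assume "convex_param K c L z A"
    then interpret convex_param K c L z A .
    show "(\<integral>\<^sup>+x. ennreal (norm (fourier2 h x) powr q) \<partial>arclength_measure) \<le> ennreal B"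
      using restriction_arclength_measure[OF r h] hp unfolding pr B_def by simp
  qed simp
  \<comment> \<open>Scaling by the norm of f needs it finite and nonzero. If f is not integrable or
    vanishes almost everywhere, the left side is 0; if the norm is infinite, so is the right side,
    because B > 0.\<close>
  consider "\<not> integrable lborel f" | "J = \<infinity>" | "J = 0" | "integrable lborel f" "J \<noteq> \<infinity>" "J \<noteq> 0" by blast
  then show ?thesis
  proof cases
    case 1
    then show ?thesis using fourier2_not_integrable[OF f] by (simp add: Lq_norm_zero)
  next
    case 2
    then show ?thesis using p B by (simp add: Lq_norm_finite_exponent Let_def J_def[symmetric] ennreal_mult_top)
  next
    case 3
    have "AE x in lborel. ennreal (norm (f x) powr p) = 0"
      using 3 unfolding J_def by (subst (asm) nn_integral_0_iff_AE) auto
    then have "AE x in lborel. f x = 0" by eventually_elim simp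
    then have "fourier2 f \<xi> = 0" for \<xi>
      unfolding fourier2_def by (intro integral_eq_zero_AE) (auto elim: eventually_mono)
    then show ?thesis by (simp add: Lq_norm_zero)
  next
    case 4
    define N where "N = enn2real J powr (1 / p)"
    have Jr: "J = ennreal (enn2real J)" "0 < enn2real J"
      using 4(2,3) by (simp_all add: enn2real_positive_iff top.not_eq_extremum zero_less_iff_neq_zero)
    have N: "0 < N" using Jr(2) by (simp add: N_def)
    have Np: "N powr p = enn2real J" using Jr(2) p by (simp add: N_def powr_powr)
    define h where "h x = of_real (1 / N) * f x" for x
    have hi: "integrable lborel h" unfolding h_def using 4(1) by simp
    have "(\<integral>\<^sup>+x. ennreal (norm (h x) powr p) \<partial>lborel) = (\<integral>\<^sup>+x. ennreal (1 / enn2real J) * ennreal (norm (f x) powr p) \<partial>lborel)"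
    proof (intro nn_integral_cong)
      fix x
      have "norm (h x) powr p = 1 / enn2real J * norm (f x) powr p"
        using N by (simp add: h_def norm_mult norm_divide powr_mult powr_divide Np)
      then show "ennreal (norm (h x) powr p) = ennreal (1 / enn2real J) * ennreal (norm (f x) powr p)"
        using Jr(2) by (simp add: ennreal_mult'[symmetric])
    qed
    also have "\<dots> = ennreal (1 / enn2real J) * J" unfolding J_def by (rule nn_integral_cmult) measurable
    also have "\<dots> = ennreal (1 / enn2real J * enn2real J)" using Jr by (metis ennreal_mult'' less_imp_le)
    also have "\<dots> = 1" using Jr(2) by simp
    finally have hp: "(\<integral>\<^sup>+x. ennreal (norm (h x) powr p) \<partial>lborel) \<le> 1" by simp
    have fh: "fourier2 f x = of_real N * fourier2 h x" for x
      unfolding fourier2_scale[symmetric] using N by (simp add: h_def)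
    have meas: "(\<lambda>x. ennreal (norm (fourier2 h x) powr q)) \<in> borel_measurable (affine_arclength K)"
    proof -
      have [measurable]: "h \<in> borel_measurable borel" using hi by auto
      have "(\<lambda>x. ennreal (norm (fourier2 h x) powr q)) \<in> borel_measurable (restrict_space borel (frontier K))"
        by (rule measurable_restrict_space1) measurable
      then show ?thesis using measurable_cong_sets[OF sets_affine_arclength[of K] refl] by blast
    qed
    have "I = (\<integral>\<^sup>+x. ennreal (N powr q) * ennreal (norm (fourier2 h x) powr q) \<partial>affine_arclength K)"
      unfolding I_def fh using N by (simp add: norm_mult powr_mult ennreal_mult)
    also have "\<dots> = ennreal (N powr q) * (\<integral>\<^sup>+x. ennreal (norm (fourier2 h x) powr q) \<partial>affine_arclength K)"
      by (rule nn_integral_cmult[OF meas])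
    also have "\<dots> \<le> ennreal (N powr q) * ennreal B" by (intro mult_left_mono unit hi hp) simp
    also have "\<dots> = ennreal (N powr q * B)" by (simp add: ennreal_mult')
    finally have I: "I \<le> ennreal (N powr q * B)" .
    then have Ifin: "I \<noteq> \<infinity>" by (auto simp: top_unique)
    have "enn2real I \<le> N powr q * B" using enn2real_mono[OF I] B by simp
    then have "enn2real I powr (1 / q) \<le> (N powr q * B) powr (1 / q)" using q by (intro powr_mono2) auto
    also have "\<dots> = B powr (1 / q) * N" using q N B by (simp add: powr_mult powr_powr)
    finally have "ennreal (enn2real I powr (1 / q)) \<le> ennreal (B powr (1 / q) * N)" by (rule ennreal_leI)
    then show ?thesis
      using p q 4(2) Ifin by (simp add: Lq_norm_finite_exponent Let_def J_def[symmetric] I_def[symmetric] N_def ennreal_mult')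
  qed
qed

text \<open>The sup bound on the Fourier transform holds at every point, so the measure enters only
  through the measurability that \<open>esssup\<close> asks for.\<close>

lemma restriction_L1:
  assumes f: "f \<in> borel_measurable borel"
  shows "Lq_norm \<infinity> (affine_arclength K) (fourier2 f) \<le> Lq_norm 1 lborel f"
proof -
  note [measurable] = f
  have "(\<lambda>x. ennreal (norm (fourier2 f x))) \<in> borel_measurable (restrict_space borel (frontier K))"
    by (rule measurable_restrict_space1) measurable
  then have meas: "(\<lambda>x. ennreal (norm (fourier2 f x))) \<in> borel_measurable (affine_arclength K)"
    using measurable_cong_sets[OF sets_affine_arclength[of K] refl] by blast
  have "ennreal (norm (fourier2 f x)) \<le> (\<integral>\<^sup>+y. ennreal (norm (f y)) \<partial>lborel)" for x
  proof (cases "integrable lborel f")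
    case True
    then show ?thesis using norm_fourier2_le[of f x] by (subst nn_integral_eq_integral) (auto intro: ennreal_leI)
  qed (simp add: fourier2_not_integrable[OF f])
  then have "esssup (affine_arclength K) (\<lambda>x. ennreal (norm (fourier2 f x))) \<le> (\<integral>\<^sup>+y. ennreal (norm (f y)) \<partial>lborel)"
    by (intro esssup_I meas) simp
  moreover have "Lq_norm 1 lborel f = (\<integral>\<^sup>+y. ennreal (norm (f y)) \<partial>lborel)"
    using Lq_norm_finite_exponent[of 1 lborel f] by (simp add: Let_def ennreal_enn2real_if)
  ultimately show ?thesis by (simp add: Lq_norm_def)
qed

theorem corollary1p4:
  fixes p :: real and p' q :: ennreal
  assumes "1 \<le> p" and "p < 4 / 3"
    and "1 / ennreal p + 1 / p' = 1"
    and "q = p' / 3"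
  shows "\<exists>C::real. \<forall>K :: (real^2) set. open K \<and> convex K \<and> K \<noteq> {} \<longrightarrow>
           (\<forall>f. schwartz f \<longrightarrow>
              Lq_norm q (affine_arclength K) (fourier f) \<le> ennreal C * Lq_norm (ennreal p) lborel f)"
proof -
  have inv_p: "1 / ennreal p = ennreal (1 / p)" using assms(1) by (simp add: divide_ennreal flip: ennreal_1)
  have "1 / p' = 1 - ennreal (1 / p)"
    using assms(3) unfolding inv_p by (metis ennreal_add_diff_cancel_left ennreal_neq_top)
  also have "\<dots> = ennreal (1 - 1 / p)" using assms(1) by (simp add: ennreal_minus flip: ennreal_1)
  finally have "inverse p' = ennreal (1 - 1 / p)" by (simp add: divide_ennreal_def)
  \<comment> \<open>Inversion in the extended reals treats p = 1 uniformly: the inverse of 0 is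
    \<infinity>.\<close>
  then have p': "p' = inverse (ennreal (1 - 1 / p))" by (metis inverse_inverse_ennreal)
  show ?thesis
  proof (cases "p = 1")
    case True
    \<comment> \<open>For the extended reals \<infinity> / 3 is again \<infinity>, which selects the
      essential supremum in \<open>Lq_norm\<close>.\<close>
    then have "q = \<infinity>" using assms(4) p' by (simp add: ennreal_top_divide)
    then show ?thesis
      using True restriction_L1[OF schwartz_borel_measurable] by (intro exI[of _ 1]) (simp add: fourier_eq_fourier2)
  next
    case False
    then have p: "1 < p" using assms(1) by simp
    then have "p' = ennreal (p / (p - 1))"
      unfolding p' by (subst inverse_ennreal) (auto simp: field_simps)
    then have "q = ennreal (p / (3 * (p - 1)))"
      using p assms(4) divide_ennreal[of "p / (p - 1)" 3] by (simp add: mult.commute)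
    then show ?thesis
      using restriction_Lq[OF p assms(2) _ _ _ schwartz_borel_measurable] unfolding fourier_eq_fourier2 by blast
  qed
qed

end
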